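(* Let $b_1<0<b_2$ and $Q_{12},Q_{21}\in L^1[0,1]$ (complex-valued). For $\lambda\in\mathbb{C}$ let $e_\pm(\cdot;\lambda)$ be the solutions of the system $$-iB^{-1}y'+Q(x)y=\lambda y,\quad x\in[0,1],\qquad B=\operatorname{diag}(b_1,b_2),\quad Q=\begin{pmatrix}0&Q_{12}\\Q_{21}&0\end{pmatrix},$$ satisfying the initial conditions $e_\pm(0;\lambda)=\binom{1}{\pm1}$. Then $e_\pm(\cdot;\lambda)$ admits the following representation by means of a triangular transformation operator: $$e_\pm(x;\lambda)=(I+K^\pm)e^0_\pm(x;\lambda)=e^0_\pm(x;\lambda)+\int_0^x K^\pm(x,t)\,e^0_\pm(t;\lambda)\,dt,\qquad x\in[0,1],\ \lambda\in\mathbb{C},$$ where $$e^0_\pm(x;\lambda)=\binom{e^{ib_1\lambda x}}{\pm e^{ib_2\lambda x}},\qquad K^\pm(x,t)=\bigl(K^\pm_{jk}(x,t)\bigr)_{j,k=1}^2,$$ with kernels (not depending on $\lambda$) $K^\pm(\cdot,\cdot)\in X_{1,0}^{2\times2}(\Omega)\cap X_{\infty,0}^{2\times2}(\Omega)$. In particular, the operator $K^\pm: f\mapsto\int_0^xK^\pm(x,t)f(t)\,dt$ is a Volterra operator in $L^p([0,1];\mathbb{C}^2)$ for each $p\in[1,\infty]$, hence $\sigma(K^\pm)=\{0\}$.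
   Context: Let $\Omega=\{(x,t):0\le t\le x\le1\}$. $X_1(\Omega)$ and $X_\infty(\Omega)$ are the Banach spaces of (classes of) measurable functions $f$ on $\Omega$ with finite norms $$\|f\|_{X_1}=\operatorname*{ess\,sup}_{t\in[0,1]}\int_t^1|f(x,t)|\,dx,\qquad \|f\|_{X_\infty}=\operatorname*{ess\,sup}_{x\in[0,1]}\int_0^x|f(x,t)|\,dt,$$ respectively. $X_{1,0}(\Omega)$ and $X_{\infty,0}(\Omega)$ are the closures of $C(\Omega)$ in $X_1(\Omega)$ and $X_\infty(\Omega)$. $X_{1,0}^{2\times2}(\Omega)$, $X_{\infty,0}^{2\times2}(\Omega)$ are the spaces of $2\times2$ matrix functions with all entries in $X_{1,0}(\Omega)$, $X_{\infty,0}(\Omega)$ respectively. For each $a\in[0,1]$ the trace map $N\mapsto N(a,\cdot)$, defined on $C(\Omega)$, extends continuously to $X_{\infty,0}(\Omega)\to L^1[0,a]$, so that $N(x,\cdot)\in L^1[0,x]$ makes sense for every $x$. A Volterra operator in a Banach space is a compact operator with spectrum $\{0\}$. *)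

theory Defs
  imports "HOL-Analysis.Analysis" "HOL-Probability.Essential_Supremum"
begin

section \<open>Absolutely continuous functions and the first order system\<close>

definition abs_continuous_on_interval :: "real \<Rightarrow> real \<Rightarrow> (real \<Rightarrow> 'a::real_normed_vector) \<Rightarrow> bool" where
  "abs_continuous_on_interval l r f \<longleftrightarrow>
     (\<forall>\<epsilon>>0. \<exists>\<delta>>0. \<forall>(n::nat) a b.
        (\<forall>i<n. l \<le> a i \<and> a i \<le> b i \<and> b i \<le> r) \<and>
        disjoint_family_on (\<lambda>i. {a i<..<b i}) {..<n} \<and>
        (\<Sum>i<n. b i - a i) < \<delta>
        \<longrightarrow> (\<Sum>i<n. norm (f (b i) - f (a i))) < \<epsilon>)"

definition B_mat :: "real \<Rightarrow> real \<Rightarrow> complex^2^2" where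
  "B_mat b1 b2 = vector [vector [of_real b1, 0], vector [0, of_real b2]]"

definition Q_mat :: "(real \<Rightarrow> complex) \<Rightarrow> (real \<Rightarrow> complex) \<Rightarrow> real \<Rightarrow> complex^2^2" where
  "Q_mat Q12 Q21 x = vector [vector [0, Q12 x], vector [Q21 x, 0]]"

text \<open>The coefficients are merely integrable, so solutions are taken in the Caratheodory sense:
  absolutely continuous functions satisfying the system almost everywhere.\<close>

definition is_solution ::
  "real \<Rightarrow> real \<Rightarrow> (real \<Rightarrow> complex) \<Rightarrow> (real \<Rightarrow> complex) \<Rightarrow> complex \<Rightarrow> (real \<Rightarrow> complex^2) \<Rightarrow> bool" where
  "is_solution b1 b2 Q12 Q21 lam y \<longleftrightarrow>
     abs_continuous_on_interval 0 1 y \<and>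
     (AE x in lebesgue_on {0..1}. \<exists>y'.
        (y has_vector_derivative y') (at x within {0..1}) \<and>
        (- \<i>) *s (matrix_inv (B_mat b1 b2) *v y') + Q_mat Q12 Q21 x *v y x = lam *s y x)"

text \<open>The sign in \<open>e\<^sup>0\<^sub>\<plusminus>\<close> is the parameter \<open>s\<close>, equal to \<open>1\<close> or \<open>-1\<close>.\<close>

definition e0 :: "real \<Rightarrow> real \<Rightarrow> complex \<Rightarrow> complex \<Rightarrow> real \<Rightarrow> complex^2" where
  "e0 b1 b2 s lam x =
     vector [exp (\<i> * of_real b1 * lam * of_real x), s * exp (\<i> * of_real b2 * lam * of_real x)]"


section \<open>The spaces $X_1$, $X_\infty$ on the triangle and their subspaces $X_{1,0}$, $X_{\infty,0}$\<close>

text \<open>Elements of the spaces are represented by functions on the plane whose values off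
  \<open>Omega\<close> are irrelevant; all conditions are invariant under changes on null subsets of
  \<open>Omega\<close>.\<close>

definition Omega :: "(real \<times> real) set" where
  "Omega = {(x, t). 0 \<le> t \<and> t \<le> x \<and> x \<le> 1}"

definition X1_norm :: "(real \<times> real \<Rightarrow> complex) \<Rightarrow> ennreal" where
  "X1_norm f = esssup (lebesgue_on {0..1})
     (\<lambda>t. \<integral>\<^sup>+x\<in>{t..1}. ennreal (norm (f (x, t))) \<partial>lebesgue)"

definition Xinf_norm :: "(real \<times> real \<Rightarrow> complex) \<Rightarrow> ennreal" where
  "Xinf_norm f = esssup (lebesgue_on {0..1})
     (\<lambda>x. \<integral>\<^sup>+t\<in>{0..x}. ennreal (norm (f (x, t))) \<partial>lebesgue)"

definition X1_space :: "(real \<times> real \<Rightarrow> complex) set" where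
  "X1_space = {f. f \<in> borel_measurable (lebesgue_on Omega) \<and> X1_norm f < \<infinity>}"

definition Xinf_space :: "(real \<times> real \<Rightarrow> complex) set" where
  "Xinf_space = {f. f \<in> borel_measurable (lebesgue_on Omega) \<and> Xinf_norm f < \<infinity>}"

definition X1_0_space :: "(real \<times> real \<Rightarrow> complex) set" where
  "X1_0_space = {f \<in> X1_space. \<forall>\<epsilon>>0. \<exists>g. continuous_on Omega g \<and>
     X1_norm (\<lambda>z. f z - g z) < ennreal \<epsilon>}"

definition Xinf_0_space :: "(real \<times> real \<Rightarrow> complex) set" where
  "Xinf_0_space = {f \<in> Xinf_space. \<forall>\<epsilon>>0. \<exists>g. continuous_on Omega g \<and>
     Xinf_norm (\<lambda>z. f z - g z) < ennreal \<epsilon>}"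

text \<open>\<open>is_trace N a h\<close>: the function \<open>h\<close> represents the value at \<open>N\<close> of the continuous
  extension \<open>X\<^bsub>\<infinity>,0\<^esub> \<rightarrow> L\<^sup>1[0,a]\<close> of the map \<open>g \<mapsto> g(a,\<cdot>)\<close> on continuous functions, that is, \<open>h\<close> is
  the \<open>L\<^sup>1\<close>-limit of \<open>g\<^sub>n(a,\<cdot>)\<close> for all continuous \<open>g\<^sub>n\<close> converging to \<open>N\<close>. Such \<open>h\<close>
  is unique up to null sets.\<close>

definition is_trace :: "(real \<times> real \<Rightarrow> complex) \<Rightarrow> real \<Rightarrow> (real \<Rightarrow> complex) \<Rightarrow> bool" where
  "is_trace N a h \<longleftrightarrow>
     N \<in> Xinf_0_space \<and>
     set_integrable lebesgue {0..a} h \<and>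
     (\<forall>g :: nat \<Rightarrow> real \<times> real \<Rightarrow> complex.
        (\<forall>n. continuous_on Omega (g n)) \<and> (\<lambda>n. Xinf_norm (\<lambda>z. N z - g n z)) \<longlonglongrightarrow> 0
        \<longrightarrow> (\<lambda>n. \<integral>\<^sup>+t\<in>{0..a}. ennreal (norm (g n (a, t) - h t)) \<partial>lebesgue) \<longlonglongrightarrow> 0)"

definition triangular_op ::
  "(real \<times> real \<Rightarrow> complex^2^2) \<Rightarrow> (real \<Rightarrow> complex^2) \<Rightarrow> real \<Rightarrow> complex^2" where
  "triangular_op K f x = (LINT t:{0..x}|lebesgue. K (x, t) *v f t)"


section \<open>Operators in $L^p$\<close>

text \<open>Elements of \<open>L\<^sup>p(M)\<close> are represented by functions, with equality of elements being
  equality almost everywhere; operators act on representatives and are required to respect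
  this equality.\<close>

definition Lp_norm :: "'a measure \<Rightarrow> ennreal \<Rightarrow> ('a \<Rightarrow> 'b::real_normed_vector) \<Rightarrow> ennreal" where
  "Lp_norm M p f =
     (if p = \<infinity> then esssup M (\<lambda>x. ennreal (norm (f x)))
      else let I = (\<integral>\<^sup>+x. ennreal (norm (f x) powr enn2real p) \<partial>M)
           in if I = \<infinity> then \<infinity> else ennreal (enn2real I powr (1 / enn2real p)))"

definition Lp_space :: "'a measure \<Rightarrow> ennreal \<Rightarrow> ('a \<Rightarrow> 'b::real_normed_vector) set" where
  "Lp_space M p = {f. f \<in> borel_measurable M \<and> Lp_norm M p f < \<infinity>}"

definition Lp_linear_op ::
  "'a measure \<Rightarrow> ennreal \<Rightarrow> (('a \<Rightarrow> complex^'n) \<Rightarrow> 'a \<Rightarrow> complex^'n) \<Rightarrow> bool" where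
  "Lp_linear_op M p T \<longleftrightarrow>
     (\<forall>f\<in>Lp_space M p. T f \<in> Lp_space M p) \<and>
     (\<forall>f\<in>Lp_space M p. \<forall>g\<in>Lp_space M p.
        (AE x in M. f x = g x) \<longrightarrow> (AE x in M. T f x = T g x)) \<and>
     (\<forall>f\<in>Lp_space M p. \<forall>g\<in>Lp_space M p. AE x in M. T (\<lambda>z. f z + g z) x = T f x + T g x) \<and>
     (\<forall>c. \<forall>f\<in>Lp_space M p. AE x in M. T (\<lambda>z. c *s f z) x = c *s T f x)"

definition Lp_bounded_op ::
  "'a measure \<Rightarrow> ennreal \<Rightarrow> (('a \<Rightarrow> complex^'n) \<Rightarrow> 'a \<Rightarrow> complex^'n) \<Rightarrow> bool" where
  "Lp_bounded_op M p T \<longleftrightarrow>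
     Lp_linear_op M p T \<and>
     (\<exists>C::real. \<forall>f\<in>Lp_space M p. Lp_norm M p (T f) \<le> ennreal C * Lp_norm M p f)"

definition Lp_compact_op ::
  "'a measure \<Rightarrow> ennreal \<Rightarrow> (('a \<Rightarrow> complex^'n) \<Rightarrow> 'a \<Rightarrow> complex^'n) \<Rightarrow> bool" where
  "Lp_compact_op M p T \<longleftrightarrow>
     Lp_linear_op M p T \<and>
     (\<forall>(f :: nat \<Rightarrow> 'a \<Rightarrow> complex^'n) (C::real).
        (\<forall>n. f n \<in> Lp_space M p \<and> Lp_norm M p (f n) \<le> ennreal C) \<longrightarrow>
        (\<exists>g\<in>Lp_space M p. \<exists>r::nat \<Rightarrow> nat. strict_mono r \<and>
           (\<lambda>n. Lp_norm M p (\<lambda>x. T (f (r n)) x - g x)) \<longlonglongrightarrow> 0))"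

definition Lp_spectrum ::
  "'a measure \<Rightarrow> ennreal \<Rightarrow> (('a \<Rightarrow> complex^'n) \<Rightarrow> 'a \<Rightarrow> complex^'n) \<Rightarrow> complex set" where
  "Lp_spectrum M p T =
     {\<mu>. \<not> (\<exists>R. Lp_bounded_op M p R \<and>
             (\<forall>f\<in>Lp_space M p. AE x in M. R (\<lambda>z. T f z - \<mu> *s f z) x = f x) \<and>
             (\<forall>f\<in>Lp_space M p. AE x in M. T (R f) x - \<mu> *s R f x = f x))}"

definition Lp_Volterra_op ::
  "'a measure \<Rightarrow> ennreal \<Rightarrow> (('a \<Rightarrow> complex^'n) \<Rightarrow> 'a \<Rightarrow> complex^'n) \<Rightarrow> bool" where
  "Lp_Volterra_op M p T \<longleftrightarrow> Lp_compact_op M p T \<and> Lp_spectrum M p T = {0}"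

end

theory Submission
  imports Defs "HOL-Complex_Analysis.Great_Picard"
begin

text \<open>Each component of a solution is its free exponential plus an integral of
  \<open>exp(i\<lambda>u)\<close> over \<open>u \<in> [b\<^sub>1x, b\<^sub>2x]\<close>, and the density is found before \<open>\<lambda>\<close> enters: in characteristic
  coordinates it solves a pair of Volterra equations of Goursat type,
  \<open>s\<^sub>i(x,\<xi>) = c\<^sub>i q\<^sub>i(\<xi>) + \<integral>\<^sub>\<xi>\<^sup>x q\<^sub>i(\<sigma>) s\<^sub>j(\<sigma>, \<sigma>-\<xi>) d\<sigma>\<close> up to scaling, whose Neumann series
  converges thanks to an exponential weight. Since \<open>b\<^sub>1 < 0 < b\<^sub>2\<close>, the parts \<open>u < 0\<close> and \<open>u > 0\<close>
  of the integral become integrals over \<open>0 \<le> t \<le> x\<close> of the two free exponentials, and this is \<open>K\<close>.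
  Contraction in the same kind of weight identifies the resulting function with the solution.

  Approximating \<open>Q\<close> in \<open>L\<^sup>1\<close> by continuous functions approximates \<open>K\<close> by continuous kernels
  in both mixed norms at once, uniformly in the free variable. This gives the membership in the two
  closures and the traces, and, with bounds of Schur type for operators on \<open>L\<^sup>p\<close>, the compactness.
  In a large exponential weight the operator has arbitrarily small norm, so every
  \<open>\<mu> \<noteq> 0\<close> is a regular value, while \<open>0\<close> is not because a compact operator on an infinite-dimensional
  space is not invertible.\<close>

section \<open>Integration of absolutely continuous functions\<close>

text \<open>With u_i = exp(- \<i> * lam * b_i * x) * e_i the system becomes u_i' = q_i * exp(d_i *
  x) * u_j, where j is the other index and d_j = - d_i. Insert u_i = \<gamma>_i + integral of S_i(x,
  y) * exp(d_i * y) over {0..x}: since exp(d_i * t) * exp(d_j * y) = exp(d_i * (t - y)), the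
  spectral parameter cancels and an equation for S alone remains.

  The obstacle is that q is merely integrable. Thus S is in general neither continuous nor bounded
  and is given by a series that may diverge at some points, while traces are asserted at every x and
  the estimates must hold for every fixed t as well. Fubini's theorem would yield almost every
  section. All estimates are therefore made on each single section, and along each line into which a
  section with fixed t is carried by the change of coordinates. A majorant with values in
  [0, \<infinity>] marks the points where the equation for S may be used. Integration against an
  integrable q preserves bounded continuous functions, so inside the integral operator q stays as it
  is and the free term alone is replaced by a continuous function.\<close>

lemma tagged_division_variation_null:
  fixes f :: "real \<Rightarrow> 'a::real_normed_vector"
  assumes \<delta>: "\<And>n a b. (\<forall>i<n. l \<le> a i \<and> a i \<le> b i \<and> b i \<le> r) \<and>
        disjoint_family_on (\<lambda>i. {a i<..<b i}) {..<n::nat} \<and>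
        (\<Sum>i<n. b i - a i) < \<delta> \<Longrightarrow> (\<Sum>i<n. norm (f (b i) - f (a i))) < e"
    and p: "p tagged_division_of {l..r}" and pp: "pp \<subseteq> p"
    and U: "U \<in> lmeasurable" "measure lebesgue U < \<delta>"
    and sub: "\<And>x K. (x, K) \<in> pp \<Longrightarrow> K \<subseteq> U"
  shows "(\<Sum>(x,K)\<in>pp. norm (f (Sup K) - f (Inf K))) < e"
proof -
  note tag = tagged_division_ofD[OF p[folded box_real(2)]]
  have fin: "finite pp" using finite_subset[OF pp] p by blast
  \<comment> \<open>Absolute continuity is stated for indexed families while a tagged division is a
    set of pairs; numbering the pairs translates one into the other. Degenerate intervals are
    harmless, since a i = b i is permitted.\<close>
  obtain h n where h: "bij_betw h {..<n::nat} pp"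
    using ex_bij_betw_nat_finite[OF fin] by (auto simp: atLeast0LessThan)
  define a where "a i = Inf (snd (h i))" for i
  define b where "b i = Sup (snd (h i))" for i
  have hp: "h i \<in> pp" if "i < n" for i using h that by (auto simp: bij_betw_def)
  have hi: "a i \<le> b i \<and> snd (h i) = {a i..b i} \<and> snd (h i) \<subseteq> {l..r} \<and> snd (h i) \<subseteq> U" if "i < n" for i
  proof -
    obtain x K where xK: "h i = (x, K)" by force
    with hp[OF that] pp have in_p: "(x, K) \<in> p" "(x,K) \<in> pp" by auto
    obtain u v where K: "K = {u..v}" using tag(4)[OF in_p(1)] by (auto simp: box_real)
    have "u \<le> v" using tag(2)[OF in_p(1)] K by auto
    then show ?thesis using tag(3)[OF in_p(1)] sub[OF in_p(2)] by (auto simp: a_def b_def xK K box_real)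
  qed
  have dis: "disjoint_family_on (\<lambda>i. {a i<..<b i}) {..<n}"
    unfolding disjoint_family_on_def
  proof (intro ballI impI)
    fix i j assume ij: "i \<in> {..<n}" "j \<in> {..<n}" "i \<noteq> j"
    have "h i \<noteq> h j" using h ij by (auto simp: bij_betw_def inj_on_def)
    moreover have "h i \<in> p" "h j \<in> p" using hp ij pp by auto
    ultimately have "interior (snd (h i)) \<inter> interior (snd (h j)) = {}"
      using tag(5)[of "fst (h i)" "snd (h i)" "fst (h j)" "snd (h j)"] by auto
    then show "{a i<..<b i} \<inter> {a j<..<b j} = {}" using hi ij by auto
  qed
  have m: "measure lebesgue {a i<..<b i} = b i - a i" if "i < n" for i
    using hi[OF that] by simp
  \<comment> \<open>The open intervals are disjoint and contained in U, so their total length is at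
    most the measure of U.\<close>
  have "(\<Sum>i<n. b i - a i) = (\<Sum>i<n. measure lebesgue {a i<..<b i})"
    using m by (intro sum.cong) auto
  also have "\<dots> = measure lebesgue (\<Union>i<n. {a i<..<b i})"
  proof (intro measure_finite_Union[symmetric])
    show "emeasure lebesgue {a i<..<b i} \<noteq> \<infinity>" if "i \<in> {..<n}" for i
      using hi[of i] that by simp
  qed (use dis in auto)
  also have "\<dots> \<le> measure lebesgue U"
  proof (rule measure_mono_fmeasurable)
    show "(\<Union>i<n. {a i<..<b i}) \<subseteq> U"
    proof
      fix z assume "z \<in> (\<Union>i<n. {a i<..<b i})"
      then obtain i where "i < n" "z \<in> {a i<..<b i}" by auto
      then show "z \<in> U" using hi[of i] by fastforce
    qed
  qed (use U in auto)
  finally have "(\<Sum>i<n. b i - a i) < \<delta>" using U by simp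
  then have "(\<Sum>i<n. norm (f (b i) - f (a i))) < e"
    using hi dis by (intro \<delta>) fastforce
  also have "(\<Sum>i<n. norm (f (b i) - f (a i))) = (\<Sum>x\<in>pp. case x of (x,K) \<Rightarrow> norm (f (Sup K) - f (Inf K)))"
    unfolding sum.reindex_bij_betw[OF h, symmetric] by (simp add: a_def b_def split_beta)
  finally show ?thesis .
qed

text \<open>Tags in the exceptional set are made harmless by a gauge confined to an open set of small
  measure, on which absolute continuity bounds the variation of \<open>f\<close>.\<close>
theorem abs_continuous_has_integral:
  fixes f :: "real \<Rightarrow> 'a::banach"
  assumes ac: "abs_continuous_on_interval l r f" and lr: "l \<le> r"
    and deriv: "AE x in lebesgue_on {l..r}. (f has_vector_derivative g x) (at x within {l..r})"
  shows "(g has_integral (f r - f l)) {l..r}"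
proof -
  have "AE x in lebesgue. x \<in> {l..r} \<longrightarrow> (f has_vector_derivative g x) (at x within {l..r})"
    using deriv by (simp add: AE_restrict_space_iff)
  then obtain N where N: "N \<in> null_sets lebesgue"
    "\<And>x. x \<in> {l..r} \<Longrightarrow> x \<notin> N \<Longrightarrow> (f has_vector_derivative g x) (at x within {l..r})"
    by (auto elim!: AE_E3)
  \<comment> \<open>Changing g on a null set does not affect the integral. With the value 0 on N, a
    tag in N adds nothing to the Riemann sum and leaves only the increment of f to be
    estimated.\<close>
  define g' where "g' x = (if x \<in> N then 0 else g x)" for x
  have "(g' has_integral (f r - f l)) {l..r}"
    unfolding has_integral_real
  proof (intro allI impI)
    fix e0 :: real assume "e0 > 0"
    \<comment> \<open>Tags off N cost at most e * (r - l) and tags in N less than e. The 2 in the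
      denominator makes the sum strictly smaller than e0 and covers l = r.\<close>
    define e where "e = e0 / (r - l + 2)"
    have e: "e > 0" using \<open>e0 > 0\<close> lr by (simp add: e_def)
    have e0: "e * (r - l) + e < e0"
    proof -
      have "e * (r - l + 2) = e0" using lr by (simp add: e_def)
      then show ?thesis using e by (simp add: algebra_simps)
    qed
    obtain \<delta> where \<delta>: "\<delta> > 0" "\<And>n a b. (\<forall>i<n. l \<le> a i \<and> a i \<le> b i \<and> b i \<le> r) \<and>
        disjoint_family_on (\<lambda>i. {a i<..<b i}) {..<n::nat} \<and>
        (\<Sum>i<n. b i - a i) < \<delta> \<Longrightarrow> (\<Sum>i<n. norm (f (b i) - f (a i))) < e"
    proof -
      from ac e obtain \<delta> where "\<delta> > 0" "\<forall>(n::nat) a b. (\<forall>i<n. l \<le> a i \<and> a i \<le> b i \<and> b i \<le> r) \<and>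
        disjoint_family_on (\<lambda>i. {a i<..<b i}) {..<n} \<and>
        (\<Sum>i<n. b i - a i) < \<delta> \<longrightarrow> (\<Sum>i<n. norm (f (b i) - f (a i))) < e"
        unfolding abs_continuous_on_interval_def by blast
      then show ?thesis by (intro that[of \<delta>]) auto
    qed
    obtain U where U: "open U" "N \<subseteq> U" "U \<in> lmeasurable" "measure lebesgue U < \<delta>"
    proof -
      obtain T where T: "open T" "N \<subseteq> T" "T - N \<in> lmeasurable" "emeasure lebesgue (T - N) < ennreal \<delta>"
        using sets_lebesgue_outer_open[of N \<delta>] N \<delta> by auto
      have "emeasure lebesgue T = emeasure lebesgue (T - N)"
        using N T by (intro emeasure_Diff_null_set[symmetric]) auto
      then have "emeasure lebesgue T < ennreal \<delta>" using T by simp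
      moreover then have "T \<in> lmeasurable"
        using T by (intro fmeasurableI) (auto intro: less_trans)
      ultimately show ?thesis using that T
        by (simp add: emeasure_eq_measure2 ennreal_less_iff)
    qed
    have "\<forall>x. \<exists>d>0. (x \<in> {l..r} - N \<longrightarrow>
         (\<forall>y\<in>{l..r}. norm (y-x) < d \<longrightarrow> norm (f y - f x - (y-x) *\<^sub>R g x) \<le> e * norm (y-x))) \<and> (x \<in> N \<longrightarrow> ball x d \<subseteq> U)"
    proof
      fix x
      show "\<exists>d>0. (x \<in> {l..r} - N \<longrightarrow>
         (\<forall>y\<in>{l..r}. norm (y-x) < d \<longrightarrow> norm (f y - f x - (y-x) *\<^sub>R g x) \<le> e * norm (y-x))) \<and> (x \<in> N \<longrightarrow> ball x d \<subseteq> U)"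
      proof (cases "x \<in> N")
        case True
        then show ?thesis using U open_contains_ball by (metis DiffD2 subsetD)
      next
        case False
        show ?thesis
        proof (cases "x \<in> {l..r}")
          case True
          then show ?thesis using N(2)[OF True False] e False
            unfolding has_vector_derivative_def has_derivative_within_alt by blast
        qed (use False in \<open>auto intro: exI[of _ 1]\<close>)
      qed
    qed
    from choice[OF this] obtain d where d0: "\<forall>x. 0 < d x \<and> (x \<in> {l..r} - N \<longrightarrow>
         (\<forall>y\<in>{l..r}. norm (y-x) < d x \<longrightarrow> norm (f y - f x - (y-x) *\<^sub>R g x) \<le> e * norm (y-x))) \<and> (x \<in> N \<longrightarrow> ball x (d x) \<subseteq> U)"
      by blast
    have d: "0 < d x" "\<lbrakk>x \<in> {l..r}; x \<notin> N; y \<in> {l..r}; norm (y-x) < d x\<rbrakk>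
        \<Longrightarrow> norm (f y - f x - (y-x) *\<^sub>R g x) \<le> e * norm (y-x)"
       "x \<in> N \<Longrightarrow> ball x (d x) \<subseteq> U" for x y
      using d0[rule_format, of x] by simp_all
    show "\<exists>\<gamma>. gauge \<gamma> \<and> (\<forall>\<D>. \<D> tagged_division_of {l..r} \<and> \<gamma> fine \<D> \<longrightarrow>
        norm (sum (\<lambda>(x,k). measure lborel k *\<^sub>R g' x) \<D> - (f r - f l)) < e0)"
    proof (intro exI conjI allI impI)
      show "gauge (\<lambda>x. ball x (d x))"
        using d(1) gauge_ball_dependent by blast
    next
      fix p assume p: "p tagged_division_of {l..r} \<and> (\<lambda>x. ball x (d x)) fine p"
      then have ptag: "p tagged_division_of {l..r}" and fine: "(\<lambda>x. ball x (d x)) fine p" by auto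
      note tag = tagged_division_ofD[OF ptag[folded box_real(2)]]
      let ?F = "\<lambda>(x,K). measure lborel K *\<^sub>R g' x - (f (Sup K) - f (Inf K))"
      let ?P = "{z \<in> p. fst z \<in> N}"
      have ba: "r - l = (\<Sum>(x,K)\<in>p. Sup K - Inf K)" "f r - f l = (\<Sum>(x,K)\<in>p. f(Sup K) - f(Inf K))"
        using additive_tagged_division_1[where f= "\<lambda>x. x"] additive_tagged_division_1[where f= f]
            lr ptag by (auto simp: box_real)
      have int: "\<exists>u v. K = {u..v} \<and> u \<le> v \<and> x \<in> K \<and> K \<subseteq> {l..r} \<and> K \<subseteq> ball x (d x)" if xK: "(x,K) \<in> p" for x K
      proof -
        obtain u v where K: "K = {u..v}" using tag(4)[OF xK] by (auto simp: box_real)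
        then show ?thesis using tag(2,3)[OF xK] xK fine by (auto simp: box_real fine_def)
      qed
      have "norm (sum (\<lambda>(x,k). measure lborel k *\<^sub>R g' x) p - (f r - f l)) = norm (sum ?F p)"
        unfolding ba(2) sum_subtractf[symmetric] by (simp add: split_beta)
      also have "sum ?F p = sum ?F (p - ?P) + sum ?F ?P"
        by (intro sum.subset_diff) (use tag(1) in auto)
      also have "norm \<dots> \<le> norm (sum ?F (p - ?P)) + norm (sum ?F ?P)" by (rule norm_triangle_ineq)
      also have "norm (sum ?F (p - ?P)) \<le> (\<Sum>(x,K)\<in>p - ?P. e * (Sup K - Inf K))"
      proof (rule sum_norm_le)
        fix z assume z: "z \<in> p - ?P"
        obtain x K where xK: "z = (x, K)" by force
        obtain u v where K: "K = {u..v}" "u \<le> v" "x \<in> K" "K \<subseteq> {l..r}" "K \<subseteq> ball x (d x)"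
          using int[of x K] z xK by auto
        have xN: "x \<notin> N" using z xK by auto
        have "u \<in> K" "v \<in> K" using K by auto
        \<comment> \<open>Straddle argument: the tag x lies between u and v, so the errors e * |u -
          x| and e * |v - x| add up to e * (v - u).\<close>
        have "norm ((v - u) *\<^sub>R g x - (f v - f u)) = norm (f u - f x - (u - x) *\<^sub>R g x - (f v - f x - (v - x) *\<^sub>R g x))"
          by (auto simp: algebra_simps)
        also have "\<dots> \<le> norm (f u - f x - (u - x) *\<^sub>R g x) + norm (f v - f x - (v - x) *\<^sub>R g x)"
          by (rule norm_triangle_ineq4)
        also have "\<dots> \<le> e * norm (u - x) + e * norm (v - x)"
        proof -
          have "u \<in> ball x (d x)" "v \<in> ball x (d x)" "u \<in> {l..r}" "v \<in> {l..r}" "x \<in> {l..r}"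
            using K \<open>u \<in> K\<close> \<open>v \<in> K\<close> by blast+
          then show ?thesis
            by (intro add_mono d(2) xN) (simp_all add: dist_norm norm_minus_commute)
        qed
        also have "\<dots> = e * (v - u)" using K by (simp add: algebra_simps)
        finally show "norm (?F z) \<le> (case z of (x,K) \<Rightarrow> e * (Sup K - Inf K))"
          using K xN by (simp add: xK g'_def)
      qed
      also have "\<dots> \<le> (\<Sum>(x,K)\<in>p. e * (Sup K - Inf K))"
      proof (rule sum_mono2)
        fix z assume "z \<in> p - (p - ?P)"
        then obtain x K where "z = (x, K)" "(x, K) \<in> p" by (cases z) auto
        with int[of x K] e show "0 \<le> (case z of (x, K) \<Rightarrow> e * (Sup K - Inf K))" by auto
      qed (use tag(1) in auto)
      also have "\<dots> = e * (r - l)" unfolding ba by (simp add: sum_distrib_left split_beta)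
      also have "norm (sum ?F ?P) \<le> (\<Sum>(x,K)\<in>?P. norm (f (Sup K) - f (Inf K)))"
        by (intro sum_norm_le) (auto simp: g'_def norm_minus_commute)
      also have "\<dots> < e"
      proof (rule tagged_division_variation_null[OF \<delta>(2) ptag])
        fix x K assume "(x,K) \<in> ?P"
        then show "K \<subseteq> U" using int[of x K] d(3)[of x] by fastforce
      qed (use U in auto)
      finally show "norm (sum (\<lambda>(x,k). measure lborel k *\<^sub>R g' x) p - (f r - f l)) < e0"
        using e0 by simp
    qed
  qed
  moreover have "negligible N" using N by (simp add: negligible_iff_null_sets)
  ultimately show ?thesis
    by (elim has_integral_spike[rotated 2]) (auto simp: g'_def)
qed

section \<open>Weighted integrals and density of continuous functions\<close>

lemma exp_weight_nn_integral:
  fixes w x :: real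
  assumes "w > 0" "0 \<le> x"
  shows "(\<integral>\<^sup>+t\<in>{0..x}. ennreal (exp (w * t)) \<partial>lborel) \<le> ennreal (exp (w * x) / w)"
proof -
  have "(\<integral>\<^sup>+t\<in>{0..x}. ennreal (exp (w * t)) \<partial>lborel) = ennreal (exp (w * x) / w - exp (w * 0) / w)"
    using assms by (intro nn_integral_FTC_Icc) (auto intro!: derivative_eq_intros)
  also have "\<dots> \<le> ennreal (exp (w * x) / w)" using assms by (intro ennreal_leI) simp
  finally show ?thesis .
qed

text \<open>An integrable f is finite almost everywhere, so its excess over the level n (subtraction
  in \<open>ennreal\<close> stops at 0) decreases to 0 and monotone convergence applies. It serves
  to split f into a bounded part and a part that is small in mean.\<close>

lemma truncated_tail_small:
  fixes f :: "'a \<Rightarrow> ennreal"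
  assumes [measurable]: "f \<in> borel_measurable M" and fin: "(\<integral>\<^sup>+x. f x \<partial>M) < \<infinity>" and e: "e > 0"
  shows "\<exists>n::nat. (\<integral>\<^sup>+x. f x - of_nat n \<partial>M) < e"
proof -
  have "(INF n::nat. \<integral>\<^sup>+x. f x - of_nat n \<partial>M) = (\<integral>\<^sup>+x. (INF n::nat. f x - of_nat n) \<partial>M)"
  proof (rule nn_integral_monotone_convergence_INF_AE[symmetric])
    show "AE x in M. f x - of_nat (Suc i) \<le> f x - of_nat i" for i
      by (intro AE_I2 ennreal_minus_mono) auto
    show "(\<integral>\<^sup>+x. f x - of_nat 0 \<partial>M) < \<infinity>" using fin by simp
  qed auto
  also have "\<dots> = (\<integral>\<^sup>+x. 0 \<partial>M)"
  proof (rule nn_integral_cong_AE)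
    have "AE x in M. f x \<noteq> \<infinity>" using fin by (intro nn_integral_PInf_AE) auto
    then show "AE x in M. (INF n::nat. f x - of_nat n) = 0"
    proof eventually_elim
      case (elim x)
      then have top: "f x < top" by (simp add: less_top)
      then obtain n :: nat where "f x \<le> of_nat n"
        using ennreal_Ex_less_of_nat[OF top] by (auto intro: less_imp_le)
      then have "f x - of_nat n = 0" using top by (intro diff_eq_0_ennreal)
      moreover have "(INF n::nat. f x - of_nat n) \<le> f x - of_nat n" by (rule INF_lower) simp
      ultimately show ?case by simp
    qed
  qed
  finally have "(INF n::nat. \<integral>\<^sup>+x. f x - of_nat n \<partial>M) < e" using e by simp
  then show ?thesis by (auto simp: INF_less_iff)
qed

text \<open>A bounded q gains the factor 1 / v against exp(v * x). A merely integrable q is cut at a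
  level n: the excess has mass below e / 2 and is weighted by at most exp(v * x), while the part
  below n contributes (n / v) * exp(v * x). Because the bound holds for all v above w, several
  weights can be replaced by their maximum.\<close>

lemma Bielecki_weight:
  fixes q :: "real \<Rightarrow> ennreal" and e :: real
  assumes [measurable]: "q \<in> borel_measurable borel" and fin: "(\<integral>\<^sup>+t. q t \<partial>lborel) < \<infinity>" and e: "e > 0"
  shows "\<exists>w>0. \<forall>v\<ge>w. \<forall>x\<ge>0. (\<integral>\<^sup>+t\<in>{0..x}. q t * ennreal (exp (v * t)) \<partial>lborel) \<le> ennreal (e * exp (v * x))"
proof -
  obtain n :: nat where n: "(\<integral>\<^sup>+t. q t - of_nat n \<partial>lborel) < ennreal (e/2)"
    using truncated_tail_small[of q lborel "ennreal (e/2)"] fin e by auto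
  \<comment> \<open>\<open>Suc n\<close> keeps w positive when n = 0 and gives n / v \<le> e / 2 for
    v \<ge> w.\<close>
  define w where "w = 2 * real (Suc n) / e"
  show ?thesis
  proof (intro exI[of _ w] conjI allI impI)
    show "w > 0" using e by (simp add: w_def)
    fix v x :: real assume v: "w \<le> v" and x: "0 \<le> x"
    have v0: "v > 0" using v \<open>w > 0\<close> by simp
    have "real n / v \<le> e / 2"
    proof -
      have "e * w = 2 * real (Suc n)" using e by (simp add: w_def)
      then have "2 * real n \<le> e * w" by simp
      also have "\<dots> \<le> e * v" using e v by simp
      finally show ?thesis using v0 by (simp add: field_simps)
    qed
    have "(\<integral>\<^sup>+t\<in>{0..x}. q t * ennreal (exp (v * t)) \<partial>lborel)
      \<le> (\<integral>\<^sup>+t. (q t - of_nat n) * ennreal (exp (v * x)) + of_nat n * (ennreal (exp (v * t)) * indicator {0..x} t) \<partial>lborel)"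
    proof (rule nn_integral_mono)
      fix t :: real
      have "q t \<le> (q t - of_nat n) + of_nat n"
        using ennreal_ineq_diff_add[of "of_nat n" "q t"] add_increasing2[of "q t - of_nat n" "q t" "of_nat n"]
        by (cases "of_nat n \<le> q t") (auto simp: add.commute)
      moreover have "ennreal (exp (v * t)) \<le> ennreal (exp (v * x))" if "t \<le> x"
        using that v0 by (intro ennreal_leI) simp
      ultimately show "q t * ennreal (exp (v * t)) * indicator {0..x} t \<le>
         (q t - of_nat n) * ennreal (exp (v * x)) + of_nat n * (ennreal (exp (v * t)) * indicator {0..x} t)"
      proof (cases "t \<in> {0..x}")
        case True
        have "q t * ennreal (exp (v * t)) \<le> ((q t - of_nat n) + of_nat n) * ennreal (exp (v * t))"
          by (intro mult_right_mono zero_le) fact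
        also have "\<dots> = (q t - of_nat n) * ennreal (exp (v * t)) + of_nat n * ennreal (exp (v * t))"
          by (simp add: distrib_right)
        also have "\<dots> \<le> (q t - of_nat n) * ennreal (exp (v * x)) + of_nat n * ennreal (exp (v * t))"
          using \<open>t \<le> x \<Longrightarrow> _\<close> True by (intro add_right_mono mult_left_mono) auto
        finally show ?thesis using True by simp
      qed simp
    qed
    also have "\<dots> = (\<integral>\<^sup>+t. q t - of_nat n \<partial>lborel) * ennreal (exp (v * x)) +
        of_nat n * (\<integral>\<^sup>+t\<in>{0..x}. ennreal (exp (v * t)) \<partial>lborel)"
      by (simp add: nn_integral_add nn_integral_multc nn_integral_cmult)
    also have "\<dots> \<le> ennreal (e/2) * ennreal (exp (v * x)) + of_nat n * ennreal (exp (v * x) / v)"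
      using n exp_weight_nn_integral[OF v0 x] by (intro add_mono mult_right_mono mult_left_mono) auto
    also have "\<dots> = ennreal (e/2 * exp (v * x) + real n / v * exp (v * x))"
      using e v0 by (simp add: ennreal_mult[symmetric] ennreal_plus[symmetric] ennreal_of_nat_eq_real_of_nat del: ennreal_plus)
    also have "\<dots> \<le> ennreal (e * exp (v * x))"
    proof (intro ennreal_leI)
      have "e/2 * exp (v * x) + real n / v * exp (v * x) = (e/2 + real n / v) * exp (v * x)" by (simp add: algebra_simps)
      also have "\<dots> \<le> (e/2 + e/2) * exp (v * x)" using \<open>real n / v \<le> e / 2\<close> by (intro mult_right_mono add_left_mono) auto
      finally show "e/2 * exp (v * x) + real n / v * exp (v * x) \<le> e * exp (v * x)" by simp
    qed
    finally show "(\<integral>\<^sup>+t\<in>{0..x}. q t * ennreal (exp (v * t)) \<partial>lborel) \<le> ennreal (e * exp (v * x))" .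
  qed
qed

text \<open>For an indicator, Urysohn's lemma interpolates between a closed set inside and an open
  set outside, and the error lives on their small difference. Boundedness of g is recorded because
  functions built from g are later integrated against the merely integrable q.\<close>

lemma continuous_bounded_dense_L1:
  fixes f :: "real \<Rightarrow> 'a::{banach, second_countable_topology}"
  assumes "integrable lborel f" "e > 0"
  shows "\<exists>g. continuous_on UNIV g \<and> bounded (range g) \<and> (\<integral>\<^sup>+x. norm (f x - g x) \<partial>lborel) < ennreal e"
  using assms
proof (induction arbitrary: e rule: integrable_induct)
  case (base A c)
  have A: "A \<in> sets lebesgue" "A \<in> sets lborel" using base by auto
  \<comment> \<open>The error set U - C has measure below 2 * d and the integrand there is at most
    \<open>norm c\<close>; the added 1 covers c = 0.\<close>
  define d where "d = e / (2 * (norm c + 1))"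
  have d: "d > 0" using base by (simp add: d_def add_nonneg_pos)
  obtain U where U: "open U" "A \<subseteq> U" "U - A \<in> lmeasurable" "emeasure lebesgue (U - A) < ennreal d"
    using sets_lebesgue_outer_open[OF A(1) d] by blast
  obtain C where C: "closed C" "C \<subseteq> A" "A - C \<in> lmeasurable" "emeasure lebesgue (A - C) < ennreal d"
    using sets_lebesgue_inner_closed[OF A(1) d] by blast
  obtain h :: "real \<Rightarrow> real" where h: "continuous_on UNIV h" "\<And>x. h x \<in> closed_segment 1 0"
      "\<And>x. x \<in> C \<Longrightarrow> h x = 1" "\<And>x. x \<in> - U \<Longrightarrow> h x = 0"
    using Urysohn[of C "- U" 1 "0::real"] C U by (auto simp: closed_Compl)
  have h01: "0 \<le> h x \<and> h x \<le> 1" for x using h(2)[of x] by (simp add: closed_segment_eq_real_ivl)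
  have "(\<integral>\<^sup>+x. norm (indicat_real A x *\<^sub>R c - h x *\<^sub>R c) \<partial>lborel) \<le> (\<integral>\<^sup>+x. ennreal (norm c) * indicator (U - C) x \<partial>lborel)"
  proof (intro nn_integral_mono)
    fix x
    have "\<bar>indicat_real A x - h x\<bar> \<le> indicat_real (U - C) x"
      using h01[of x] h(3,4)[of x] C U by (auto simp: indicator_def)
    then have "\<bar>indicat_real A x - h x\<bar> * norm c \<le> indicat_real (U - C) x * norm c"
      by (intro mult_right_mono) auto
    then show "ennreal (norm (indicat_real A x *\<^sub>R c - h x *\<^sub>R c)) \<le> ennreal (norm c) * indicator (U - C) x"
      unfolding scaleR_diff_left[symmetric] norm_scaleR
      by (simp add: ennreal_indicator[symmetric] ennreal_mult[symmetric] mult.commute ennreal_leI)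
  qed
  also have "\<dots> = ennreal (norm c) * emeasure lebesgue (U - C)"
    using U(1) C(1) by (subst nn_integral_cmult_indicator) auto
  also have "emeasure lebesgue (U - C) \<le> emeasure lebesgue (U - A) + emeasure lebesgue (A - C)"
    using U C by (intro order.trans[OF emeasure_mono emeasure_subadditive]) auto
  also have "\<dots> \<le> ennreal d + ennreal d"
    using U C by (intro add_mono) auto
  finally have "(\<integral>\<^sup>+x. norm (indicat_real A x *\<^sub>R c - h x *\<^sub>R c) \<partial>lborel) \<le> ennreal (norm c) * (ennreal d + ennreal d)"
    by (simp add: mult_left_mono)
  also have "\<dots> = ennreal (norm c * (2 * d))"
    using d by (simp add: ennreal_mult ennreal_plus[symmetric] del: ennreal_plus)
  also have "\<dots> < ennreal e"
  proof (intro ennreal_lessI)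
    have "norm c * (2 * d) = e * (norm c / (norm c + 1))"
      using norm_ge_zero[of c] unfolding d_def by (simp add: divide_simps) (simp add: algebra_simps)?
    also have "\<dots> < e * 1" using base by (intro mult_strict_left_mono) (auto simp: add_nonneg_pos divide_less_eq)
    finally show "norm c * (2 * d) < e" by simp
  qed (use base in auto)
  finally show ?case
    using h h01 by (intro exI[of _ "\<lambda>x. h x *\<^sub>R c"])
      (auto intro!: continuous_intros boundedI[of _ "norm c"] mult_left_le_one_le)
next
  case (add f g)
  obtain f' where f': "continuous_on UNIV f'" "bounded (range f')" "(\<integral>\<^sup>+x. norm (f x - f' x) \<partial>lborel) < ennreal (e/2)"
    using add.IH(1)[of "e/2"] add.prems by (auto simp del: ennreal_divide_numeral)
  obtain g' where g': "continuous_on UNIV g'" "bounded (range g')" "(\<integral>\<^sup>+x. norm (g x - g' x) \<partial>lborel) < ennreal (e/2)"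
    using add.IH(2)[of "e/2"] add.prems by (auto simp del: ennreal_divide_numeral)
  have [measurable]: "f \<in> borel_measurable borel" "g \<in> borel_measurable borel" "f' \<in> borel_measurable borel" "g' \<in> borel_measurable borel"
    using add f' g' by (auto intro: borel_measurable_continuous_onI)
  have "(\<integral>\<^sup>+x. norm (f x + g x - (f' x + g' x)) \<partial>lborel) \<le> (\<integral>\<^sup>+x. ennreal (norm (f x - f' x)) + ennreal (norm (g x - g' x)) \<partial>lborel)"
    by (intro nn_integral_mono) (auto simp: ennreal_plus[symmetric] simp del: ennreal_plus intro!: ennreal_leI norm_diff_triangle_ineq)
  also have "\<dots> = (\<integral>\<^sup>+x. norm (f x - f' x) \<partial>lborel) + (\<integral>\<^sup>+x. norm (g x - g' x) \<partial>lborel)"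
    by (intro nn_integral_add) auto
  also have "\<dots> < ennreal (e/2) + ennreal (e/2)" using f' g' by (intro add_strict_mono) auto
  also have "\<dots> = ennreal e" using add by (simp add: ennreal_plus[symmetric] del: ennreal_plus)
  finally show ?case
    using f' g' by (intro exI[of _ "\<lambda>x. f' x + g' x"]) (auto intro!: continuous_intros bounded_plus_comp)
next
  case (lim f s)
  have [measurable]: "f \<in> borel_measurable borel" "\<And>i. s i \<in> borel_measurable borel" using lim by auto
  have "(\<lambda>i. \<integral>\<^sup>+x. norm (f x - s i x) \<partial>lborel) \<longlonglongrightarrow> 0"
  proof (rule nn_integral_dominated_convergence_norm[where w = "\<lambda>x. 2 * norm (f x)"])
    have "integrable lborel (\<lambda>x. 2 * norm (f x))" using lim by auto
    then show "(\<integral>\<^sup>+x. ennreal (2 * norm (f x)) \<partial>lborel) < \<infinity>"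
      by (subst nn_integral_eq_integral) auto
  qed (use lim in auto)
  from order_tendstoD(2)[OF this, of "ennreal (e/2)"] lim.prems
  obtain i where i: "(\<integral>\<^sup>+x. norm (f x - s i x) \<partial>lborel) < ennreal (e/2)"
    by (auto simp: eventually_sequentially simp del: ennreal_divide_numeral)
  obtain g where g: "continuous_on UNIV g" "bounded (range g)" "(\<integral>\<^sup>+x. norm (s i x - g x) \<partial>lborel) < ennreal (e/2)"
    using lim.IH[of "e/2" i] lim.prems by (auto simp del: ennreal_divide_numeral)
  have [measurable]: "g \<in> borel_measurable borel"
    using g by (auto intro: borel_measurable_continuous_onI)
  have "(\<integral>\<^sup>+x. norm (f x - g x) \<partial>lborel) \<le> (\<integral>\<^sup>+x. ennreal (norm (f x - s i x)) + ennreal (norm (s i x - g x)) \<partial>lborel)"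
    by (intro nn_integral_mono)
      (auto simp: ennreal_plus[symmetric] simp del: ennreal_plus intro!: ennreal_leI norm_triangle_sub order.trans[OF _ norm_triangle_ineq])
  also have "\<dots> = (\<integral>\<^sup>+x. norm (f x - s i x) \<partial>lborel) + (\<integral>\<^sup>+x. norm (s i x - g x) \<partial>lborel)"
    by (intro nn_integral_add) auto
  also have "\<dots> < ennreal (e/2) + ennreal (e/2)" using i g by (intro add_strict_mono) auto
  also have "\<dots> = ennreal e" using lim.prems by (simp add: ennreal_plus[symmetric] del: ennreal_plus)
  finally show ?case using g by blast
qed

section \<open>The Goursat problem for the kernel\<close>

text \<open>In the index type \<open>2\<close> addition is modulo two, so i + 1 is always the other
  component. The coupled pair of equations is written once, with i and i + 1.\<close>

lemma two_swap [simp]: "(i::2) + 1 + 1 = i" "(i::2) + 1 \<noteq> i"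
  using exhaust_2[of i] by auto

text \<open>No integrability is assumed: a non-integrable function has integral 0. Bounds can thus
  be derived before convergence is known.\<close>

lemma ennreal_norm_integral_le:
  fixes f :: "'a \<Rightarrow> 'b::{banach, second_countable_topology}"
  shows "ennreal (norm (integral\<^sup>L M f)) \<le> (\<integral>\<^sup>+x. norm (f x) \<partial>M)"
  by (cases "integrable M f") (auto simp: integral_norm_bound_ennreal not_integrable_integral_eq)

lemma nn_integral_reflect:
  assumes [measurable]: "f \<in> borel_measurable borel"
  shows "(\<integral>\<^sup>+x\<in>{0..s}. f (s - x) \<partial>lborel) = (\<integral>\<^sup>+x\<in>{0..s::real}. f x \<partial>lborel)"
proof -
  have "(\<integral>\<^sup>+x\<in>{0..s}. f x \<partial>lborel) = (\<integral>\<^sup>+x. f (s + (-1) * x) * indicator {0..s} (s + (-1) * x) \<partial>lborel)"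
    by (subst nn_integral_real_affine[of _ "-1" s]) auto
  also have "\<dots> = (\<integral>\<^sup>+x\<in>{0..s}. f (s - x) \<partial>lborel)"
    by (intro nn_integral_cong) (auto simp: indicator_def)
  finally show ?thesis by simp
qed

lemma nn_integral_affine_line:
  assumes [measurable]: "f \<in> borel_measurable borel" and k: "k > 0"
  shows "(\<integral>\<^sup>+x. f (c - k * x) \<partial>lborel) = ennreal (1 / k) * (\<integral>\<^sup>+x. f x \<partial>lborel)"
    and "(\<integral>\<^sup>+x. f (c + k * x) \<partial>lborel) = ennreal (1 / k) * (\<integral>\<^sup>+x. f x \<partial>lborel)"
proof -
  have "ennreal (1/k) * (ennreal k * y) = y" for y
    using k by (simp add: mult.assoc[symmetric] ennreal_mult[symmetric])
  note cancel = this
  have "(\<integral>\<^sup>+x. f x \<partial>lborel) = ennreal k * (\<integral>\<^sup>+x. f (c - k * x) \<partial>lborel)"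
    using nn_integral_real_affine[of f "-k" c] k by simp
  then show "(\<integral>\<^sup>+x. f (c - k * x) \<partial>lborel) = ennreal (1 / k) * (\<integral>\<^sup>+x. f x \<partial>lborel)"
    by (simp only: cancel)
  have "(\<integral>\<^sup>+x. f x \<partial>lborel) = ennreal k * (\<integral>\<^sup>+x. f (c + k * x) \<partial>lborel)"
    using nn_integral_real_affine[of f k c] k by simp
  then show "(\<integral>\<^sup>+x. f (c + k * x) \<partial>lborel) = ennreal (1 / k) * (\<integral>\<^sup>+x. f x \<partial>lborel)"
    by (simp only: cancel)
qed

text \<open>q is the coupling and a the free term of the Goursat problem. The relation a i =
  \<gamma> (i + 1) * q i enters when the series is linked to the system; convergence and
  approximation treat a as an independent integrable function.\<close>

locale goursat =
  fixes q a :: "2 \<Rightarrow> real \<Rightarrow> complex"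
  assumes integrable_q: "\<And>i. integrable lborel (q i)"
    and integrable_a: "\<And>i. integrable lborel (a i)"
begin

lemma q_meas [measurable]: "q i \<in> borel_measurable borel"
  using integrable_q[of i] by auto

lemma a_meas [measurable]: "a i \<in> borel_measurable borel"
  using integrable_a[of i] by auto

text \<open>The reflected argument t - snd z comes from the opposite phases of the two components:
  exp(d * t) * exp(- d * y) = exp(d * (t - y)).\<close>

definition A :: "(2 \<Rightarrow> real \<times> real \<Rightarrow> complex) \<Rightarrow> 2 \<Rightarrow> real \<times> real \<Rightarrow> complex" where
  "A v i z = (LINT t|lborel. indicator {snd z..fst z} t *\<^sub>R (q i t * v (i+1) (t, t - snd z)))"

text \<open>Positive counterpart of \<open>A\<close>. With values in \<open>ennreal\<close> it
  raises no question of convergence, so a majorant series can be summed before anything is known to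
  be integrable.\<close>

definition Ap :: "(2 \<Rightarrow> real \<times> real \<Rightarrow> ennreal) \<Rightarrow> 2 \<Rightarrow> real \<times> real \<Rightarrow> ennreal" where
  "Ap v i z = (\<integral>\<^sup>+t. indicator {snd z..fst z} t * (ennreal (norm (q i t)) * v (i+1) (t, t - snd z)) \<partial>lborel)"

lemma A_meas [measurable]:
  assumes [measurable]: "\<And>i. v i \<in> borel_measurable (borel \<Otimes>\<^sub>M borel)"
  shows "A v i \<in> borel_measurable (borel \<Otimes>\<^sub>M borel)"
  unfolding A_def indicator_def atLeastAtMost_iff by measurable

lemma Ap_meas [measurable]:
  assumes [measurable]: "\<And>i. v i \<in> borel_measurable (borel \<Otimes>\<^sub>M borel)"
  shows "Ap v i \<in> borel_measurable (borel \<Otimes>\<^sub>M borel)"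
  unfolding Ap_def indicator_def atLeastAtMost_iff by measurable

lemma norm_A_le: "ennreal (norm (A v i z)) \<le> Ap (\<lambda>i z. ennreal (norm (v i z))) i z"
proof -
  have "ennreal (norm (A v i z)) \<le> (\<integral>\<^sup>+t. norm (indicator {snd z..fst z} t *\<^sub>R (q i t * v (i+1) (t, t - snd z))) \<partial>lborel)"
    unfolding A_def by (rule ennreal_norm_integral_le)
  also have "\<dots> = Ap (\<lambda>i z. ennreal (norm (v i z))) i z"
    unfolding Ap_def by (intro nn_integral_cong) (auto simp: indicator_def norm_mult ennreal_mult)
  finally show ?thesis .
qed

lemma Ap_mono: "(\<And>i z. u i z \<le> v i z) \<Longrightarrow> Ap u i z \<le> Ap v i z"
  unfolding Ap_def by (intro nn_integral_mono mult_left_mono) auto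

text \<open>Tonelli and the reflection of y to t - y turn the integral over the section at x into a
  Volterra integral of section integrals. The problem in two variables is thereby reduced to an
  inequality in x alone.\<close>

lemma nn_integral_Ap:
  assumes [measurable]: "\<And>i. v i \<in> borel_measurable (borel \<Otimes>\<^sub>M borel)"
  shows "(\<integral>\<^sup>+y\<in>{0..x}. Ap v i (x, y) \<partial>lborel) =
    (\<integral>\<^sup>+t\<in>{0..x}. ennreal (norm (q i t)) * (\<integral>\<^sup>+y\<in>{0..t}. v (i+1) (t, y) \<partial>lborel) \<partial>lborel)"
proof -
  have "(\<integral>\<^sup>+y\<in>{0..x}. Ap v i (x, y) \<partial>lborel) =
    (\<integral>\<^sup>+y. \<integral>\<^sup>+t. indicator {0..x} y * (indicator {y..x} t * (ennreal (norm (q i t)) * v (i+1) (t, t - y))) \<partial>lborel \<partial>lborel)"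
    unfolding Ap_def indicator_def by (simp add: nn_integral_cmult mult.commute)
  also have "\<dots> = (\<integral>\<^sup>+t. \<integral>\<^sup>+y. indicator {0..x} y * (indicator {y..x} t * (ennreal (norm (q i t)) * v (i+1) (t, t - y))) \<partial>lborel \<partial>lborel)"
    unfolding indicator_def atLeastAtMost_iff by (intro lborel_pair.Fubini') measurable
  also have "\<dots> = (\<integral>\<^sup>+t. \<integral>\<^sup>+y. indicator {0..x} t * (ennreal (norm (q i t)) * (v (i+1) (t, t - y) * indicator {0..t} y)) \<partial>lborel \<partial>lborel)"
    by (intro nn_integral_cong) (auto simp: indicator_def)
  also have "\<dots> = (\<integral>\<^sup>+t. indicator {0..x} t * (ennreal (norm (q i t)) * (\<integral>\<^sup>+y\<in>{0..t}. v (i+1) (t, t - y) \<partial>lborel)) \<partial>lborel)"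
    by (simp add: nn_integral_cmult)
  also have "\<dots> = (\<integral>\<^sup>+t\<in>{0..x}. ennreal (norm (q i t)) * (\<integral>\<^sup>+y\<in>{0..t}. v (i+1) (t, y) \<partial>lborel) \<partial>lborel)"
    by (subst nn_integral_reflect) (auto simp: mult.commute mult.left_commute)
  finally show ?thesis .
qed

text \<open>Measured in the weight exp(w * x), section integrals gain the factor e, the Bielecki
  constant of q, under \<open>Ap\<close>. With e = 1/2 this is the contraction behind the Neumann
  series.\<close>

lemma nn_integral_Ap_weighted:
  assumes [measurable]: "\<And>i. v i \<in> borel_measurable (borel \<Otimes>\<^sub>M borel)"
    and v: "\<And>i x. 0 \<le> x \<Longrightarrow> (\<integral>\<^sup>+y\<in>{0..x}. v i (x, y) \<partial>lborel) \<le> ennreal (c * exp (w * x))"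
    and q: "\<And>i x. 0 \<le> x \<Longrightarrow> (\<integral>\<^sup>+t\<in>{0..x}. ennreal (norm (q i t)) * ennreal (exp (w * t)) \<partial>lborel) \<le> ennreal (e * exp (w * x))"
    and "0 \<le> x" "0 \<le> c" "0 \<le> e"
  shows "(\<integral>\<^sup>+y\<in>{0..x}. Ap v i (x, y) \<partial>lborel) \<le> ennreal (c * e * exp (w * x))"
proof -
  have "(\<integral>\<^sup>+y\<in>{0..x}. Ap v i (x, y) \<partial>lborel) \<le>
     (\<integral>\<^sup>+t\<in>{0..x}. ennreal c * (ennreal (norm (q i t)) * ennreal (exp (w * t))) \<partial>lborel)"
    unfolding nn_integral_Ap[OF assms(1)]
  proof (rule nn_integral_mono)
    fix t :: real
    show "ennreal (norm (q i t)) * (\<integral>\<^sup>+y\<in>{0..t}. v (i+1) (t, y) \<partial>lborel) * indicator {0..x} t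
        \<le> ennreal c * (ennreal (norm (q i t)) * ennreal (exp (w * t))) * indicator {0..x} t"
      using mult_left_mono[OF v[of t "i+1"], of "ennreal (norm (q i t))"] \<open>0 \<le> c\<close>
      by (auto simp: indicator_def ennreal_mult mult.left_commute)
  qed
  also have "\<dots> = ennreal c * (\<integral>\<^sup>+t\<in>{0..x}. ennreal (norm (q i t)) * ennreal (exp (w * t)) \<partial>lborel)"
    by (simp add: nn_integral_cmult mult.assoc)
  also have "\<dots> \<le> ennreal c * ennreal (e * exp (w * x))"
    by (intro mult_left_mono q assms) auto
  also have "\<dots> = ennreal (c * e * exp (w * x))"
    using assms by (simp add: ennreal_mult[symmetric] mult.assoc)
  finally show ?thesis .
qed

text \<open>The inner integral along a transversal line sweeps, for fixed \<open>t\<close>, a segment of the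
  section at \<open>t\<close>; so bounds on sections give bounds along all transversal lines.\<close>
lemma nn_integral_Ap_line:
  assumes [measurable]: "\<And>i. v i \<in> borel_measurable (borel \<Otimes>\<^sub>M borel)"
    and k: "k > 0" and line: "\<And>x. x \<in> {s..1} \<Longrightarrow> 0 \<le> \<alpha> + k * x"
  shows "(\<integral>\<^sup>+x\<in>{s..1}. Ap v i (x, \<alpha> + k * x) \<partial>lborel) \<le>
    ennreal (1 / k) * (\<integral>\<^sup>+t\<in>{0..1}. ennreal (norm (q i t)) * (\<integral>\<^sup>+y\<in>{0..t}. v (i+1) (t, y) \<partial>lborel) \<partial>lborel)"
proof -
  have "(\<integral>\<^sup>+x\<in>{s..1}. Ap v i (x, \<alpha> + k * x) \<partial>lborel) =
    (\<integral>\<^sup>+x. \<integral>\<^sup>+t. indicator {s..1} x * (indicator {\<alpha> + k * x..x} t * (ennreal (norm (q i t)) * v (i+1) (t, t - (\<alpha> + k * x)))) \<partial>lborel \<partial>lborel)"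
    unfolding Ap_def indicator_def by (simp add: nn_integral_cmult mult.commute)
  also have "\<dots> = (\<integral>\<^sup>+t. \<integral>\<^sup>+x. indicator {s..1} x * (indicator {\<alpha> + k * x..x} t * (ennreal (norm (q i t)) * v (i+1) (t, t - (\<alpha> + k * x)))) \<partial>lborel \<partial>lborel)"
    unfolding indicator_def atLeastAtMost_iff by (intro lborel_pair.Fubini') measurable
  \<comment> \<open>For fixed t the variable y = t - (\<alpha> + k * x) stays in {0..t}: y \<le> t
    is the hypothesis \<open>line\<close>, and y \<ge> 0 is the lower limit of the inner integral.
    The substitution costs the factor 1 / k.\<close>
  also have "\<dots> \<le> (\<integral>\<^sup>+t. \<integral>\<^sup>+x. (indicator {0..1} t * ennreal (norm (q i t))) * (v (i+1) (t, (t - \<alpha>) - k * x) * indicator {0..t} ((t - \<alpha>) - k * x)) \<partial>lborel \<partial>lborel)"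
  proof (intro nn_integral_mono)
    fix t x :: real
    show "indicator {s..1} x * (indicator {\<alpha> + k * x..x} t * (ennreal (norm (q i t)) * v (i+1) (t, t - (\<alpha> + k * x))))
      \<le> (indicator {0..1} t * ennreal (norm (q i t))) * (v (i+1) (t, (t - \<alpha>) - k * x) * indicator {0..t} ((t - \<alpha>) - k * x))"
    proof (cases "s \<le> x \<and> x \<le> 1 \<and> \<alpha> + k * x \<le> t \<and> t \<le> x")
      case True
      then have "0 \<le> \<alpha> + k * x" using line by simp
      with True have "t \<in> {0..1}" "(t - \<alpha>) - k * x \<in> {0..t}" by auto
      then show ?thesis using True by (simp add: diff_diff_eq)
    qed (auto simp: indicator_def)
  qed
  also have "\<dots> = (\<integral>\<^sup>+t. (indicator {0..1} t * ennreal (norm (q i t))) * (ennreal (1 / k) * (\<integral>\<^sup>+x. v (i+1) (t, x) * indicator {0..t} x \<partial>lborel)) \<partial>lborel)"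
    using k by (simp add: nn_integral_cmult nn_integral_affine_line(1)[of "\<lambda>x. v (i+1) (_, x) * indicator {0.._} x"])
  also have "\<dots> = (\<integral>\<^sup>+t. ennreal (1 / k) * (ennreal (norm (q i t)) * (\<integral>\<^sup>+y\<in>{0..t}. v (i+1) (t, y) \<partial>lborel) * indicator {0..1} t) \<partial>lborel)"
    by (intro nn_integral_cong) (simp only: mult_ac)
  also have "\<dots> = ennreal (1 / k) * (\<integral>\<^sup>+t\<in>{0..1}. ennreal (norm (q i t)) * (\<integral>\<^sup>+y\<in>{0..t}. v (i+1) (t, y) \<partial>lborel) \<partial>lborel)"
    by (intro nn_integral_cmult) (unfold indicator_def atLeastAtMost_iff, measurable)
  finally show ?thesis .
qed

primrec U :: "nat \<Rightarrow> 2 \<Rightarrow> real \<times> real \<Rightarrow> complex" where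
  "U 0 = (\<lambda>i z. a i (snd z))"
| "U (Suc n) = A (U n)"

primrec m :: "nat \<Rightarrow> 2 \<Rightarrow> real \<times> real \<Rightarrow> ennreal" where
  "m 0 = (\<lambda>i z. ennreal (norm (a i (snd z))))"
| "m (Suc n) = Ap (m n)"

lemma U_meas [measurable]: "U n i \<in> borel_measurable (borel \<Otimes>\<^sub>M borel)"
  by (induction n arbitrary: i) auto

lemma m_meas [measurable]: "m n i \<in> borel_measurable (borel \<Otimes>\<^sub>M borel)"
  by (induction n arbitrary: i) auto

lemma norm_U_le: "ennreal (norm (U n i z)) \<le> m n i z"
proof (induction n arbitrary: i z)
  case (Suc n)
  show ?case using norm_A_le[of "U n" i z] Ap_mono[of "\<lambda>i z. ennreal (norm (U n i z))" "m n" i z, OF Suc]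
    by (simp del: split_paired_All)
qed auto

text \<open>Where the series diverges \<open>suminf\<close> returns an unspecified value; the
  integral equation for \<open>S\<close> is therefore stated at points with
  \<open>M i z < \<infinity>\<close>.\<close>

definition S :: "2 \<Rightarrow> real \<times> real \<Rightarrow> complex" where "S i z = (\<Sum>n. U n i z)"

definition M :: "2 \<Rightarrow> real \<times> real \<Rightarrow> ennreal" where "M i z = (\<Sum>n. m n i z)"

lemma S_meas [measurable]: "S i \<in> borel_measurable (borel \<Otimes>\<^sub>M borel)"
  unfolding S_def by measurable

lemma M_meas [measurable]: "M i \<in> borel_measurable (borel \<Otimes>\<^sub>M borel)"
  unfolding M_def by measurable

text \<open>Sum and integral of nonnegative terms commute in \<open>ennreal\<close> without any
  finiteness, so this equation holds at every point, in contrast to the one for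
  \<open>S\<close>.\<close>

lemma M_eq: "M i z = ennreal (norm (a i (snd z))) + Ap M i z"
proof -
  have "M i z = m 0 i z + (\<Sum>n. m (Suc n) i z)"
    unfolding M_def by (subst suminf_offset[of _ 1]) (auto simp: summableI)
  also have "(\<Sum>n. m (Suc n) i z) = Ap M i z"
    unfolding M_def m.simps Ap_def
    by (subst nn_integral_suminf[symmetric])
      (auto intro!: nn_integral_cong simp: ennreal_suminf_cmult)
  finally show ?thesis by simp
qed

lemma summable_U: assumes "M i z < \<infinity>" shows "summable (\<lambda>n. norm (U n i z))"
proof -
  have "(\<Sum>n. ennreal (norm (U n i z))) \<le> M i z"
    unfolding M_def by (intro suminf_le norm_U_le summableI)
  then show ?thesis using assms by (intro summable_suminf_not_top) (auto simp: top_unique)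
qed

lemma norm_S_le: "ennreal (norm (S i z)) \<le> M i z"
proof (cases "M i z < \<infinity>")
  case True
  have "ennreal (norm (S i z)) \<le> ennreal (\<Sum>n. norm (U n i z))"
    unfolding S_def by (intro ennreal_leI summable_norm summable_U True)
  also have "\<dots> = (\<Sum>n. ennreal (norm (U n i z)))"
    by (intro suminf_ennreal2[symmetric] summable_U True) auto
  also have "\<dots> \<le> M i z"
    unfolding M_def by (intro suminf_le norm_U_le summableI)
  finally show ?thesis .
qed (simp add: not_less top_unique)

end

section \<open>Convergence of the Neumann series\<close>

context goursat begin

lemma weight_exists:
  "\<exists>w>0. \<forall>i. \<forall>x\<ge>0. (\<integral>\<^sup>+t\<in>{0..x}. ennreal (norm (q i t)) * ennreal (exp (w * t)) \<partial>lborel) \<le> ennreal (1/2 * exp (w * x))"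
proof -
  have "\<forall>i. \<exists>w>0. \<forall>v\<ge>w. \<forall>x\<ge>0. (\<integral>\<^sup>+t\<in>{0..x}. ennreal (norm (q i t)) * ennreal (exp (v * t)) \<partial>lborel) \<le> ennreal (1/2 * exp (v * x))"
    using integrable_q by (intro allI Bielecki_weight) (auto simp: integrable_iff_bounded)
  from choice[OF this] obtain w where w: "\<forall>i. w i > 0 \<and> (\<forall>v\<ge>w i. \<forall>x\<ge>0.
      (\<integral>\<^sup>+t\<in>{0..x}. ennreal (norm (q i t)) * ennreal (exp (v * t)) \<partial>lborel) \<le> ennreal (1/2 * exp (v * x)))" ..
  have "w i \<le> max (w 1) (w 2)" for i using exhaust_2[of i] by auto
  then show ?thesis using w by (intro exI[of _ "max (w 1) (w 2)"]) (auto simp: less_max_iff_disj)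
qed

definition wt :: real where
  "wt = (SOME w. w > 0 \<and> (\<forall>i. \<forall>x\<ge>0. (\<integral>\<^sup>+t\<in>{0..x}. ennreal (norm (q i t)) * ennreal (exp (w * t)) \<partial>lborel) \<le> ennreal (1/2 * exp (w * x))))"

lemma wt: "wt > 0"
  "0 \<le> x \<Longrightarrow> (\<integral>\<^sup>+t\<in>{0..x}. ennreal (norm (q i t)) * ennreal (exp (wt * t)) \<partial>lborel) \<le> ennreal (1/2 * exp (wt * x))"
  using someI_ex[OF weight_exists] unfolding wt_def by auto

definition c0 :: real where "c0 = (\<Sum>i\<in>UNIV. LINT t|lborel. norm (a i t))"

lemma c0_nonneg: "c0 \<ge> 0" unfolding c0_def by (intro sum_nonneg) auto

lemma a_bound: "(\<integral>\<^sup>+t. norm (a i t) \<partial>lborel) \<le> ennreal c0"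
proof -
  have "(\<integral>\<^sup>+t. norm (a i t) \<partial>lborel) = ennreal (LINT t|lborel. norm (a i t))"
    using integrable_a by (intro nn_integral_eq_integral) auto
  also have "\<dots> \<le> ennreal c0"
    unfolding c0_def by (intro ennreal_leI member_le_sum) auto
  finally show ?thesis .
qed

lemma set_nn_integral_le: "(\<integral>\<^sup>+x\<in>E. f x \<partial>N) \<le> (\<integral>\<^sup>+x. f x \<partial>N)"
  by (intro nn_integral_mono) (auto simp: indicator_def)

text \<open>Each application of \<open>Ap\<close> halves the weighted section integral, by the
  choice of \<open>wt\<close>; the start uses exp(wt * x) \<ge> 1.\<close>

lemma m_bound: "0 \<le> x \<Longrightarrow> (\<integral>\<^sup>+y\<in>{0..x}. m n i (x, y) \<partial>lborel) \<le> ennreal (c0 * (1/2)^n * exp (wt * x))"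
proof (induction n arbitrary: i x)
  case 0
  have "(\<integral>\<^sup>+y\<in>{0..x}. m 0 i (x, y) \<partial>lborel) \<le> ennreal c0"
    by (auto intro: order.trans[OF set_nn_integral_le a_bound])
  also have "\<dots> \<le> ennreal (c0 * exp (wt * x))"
    using 0 wt(1) c0_nonneg by (intro ennreal_leI) (auto simp: mult_le_cancel_left1)
  finally show ?case by simp
next
  case (Suc n)
  show ?case
    using nn_integral_Ap_weighted[where v="m n" and c="c0 * (1/2)^n" and e="1/2" and w=wt and i=i and x=x, OF m_meas Suc.IH wt(2)]
      Suc.prems c0_nonneg by (simp add: mult_ac)
qed

lemma M_bound: assumes "0 \<le> x"
  shows "(\<integral>\<^sup>+y\<in>{0..x}. M i (x, y) \<partial>lborel) \<le> ennreal (2 * c0 * exp (wt * x))"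
proof -
  have "(\<integral>\<^sup>+y\<in>{0..x}. M i (x, y) \<partial>lborel) = (\<Sum>n. \<integral>\<^sup>+y\<in>{0..x}. m n i (x, y) \<partial>lborel)"
    unfolding M_def by (subst nn_integral_suminf[symmetric]) (auto intro!: nn_integral_cong simp: ennreal_suminf_multc)
  also have "\<dots> \<le> (\<Sum>n. ennreal (c0 * exp (wt * x) * (1/2)^n))"
    using m_bound[OF assms] by (intro suminf_le summableI) (simp add: mult_ac)
  also have "\<dots> = ennreal (\<Sum>n. c0 * exp (wt * x) * (1/2)^n)"
    using c0_nonneg by (intro suminf_ennreal2 summable_mult summable_geometric) auto
  also have "(\<Sum>n. c0 * exp (wt * x) * (1/2)^n) = 2 * c0 * exp (wt * x)"
    by (subst suminf_mult) (auto simp: suminf_geometric)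
  finally show ?thesis .
qed

text \<open>The exceptional set is null in every section, not merely in almost every one; this is
  why the representation and the traces will hold for each x.\<close>

lemma M_finite_section:
  assumes "0 \<le> x" shows "AE y in lborel. y \<in> {0..x} \<longrightarrow> M i (x, y) < \<infinity>"
proof -
  have "(\<integral>\<^sup>+y\<in>{0..x}. M i (x, y) \<partial>lborel) \<noteq> \<infinity>"
    using M_bound[OF assms, of i] by (auto simp: top_unique)
  then have "AE y in lborel. M i (x, y) * indicator {0..x} y \<noteq> \<infinity>"
    by (intro nn_integral_PInf_AE) auto
  then show ?thesis by eventually_elim (auto simp: less_top)
qed

text \<open>Turns weighted bounds on sections into the bound needed along transversal lines; the
  weight is estimated by its value at 1.\<close>

lemma M_section_total:
  "(\<integral>\<^sup>+t\<in>{0..1}. ennreal (norm (q i t)) * (\<integral>\<^sup>+y\<in>{0..t}. v (i+1) (t, y) \<partial>lborel) \<partial>lborel)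
     \<le> ennreal (c * exp wt * (LINT t|lborel. norm (q i t)))"
  if v: "\<And>i x. 0 \<le> x \<Longrightarrow> (\<integral>\<^sup>+y\<in>{0..x}. v i (x, y) \<partial>lborel) \<le> ennreal (c * exp (wt * x))" and c: "c \<ge> 0"
proof -
  have "(\<integral>\<^sup>+t\<in>{0..1}. ennreal (norm (q i t)) * (\<integral>\<^sup>+y\<in>{0..t}. v (i+1) (t, y) \<partial>lborel) \<partial>lborel)
    \<le> (\<integral>\<^sup>+t. ennreal (norm (q i t)) * ennreal (c * exp wt) \<partial>lborel)"
  proof (intro nn_integral_mono)
    fix t :: real
    show "ennreal (norm (q i t)) * (\<integral>\<^sup>+y\<in>{0..t}. v (i+1) (t, y) \<partial>lborel) * indicator {0..1} t \<le> ennreal (norm (q i t)) * ennreal (c * exp wt)"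
    proof (cases "t \<in> {0..1}")
      case True
      have "(\<integral>\<^sup>+y\<in>{0..t}. v (i+1) (t, y) \<partial>lborel) \<le> ennreal (c * exp (wt * t))" using v True by auto
      also have "\<dots> \<le> ennreal (c * exp wt)" using True wt(1) c by (intro ennreal_leI mult_left_mono) auto
      finally show ?thesis using True by (simp add: mult_left_mono)
    qed simp
  qed
  also have "\<dots> = ennreal (LINT t|lborel. norm (q i t)) * ennreal (c * exp wt)"
    using integrable_q[of i] by (simp add: nn_integral_multc nn_integral_eq_integral)
  also have "\<dots> = ennreal (c * exp wt * (LINT t|lborel. norm (q i t)))"
    using c by (simp add: ennreal_mult[symmetric] mult_ac)
  finally show ?thesis .
qed

text \<open>Along a line of slope k > 0 the free term is integrable by substitution, and the
  remaining term \<open>Ap M\<close> is controlled by the section integrals of \<open>M\<close>.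
  Such lines are where the kernel with fixed t will be evaluated.\<close>

lemma M_finite_line:
  assumes k: "k > 0" and line: "\<And>x. x \<in> {s..1} \<Longrightarrow> 0 \<le> \<alpha> + k * x"
  shows "AE x in lborel. x \<in> {s..1} \<longrightarrow> M i (x, \<alpha> + k * x) < \<infinity>"
proof -
  have "(\<integral>\<^sup>+x\<in>{s..1}. M i (x, \<alpha> + k * x) \<partial>lborel) = 
     (\<integral>\<^sup>+x. ennreal (norm (a i (\<alpha> + k * x))) * indicator {s..1} x + Ap M i (x, \<alpha> + k * x) * indicator {s..1} x \<partial>lborel)"
    by (subst M_eq) (simp add: distrib_right)
  also have "\<dots> = (\<integral>\<^sup>+x\<in>{s..1}. ennreal (norm (a i (\<alpha> + k * x))) \<partial>lborel) + (\<integral>\<^sup>+x\<in>{s..1}. Ap M i (x, \<alpha> + k * x) \<partial>lborel)"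
    by (intro nn_integral_add) auto
  also have "\<dots> \<le> ennreal (1/k) * ennreal c0 + ennreal (1/k) * ennreal (2 * c0 * exp wt * (LINT t|lborel. norm (q i t)))"
  proof (rule add_mono)
    show "(\<integral>\<^sup>+x\<in>{s..1}. ennreal (norm (a i (\<alpha> + k * x))) \<partial>lborel) \<le> ennreal (1/k) * ennreal c0"
      using nn_integral_affine_line(2)[OF _ k, of "\<lambda>x. ennreal (norm (a i x))" \<alpha>]
        mult_left_mono[OF a_bound[of i], of "ennreal (1/k)"] by (auto intro: order.trans[OF set_nn_integral_le])
    show "(\<integral>\<^sup>+x\<in>{s..1}. Ap M i (x, \<alpha> + k * x) \<partial>lborel) \<le> ennreal (1/k) * ennreal (2 * c0 * exp wt * (LINT t|lborel. norm (q i t)))"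
      using c0_nonneg by (intro order.trans[OF nn_integral_Ap_line[OF M_meas k line]] mult_left_mono M_section_total M_bound) auto
  qed
  also have "\<dots> < \<infinity>" using c0_nonneg k by (simp add: ennreal_mult[symmetric] ennreal_plus[symmetric] del: ennreal_plus)
  finally have "AE x in lborel. M i (x, \<alpha> + k * x) * indicator {s..1} x \<noteq> \<infinity>"
    by (intro nn_integral_PInf_AE) auto
  then show ?thesis by eventually_elim (auto simp: less_top)
qed

lemma A_integrable_S:
  assumes "M i z < \<infinity>"
  shows "integrable lborel (\<lambda>t. indicator {snd z..fst z} t *\<^sub>R (q i t * S (i+1) (t, t - snd z)))"
proof (rule integrableI_bounded)
  show "(\<lambda>t. indicator {snd z..fst z} t *\<^sub>R (q i t * S (i+1) (t, t - snd z))) \<in> borel_measurable lborel"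
    by measurable
  have "(\<integral>\<^sup>+t. norm (indicator {snd z..fst z} t *\<^sub>R (q i t * S (i+1) (t, t - snd z))) \<partial>lborel) = Ap (\<lambda>i z. ennreal (norm (S i z))) i z"
    unfolding Ap_def by (intro nn_integral_cong) (auto simp: indicator_def norm_mult ennreal_mult)
  also have "\<dots> \<le> Ap M i z" by (intro Ap_mono norm_S_le)
  also have "\<dots> \<le> M i z" by (simp add: M_eq[of i z])
  finally show "(\<integral>\<^sup>+t. norm (indicator {snd z..fst z} t *\<^sub>R (q i t * S (i+1) (t, t - snd z))) \<partial>lborel) < \<infinity>"
    using assms by simp
qed

text \<open>Sum and integral may be exchanged because the integrals of the moduli are bounded by the
  terms of \<open>M\<close>, whose sum is finite at z.\<close>

lemma S_eq:
  assumes fin: "M i z < \<infinity>"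
  shows "S i z = a i (snd z) + A S i z"
proof -
  let ?f = "\<lambda>n t. indicator {snd z..fst z} t *\<^sub>R (q i t * U n (i+1) (t, t - snd z))"
  have Ap: "Ap M i z < \<infinity>" using fin M_eq[of i z] by (simp add: less_top)
  have mm: "(\<integral>\<^sup>+t. norm (?f n t) \<partial>lborel) \<le> m (Suc n) i z" for n
  proof -
    have "(\<integral>\<^sup>+t. norm (?f n t) \<partial>lborel) = Ap (\<lambda>i z. ennreal (norm (U n i z))) i z"
      unfolding Ap_def by (intro nn_integral_cong) (auto simp: indicator_def norm_mult ennreal_mult)
    also have "\<dots> \<le> Ap (m n) i z" by (intro Ap_mono norm_U_le)
    finally show ?thesis by simp
  qed
  have "(\<Sum>n. m (Suc n) i z) \<le> M i z"
    unfolding M_def by (subst (2) suminf_offset[of _ 1]) (auto simp: summableI)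
  then have msum: "(\<Sum>n. m (Suc n) i z) < \<infinity>" using fin by simp
  have mfin: "m (Suc n) i z < \<infinity>" for n
  proof -
    have "m (Suc n) i z \<le> (\<Sum>n. m (Suc n) i z)"
      using sum_le_suminf[of "\<lambda>n. m (Suc n) i z" "{n}"] by (simp add: summableI)
    then show ?thesis using msum by simp
  qed
  have int: "integrable lborel (?f n)" for n
    using mm[of n] mfin[of n] by (intro integrableI_bounded) (auto intro: le_less_trans)
  have "(\<Sum>n. ennreal (LINT t|lborel. norm (?f n t))) \<le> (\<Sum>n. m (Suc n) i z)"
  proof (intro suminf_le summableI)
    show "ennreal (LINT t|lborel. norm (?f n t)) \<le> m (Suc n) i z" for n
      using mm[of n] unfolding nn_integral_eq_integral[OF integrable_norm[OF int[of n]] AE_I2[OF norm_ge_zero]] .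
  qed
  note le = this
  have summ: "summable (\<lambda>n. LINT t|lborel. norm (?f n t))"
  proof (rule summable_suminf_not_top)
    show "0 \<le> (LINT t|lborel. norm (?f n t))" for n
      by (rule Bochner_Integration.integral_nonneg) (rule norm_ge_zero)
    show "(\<Sum>n. ennreal (LINT t|lborel. norm (?f n t))) \<noteq> top"
      by (rule less_imp_neq[OF le_less_trans[OF le msum], unfolded infinity_ennreal_def])
  qed
  \<comment> \<open>Finiteness of \<open>Ap M\<close> controls the product of q and
    \<open>M\<close>. Where q vanishes \<open>M\<close> may be infinite, but there the integrand is
    0.\<close>
  have ae: "AE t in lborel. t \<in> {snd z..fst z} \<longrightarrow> norm (q i t) = 0 \<or> M (i+1) (t, t - snd z) < \<infinity>"
  proof -
    have "AE t in lborel. indicator {snd z..fst z} t * (ennreal (norm (q i t)) * M (i+1) (t, t - snd z)) \<noteq> \<infinity>"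
      using Ap unfolding Ap_def by (intro nn_integral_PInf_AE) auto
    then show ?thesis by eventually_elim (auto simp: ennreal_mult_eq_top_iff less_top)
  qed
  have aes: "AE t in lborel. summable (\<lambda>n. norm (?f n t))"
    using ae
  proof eventually_elim
    case (elim t)
    show ?case
    proof (cases "t \<in> {snd z..fst z} \<and> q i t \<noteq> 0")
      case True
      then have "summable (\<lambda>n. norm (q i t) * norm (U n (i+1) (t, t - snd z)))"
        using elim by (intro summable_mult summable_U) auto
      then show ?thesis using True by (simp add: norm_mult)
    qed auto
  qed
  have "A S i z = (LINT t|lborel. (\<Sum>n. ?f n t))"
    unfolding A_def
  proof (rule integral_cong_AE)
    show "AE t in lborel. indicator {snd z..fst z} t *\<^sub>R (q i t * S (i+1) (t, t - snd z)) = (\<Sum>n. ?f n t)"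
      using ae
    proof eventually_elim
      case (elim t)
      show ?case
      proof (cases "t \<in> {snd z..fst z} \<and> q i t \<noteq> 0")
        case True
        then have "summable (\<lambda>n. U n (i+1) (t, t - snd z))"
          using elim by (intro summable_norm_cancel[OF summable_U]) auto
        then show ?thesis using True unfolding S_def by (simp add: suminf_mult)
      qed auto
    qed
  qed measurable
  also have "\<dots> = (\<Sum>n. LINT t|lborel. ?f n t)"
    by (rule integral_suminf[OF int aes summ])
  also have "\<dots> = (\<Sum>n. U (Suc n) i z)" by (simp add: A_def)
  finally have "A S i z = (\<Sum>n. U (Suc n) i z)" .
  moreover have "S i z = U 0 i z + (\<Sum>n. U (Suc n) i z)"
    unfolding S_def using summable_norm_cancel[OF summable_U[OF fin]] by (subst suminf_split_head) auto
  ultimately show ?thesis by simp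
qed

text \<open>Dominated convergence with the majorant B * |q|: an integrable q is enough to preserve
  continuity and boundedness, so q needs no approximation inside the operator.\<close>

lemma A_continuous_bounded:
  assumes cont: "\<And>i. continuous_on UNIV (G i)" and bdd: "\<And>i. bounded (range (G i))"
  shows "continuous_on UNIV (A G i)" "bounded (range (A G i))"
    "integrable lborel (\<lambda>t. indicator {snd z..fst z} t *\<^sub>R (q i t * G (i+1) (t, t - snd z)))"
proof -
  obtain B where B: "\<And>z. norm (G (i+1) z) \<le> B" using bdd[of "i+1"] by (auto simp: bounded_iff)
  have [measurable]: "G i \<in> borel_measurable (borel \<Otimes>\<^sub>M borel)" for i
    using cont[of i] unfolding borel_prod by (rule borel_measurable_continuous_onI)
  have intw: "integrable lborel (\<lambda>t. B * norm (q i t))" using integrable_q[of i] by auto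
  have dom: "norm (indicator {snd z..fst z} t *\<^sub>R (q i t * G (i+1) (t, t - snd z))) \<le> B * norm (q i t)" for z t
    using mult_right_mono[OF B[of "(t, t - snd z)"], of "norm (q i t)"] order.trans[OF norm_ge_zero B[of z]]
    by (auto simp: indicator_def norm_mult mult.commute)
  have int: "integrable lborel (\<lambda>t. indicator {snd z..fst z} t *\<^sub>R (q i t * G (i+1) (t, t - snd z)))" for z
    by (rule Bochner_Integration.integrable_bound[OF intw])
      (measurable, intro AE_I2 order.trans[OF dom[of z]], simp)
  then show "integrable lborel (\<lambda>t. indicator {snd z..fst z} t *\<^sub>R (q i t * G (i+1) (t, t - snd z)))" .
  have "norm (A G i z) \<le> (LINT t|lborel. B * norm (q i t))" for z
    unfolding A_def by (intro order.trans[OF integral_norm_bound] integral_mono intw integrable_norm int dom)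
  then show "bounded (range (A G i))" by (auto simp: bounded_iff)
  show "continuous_on UNIV (A G i)"
    unfolding continuous_on_sequentially
  proof (intro allI ballI impI)
    fix x :: "nat \<Rightarrow> real \<times> real" and z assume x: "(\<forall>n. x n \<in> UNIV) \<and> x \<longlonglongrightarrow> z"
    then have lim: "(\<lambda>n. fst (x n)) \<longlonglongrightarrow> fst z" "(\<lambda>n. snd (x n)) \<longlonglongrightarrow> snd z"
      by (auto intro: tendsto_fst tendsto_snd)
    have "(\<lambda>n. LINT t|lborel. indicator {snd (x n)..fst (x n)} t *\<^sub>R (q i t * G (i+1) (t, t - snd (x n))))
      \<longlonglongrightarrow> (LINT t|lborel. indicator {snd z..fst z} t *\<^sub>R (q i t * G (i+1) (t, t - snd z)))"
    proof (rule integral_dominated_convergence[OF _ _ intw])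
      show "AE t in lborel. (\<lambda>n. indicator {snd (x n)..fst (x n)} t *\<^sub>R (q i t * G (i+1) (t, t - snd (x n))))
         \<longlonglongrightarrow> indicator {snd z..fst z} t *\<^sub>R (q i t * G (i+1) (t, t - snd z))"
        \<comment> \<open>The indicator of the moving interval converges at every t except possibly
          the two limiting end points.\<close>
        using AE_lborel_singleton[of "fst z"] AE_lborel_singleton[of "snd z"]
      proof eventually_elim
        case (elim t)
        have G: "(\<lambda>n. G (i+1) (t, t - snd (x n))) \<longlonglongrightarrow> G (i+1) (t, t - snd z)"
          by (rule continuous_on_tendsto_compose[OF cont]) (auto intro!: tendsto_intros lim)
        have "(\<lambda>n. indicator {snd (x n)..fst (x n)} t :: real) \<longlonglongrightarrow> indicator {snd z..fst z} t"
        proof (rule tendsto_eventually)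
          consider "t < snd z" | "t > fst z" | "snd z < t" "t < fst z" using elim by linarith
          then show "\<forall>\<^sub>F n in sequentially. indicator {snd (x n)..fst (x n)} t = (indicator {snd z..fst z} t :: real)"
          proof cases
            case 1
            then show ?thesis using order_tendstoD(1)[OF lim(2) 1] by (auto elim!: eventually_mono)
          next
            case 2
            then show ?thesis using order_tendstoD(2)[OF lim(1) 2] by (auto elim!: eventually_mono)
          next
            case 3
            show ?thesis using order_tendstoD(2)[OF lim(2) 3(1)] order_tendstoD(1)[OF lim(1) 3(2)]
              by eventually_elim (use 3 in \<open>simp add: indicator_def\<close>)
          qed
        qed
        then show ?case by (intro tendsto_scaleR tendsto_mult tendsto_const G)
      qed
    qed (use dom in auto)
    then show "(A G i \<circ> x) \<longlonglongrightarrow> A G i z" unfolding A_def o_def .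
  qed
qed

end

section \<open>Approximation of the density by continuous functions\<close>

context goursat begin

lemma S_diff_le:
  assumes fin: "M i z < \<infinity>" and G: "\<And>i. continuous_on UNIV (G i)" "\<And>i. bounded (range (G i))"
  shows "ennreal (norm (S i z - (g (snd z) + A G i z))) \<le>
    ennreal (norm (a i (snd z) - g (snd z))) + Ap (\<lambda>i z. ennreal (norm (S i z - G i z))) i z"
proof -
  have "A S i z - A G i z = A (\<lambda>i z. S i z - G i z) i z"
    unfolding A_def
    by (subst Bochner_Integration.integral_diff[symmetric, OF A_integrable_S[OF fin] A_continuous_bounded(3)[OF G]])
      (simp add: scaleR_diff_right[symmetric] right_diff_distrib)
  then have eq: "S i z - (g (snd z) + A G i z) = (a i (snd z) - g (snd z)) + A (\<lambda>i z. S i z - G i z) i z"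
    using S_eq[OF fin] by (simp add: algebra_simps)
  have "ennreal (norm (S i z - (g (snd z) + A G i z))) \<le>
      ennreal (norm (a i (snd z) - g (snd z))) + ennreal (norm (A (\<lambda>i z. S i z - G i z) i z))"
    unfolding eq by (simp add: ennreal_plus[symmetric] norm_triangle_ineq ennreal_leI del: ennreal_plus)
  also have "\<dots> \<le> ennreal (norm (a i (snd z) - g (snd z))) + Ap (\<lambda>i z. ennreal (norm (S i z - G i z))) i z"
    by (intro add_left_mono norm_A_le)
  finally show ?thesis .
qed

text \<open>The weight \<open>wt\<close> is built in so that one step of the iteration halves the
  constant c.\<close>

definition section_close :: "(2 \<Rightarrow> real \<times> real \<Rightarrow> complex) \<Rightarrow> real \<Rightarrow> bool" where
  "section_close G c \<longleftrightarrow> (\<forall>i. continuous_on UNIV (G i)) \<and> (\<forall>i. bounded (range (G i))) \<and>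
    (\<forall>i x. 0 \<le> x \<longrightarrow> (\<integral>\<^sup>+y\<in>{0..x}. ennreal (norm (S i (x, y) - G i (x, y))) \<partial>lborel) \<le> ennreal (c * exp (wt * x)))"

lemma section_closeD:
  assumes "section_close G c"
  shows "continuous_on UNIV (G i)" "bounded (range (G i))"
    "0 \<le> x \<Longrightarrow> (\<integral>\<^sup>+y\<in>{0..x}. ennreal (norm (S i (x, y) - G i (x, y))) \<partial>lborel) \<le> ennreal (c * exp (wt * x))"
  using assms unfolding section_close_def by auto

lemma section_close_mono: "section_close G c \<Longrightarrow> c \<le> d \<Longrightarrow> section_close G d"
  unfolding section_close_def by (meson ennreal_leI exp_ge_zero mult_right_mono order.trans)

text \<open>One Picard step G' = g + A G with a continuous g close to the free term. On sections the
  error c becomes e + c / 2. Along lines the error of G' is bounded through the section error of G,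
  so nothing has to be known about G on lines.\<close>

lemma improve_approx:
  assumes close: "section_close G c" and c0: "c \<ge> 0" and e: "e > 0"
  obtains G' where "section_close G' (e + c / 2)"
    "\<forall>i k \<alpha> s. k > 0 \<longrightarrow> (\<forall>x\<in>{s..1}. 0 \<le> \<alpha> + k * x) \<longrightarrow>
       (\<integral>\<^sup>+x\<in>{s..1}. ennreal (norm (S i (x, \<alpha> + k * x) - G' i (x, \<alpha> + k * x))) \<partial>lborel)
         \<le> ennreal ((e + c * exp wt * (LINT t|lborel. norm (q i t))) / k)"
proof -
  note G = section_closeD(1,2)[OF close] and c = c0 section_closeD(3)[OF close]
  have "\<forall>i. \<exists>g. continuous_on UNIV g \<and> bounded (range g) \<and> (\<integral>\<^sup>+x. ennreal (norm (a i x - g x)) \<partial>lborel) < ennreal e"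
    using continuous_bounded_dense_L1[OF integrable_a e] by blast
  then obtain g where g: "\<And>i. continuous_on UNIV (g i)" "\<And>i. bounded (range (g i))"
     "\<And>i. (\<integral>\<^sup>+x. ennreal (norm (a i x - g i x)) \<partial>lborel) < ennreal e"
    by metis
  define G' where "G' i z = g i (snd z) + A G i z" for i z
  let ?D = "\<lambda>i z. ennreal (norm (S i z - G i z))"
  have [measurable]: "G i \<in> borel_measurable (borel \<Otimes>\<^sub>M borel)" for i
    using G(1)[of i] unfolding borel_prod by (rule borel_measurable_continuous_onI)
  have [measurable]: "g i \<in> borel_measurable borel" for i
    using g(1)[of i] by (rule borel_measurable_continuous_onI)
  have D[measurable]: "?D i \<in> borel_measurable (borel \<Otimes>\<^sub>M borel)" for i
    by measurable
  have [measurable]: "Ap ?D i \<in> borel_measurable (borel \<Otimes>\<^sub>M borel)" for i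
    by (rule Ap_meas) (rule D)
  have cont: "continuous_on UNIV (G' i)" for i
    unfolding G'_def by (intro continuous_intros A_continuous_bounded G continuous_on_compose2[OF g(1)]) auto
  have bdd: "bounded (range (G' i))" for i
  proof -
    have "bounded (range (\<lambda>z::real \<times> real. g i (snd z)))"
      by (rule bounded_subset[OF g(2)[of i]]) auto
    then show ?thesis
      unfolding G'_def by (intro bounded_plus_comp A_continuous_bounded(2)[OF G]) auto
  qed
  have sec: "(\<integral>\<^sup>+y\<in>{0..x}. ennreal (norm (S i (x, y) - G' i (x, y))) \<partial>lborel) \<le> ennreal ((e + c / 2) * exp (wt * x))"
    if x: "0 \<le> x" for i x
  proof -
    have "(\<integral>\<^sup>+y\<in>{0..x}. ennreal (norm (S i (x, y) - G' i (x, y))) \<partial>lborel) \<le>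
      (\<integral>\<^sup>+y. ennreal (norm (a i y - g i y)) * indicator {0..x} y + Ap ?D i (x, y) * indicator {0..x} y \<partial>lborel)"
    proof (rule nn_integral_mono_AE)
      show "AE y in lborel. ennreal (norm (S i (x, y) - G' i (x, y))) * indicator {0..x} y \<le>
         ennreal (norm (a i y - g i y)) * indicator {0..x} y + Ap ?D i (x, y) * indicator {0..x} y"
        using M_finite_section[OF x, of i]
      proof eventually_elim
        case (elim y)
        then show ?case using S_diff_le[of i "(x, y)" G "g i", OF _ G] by (auto simp: G'_def indicator_def)
      qed
    qed
    also have "\<dots> = (\<integral>\<^sup>+y\<in>{0..x}. ennreal (norm (a i y - g i y)) \<partial>lborel) + (\<integral>\<^sup>+y\<in>{0..x}. Ap ?D i (x, y) \<partial>lborel)"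
      by (rule nn_integral_add) measurable
    also have "\<dots> \<le> ennreal (e * exp (wt * x)) + ennreal (c * (1/2) * exp (wt * x))"
    proof (rule add_mono)
      have "(\<integral>\<^sup>+y\<in>{0..x}. ennreal (norm (a i y - g i y)) \<partial>lborel) \<le> ennreal e"
        using g(3)[of i] by (intro order.trans[OF set_nn_integral_le]) auto
      also have "\<dots> \<le> ennreal (e * exp (wt * x))"
        using e wt(1) x by (intro ennreal_leI) (auto simp: mult_le_cancel_left1)
      finally show "(\<integral>\<^sup>+y\<in>{0..x}. ennreal (norm (a i y - g i y)) \<partial>lborel) \<le> ennreal (e * exp (wt * x))" .
      show "(\<integral>\<^sup>+y\<in>{0..x}. Ap ?D i (x, y) \<partial>lborel) \<le> ennreal (c * (1/2) * exp (wt * x))"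
        by (rule nn_integral_Ap_weighted[OF D c(2) wt(2) x c(1)]) auto
    qed
    also have "\<dots> = ennreal ((e + c / 2) * exp (wt * x))"
      using e c by (simp add: ennreal_plus[symmetric] distrib_right del: ennreal_plus)
    finally show ?thesis .
  qed
  have line: "(\<integral>\<^sup>+x\<in>{s..1}. ennreal (norm (S i (x, \<alpha> + k * x) - G' i (x, \<alpha> + k * x))) \<partial>lborel)
         \<le> ennreal ((e + c * exp wt * (LINT t|lborel. norm (q i t))) / k)"
    if k: "k > 0" and l: "\<And>x. x \<in> {s..1} \<Longrightarrow> 0 \<le> \<alpha> + k * x" for i k \<alpha> s
  proof -
    let ?Q = "LINT t|lborel. norm (q i t)"
    have "(\<integral>\<^sup>+x\<in>{s..1}. ennreal (norm (S i (x, \<alpha> + k * x) - G' i (x, \<alpha> + k * x))) \<partial>lborel) \<le>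
      (\<integral>\<^sup>+x. ennreal (norm (a i (\<alpha> + k * x) - g i (\<alpha> + k * x))) * indicator {s..1} x + Ap ?D i (x, \<alpha> + k * x) * indicator {s..1} x \<partial>lborel)"
    proof (rule nn_integral_mono_AE)
      have "AE x in lborel. x \<in> {s..1} \<longrightarrow> M i (x, \<alpha> + k * x) < \<infinity>"
        using l by (intro M_finite_line k) auto
      then show "AE x in lborel. ennreal (norm (S i (x, \<alpha> + k * x) - G' i (x, \<alpha> + k * x))) * indicator {s..1} x \<le>
         ennreal (norm (a i (\<alpha> + k * x) - g i (\<alpha> + k * x))) * indicator {s..1} x + Ap ?D i (x, \<alpha> + k * x) * indicator {s..1} x"
      proof eventually_elim
        case (elim x)
        then show ?case using S_diff_le[of i "(x, \<alpha> + k * x)" G "g i", OF _ G] by (auto simp: G'_def indicator_def)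
      qed
    qed
    also have "\<dots> = (\<integral>\<^sup>+x\<in>{s..1}. ennreal (norm (a i (\<alpha> + k * x) - g i (\<alpha> + k * x))) \<partial>lborel) + (\<integral>\<^sup>+x\<in>{s..1}. Ap ?D i (x, \<alpha> + k * x) \<partial>lborel)"
      by (rule nn_integral_add) measurable
    also have "\<dots> \<le> ennreal (1 / k) * ennreal e + ennreal (1 / k) * ennreal (c * exp wt * ?Q)"
    proof (rule add_mono)
      have "(\<integral>\<^sup>+x\<in>{s..1}. ennreal (norm (a i (\<alpha> + k * x) - g i (\<alpha> + k * x))) \<partial>lborel) \<le> ennreal (1/k) * (\<integral>\<^sup>+x. ennreal (norm (a i x - g i x)) \<partial>lborel)"
        using nn_integral_affine_line(2)[OF _ k, of "\<lambda>x. ennreal (norm (a i x - g i x))" \<alpha>]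
        by (intro order.trans[OF set_nn_integral_le]) simp
      also have "\<dots> \<le> ennreal (1 / k) * ennreal e" using g(3)[of i] by (intro mult_left_mono) auto
      finally show "(\<integral>\<^sup>+x\<in>{s..1}. ennreal (norm (a i (\<alpha> + k * x) - g i (\<alpha> + k * x))) \<partial>lborel) \<le> ennreal (1 / k) * ennreal e" .
      show "(\<integral>\<^sup>+x\<in>{s..1}. Ap ?D i (x, \<alpha> + k * x) \<partial>lborel) \<le> ennreal (1 / k) * ennreal (c * exp wt * ?Q)"
        using l by (intro order.trans[OF nn_integral_Ap_line[OF D k]] mult_left_mono M_section_total c) auto
    qed
    also have "\<dots> = ennreal ((e + c * exp wt * ?Q) / k)"
      using e c k by (simp add: ennreal_mult[symmetric] ennreal_plus[symmetric] add_divide_distrib del: ennreal_plus)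
    finally show ?thesis .
  qed
  show ?thesis
    by (rule that[of G'], unfold section_close_def) (use cont bdd sec line in simp_all)
qed

lemma S_bound: assumes "0 \<le> x"
  shows "(\<integral>\<^sup>+y\<in>{0..x}. ennreal (norm (S i (x, y))) \<partial>lborel) \<le> ennreal (2 * c0 * exp (wt * x))"
  by (intro order.trans[OF nn_integral_mono M_bound[OF assms, of i]] mult_right_mono norm_S_le) auto

text \<open>The recursion from c to e / 4 + c / 2 has the fixed point e / 2. Started from G = 0,
  whose error is the bound 2 * c0 of \<open>S\<close>, the excess over the fixed point is halved in
  every step.\<close>

lemma section_approx:
  assumes "e > 0"
  obtains G where "section_close G e"
proof -
  have "\<exists>G. section_close G (e / 2 + 2 * c0 / 2 ^ n)" for n
  proof (induction n)
    case 0
    have "section_close (\<lambda>_ _. 0) (2 * c0)"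
      using S_bound by (simp add: section_close_def)
    then show ?case using assms by (intro exI) (rule section_close_mono, auto)
  next
    case (Suc n)
    then obtain G where G: "section_close G (e / 2 + 2 * c0 / 2 ^ n)" by blast
    have "0 \<le> e / 2 + 2 * c0 / 2 ^ n" "0 < e / 4" using assms c0_nonneg by auto
    from improve_approx[OF G this] obtain G' where "section_close G' (e / 4 + (e / 2 + 2 * c0 / 2 ^ n) / 2)" .
    moreover have "e / 4 + (e / 2 + 2 * c0 / 2 ^ n) / 2 = e / 2 + 2 * c0 / 2 ^ Suc n" by (simp add: field_simps)
    ultimately show ?case by auto
  qed
  moreover obtain n where "2 * c0 / 2 ^ n < e / 2"
  proof -
    have "(\<lambda>n. 2 * c0 / 2 ^ n) \<longlonglongrightarrow> 0"
      by (intro tendsto_divide_0[OF tendsto_const] filterlim_at_top_imp_at_infinity filterlim_realpow_sequentially_gt1) auto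
    from order_tendstoD(2)[OF this, of "e/2"] assms show ?thesis using that by (auto simp: eventually_sequentially)
  qed
  ultimately show ?thesis using that section_close_mono[of _ "e / 2 + 2 * c0 / 2 ^ n" e] by force
qed

text \<open>\<open>section_approx\<close> says nothing about lines; one further Picard step adds the
  estimate on them. Later, fixing x in the kernel leads to sections and fixing t to lines of slope
  k.\<close>

theorem S_approx:
  assumes e: "e > 0"
  shows "\<exists>G :: 2 \<Rightarrow> real \<times> real \<Rightarrow> complex. (\<forall>i. continuous_on UNIV (G i) \<and> bounded (range (G i))) \<and>
    (\<forall>i. \<forall>x\<in>{0..1}. (\<integral>\<^sup>+y\<in>{0..x}. ennreal (norm (S i (x, y) - G i (x, y))) \<partial>lborel) \<le> ennreal e) \<and>
    (\<forall>i k \<alpha> s. k > 0 \<longrightarrow> (\<forall>x\<in>{s..1}. 0 \<le> \<alpha> + k * x) \<longrightarrow>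
       (\<integral>\<^sup>+x\<in>{s..1}. ennreal (norm (S i (x, \<alpha> + k * x) - G i (x, \<alpha> + k * x))) \<partial>lborel) \<le> ennreal (e / k))"
proof -
  define Q where "Q = (\<Sum>i\<in>UNIV. LINT t|lborel. norm (q i t))"
  have Q: "(LINT t|lborel. norm (q i t)) \<le> Q" for i
    unfolding Q_def by (intro member_le_sum) auto
  have Q0: "0 \<le> Q" unfolding Q_def by (intro sum_nonneg) auto
  \<comment> \<open>Makes d * exp wt * Q and d * exp wt at most e / 2; the other half of e is left
    for the approximation of the free term.\<close>
  define d where "d = e / (2 * exp wt * (Q + 1))"
  have d: "d > 0" using e Q0 by (simp add: d_def)
  have dQ: "d * exp wt * Q \<le> e / 2" "d * exp wt \<le> e / 2"
  proof -
    have "d * (2 * exp wt * (Q + 1)) = e" using Q0 by (simp add: d_def)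
    then have "d * exp wt * (Q + 1) = e / 2" by (simp add: mult_ac)
    moreover have "0 \<le> d * exp wt" "0 \<le> d * exp wt * Q" using d Q0 by auto
    ultimately show "d * exp wt * Q \<le> e / 2" "d * exp wt \<le> e / 2" by (simp_all add: distrib_left)
  qed
  define e' where "e' = e / (2 * exp wt)"
  have e': "e' > 0" "e' * exp wt = e / 2" using e by (auto simp: e'_def)
  have e'2: "e' \<le> e / 2"
  proof -
    have "e' * 1 \<le> e' * exp wt" using e' wt(1) by (intro mult_left_mono) auto
    then show ?thesis using e' by simp
  qed
  obtain G where G: "section_close G d" using section_approx[OF d] .
  obtain G' where G': "section_close G' (e' + d / 2)"
    and line: "\<forall>i k \<alpha> s. k > 0 \<longrightarrow> (\<forall>x\<in>{s..1}. 0 \<le> \<alpha> + k * x) \<longrightarrow>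
       (\<integral>\<^sup>+x\<in>{s..1}. ennreal (norm (S i (x, \<alpha> + k * x) - G' i (x, \<alpha> + k * x))) \<partial>lborel)
         \<le> ennreal ((e' + d * exp wt * (LINT t|lborel. norm (q i t))) / k)"
    using improve_approx[OF G less_imp_le[OF d] e'(1)] .
  note sec = section_closeD(3)[OF G']
  show ?thesis
  proof (intro exI[of _ G'] conjI allI impI ballI)
    fix i x assume "x \<in> {0..1::real}"
    then have x: "0 \<le> x" "x \<le> 1" by auto
    have "(e' + d / 2) * exp (wt * x) \<le> (e' + d / 2) * exp wt"
      using x wt(1) e' d by (intro mult_left_mono) auto
    also have "\<dots> = e' * exp wt + (d * exp wt) / 2" by (simp add: algebra_simps)
    also have "\<dots> \<le> e" using e'(2) dQ(2) e by linarith
    finally show "(\<integral>\<^sup>+y\<in>{0..x}. ennreal (norm (S i (x, y) - G' i (x, y))) \<partial>lborel) \<le> ennreal e"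
      using sec[OF x(1), of i] by (auto intro: order.trans ennreal_leI)
  next
    fix i k \<alpha> s assume k: "0 < (k::real)" and l: "\<forall>x\<in>{s..1}. 0 \<le> \<alpha> + k * x"
    have "d * exp wt * (LINT t|lborel. norm (q i t)) \<le> d * exp wt * Q"
      using Q d by (intro mult_left_mono) auto
    then have "(e' + d * exp wt * (LINT t|lborel. norm (q i t))) / k \<le> e / k"
      using dQ e'2 k by (intro divide_right_mono) auto
    then show "(\<integral>\<^sup>+x\<in>{s..1}. ennreal (norm (S i (x, \<alpha> + k * x) - G' i (x, \<alpha> + k * x))) \<partial>lborel) \<le> ennreal (e / k)"
      using line[rule_format, OF k, of s \<alpha> i] l by (auto intro: order.trans ennreal_leI)
  qed (use section_closeD(1,2)[OF G'] in blast)+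
qed

end

section \<open>The integral equation and its uniqueness\<close>

context goursat begin

lemma exp_bound:
  fixes d :: complex
  assumes "0 \<le> y" "y \<le> x"
  shows "norm (exp (d * of_real y)) \<le> exp (norm d * x)"
proof -
  have "Re (d * of_real y) \<le> norm d * y"
    using assms complex_Re_le_cmod[of d] by (simp add: mult_right_mono)
  also have "\<dots> \<le> norm d * x" using assms by (simp add: mult_left_mono)
  finally have "Re (d * of_real y) \<le> norm d * x" .
  then show ?thesis by (simp add: norm_exp_eq_Re)
qed

text \<open>Ansatz for a component of the solution with its free phase divided out; \<gamma> is the
  value at 0, and the spectral parameter enters through d alone.\<close>

definition z :: "(2 \<Rightarrow> complex) \<Rightarrow> (2 \<Rightarrow> complex) \<Rightarrow> 2 \<Rightarrow> real \<Rightarrow> complex" where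
  "z \<gamma> d i x = \<gamma> i + (LINT y|lborel. indicator {0..x} y *\<^sub>R (S i (x, y) * exp (d i * of_real y)))"

lemma S_exp_integrable:
  assumes x: "0 \<le> x"
  shows "integrable lborel (\<lambda>y. indicator {0..x} y *\<^sub>R (S i (x, y) * exp (c * of_real y)))"
    and "norm (LINT y|lborel. indicator {0..x} y *\<^sub>R (S i (x, y) * exp (c * of_real y))) \<le> 2 * c0 * exp (wt * x) * exp (norm c * x)"
proof -
  have bd: "(\<integral>\<^sup>+y. norm (indicator {0..x} y *\<^sub>R (S i (x, y) * exp (c * of_real y))) \<partial>lborel) \<le> ennreal (2 * c0 * exp (wt * x) * exp (norm c * x))"
  proof -
    have "(\<integral>\<^sup>+y. norm (indicator {0..x} y *\<^sub>R (S i (x, y) * exp (c * of_real y))) \<partial>lborel) \<le>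
      (\<integral>\<^sup>+y. (ennreal (norm (S i (x, y))) * indicator {0..x} y) * ennreal (exp (norm c * x)) \<partial>lborel)"
    proof (intro nn_integral_mono)
      fix y :: real
      show "ennreal (norm (indicator {0..x} y *\<^sub>R (S i (x, y) * exp (c * of_real y)))) \<le>
         (ennreal (norm (S i (x, y))) * indicator {0..x} y) * ennreal (exp (norm c * x))"
        using exp_bound[of y x c] mult_left_mono[OF exp_bound[of y x c], of "norm (S i (x, y))"]
        by (auto simp: indicator_def norm_mult ennreal_mult[symmetric] intro!: ennreal_leI)
    qed
    also have "\<dots> = (\<integral>\<^sup>+y\<in>{0..x}. norm (S i (x, y)) \<partial>lborel) * ennreal (exp (norm c * x))"
      by (rule nn_integral_multc) measurable
    also have "\<dots> \<le> ennreal (2 * c0 * exp (wt * x)) * ennreal (exp (norm c * x))"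
      by (intro mult_right_mono S_bound x) auto
    finally show ?thesis using c0_nonneg by (simp add: ennreal_mult)
  qed
  show "integrable lborel (\<lambda>y. indicator {0..x} y *\<^sub>R (S i (x, y) * exp (c * of_real y)))"
    by (rule integrableI_bounded) (use bd in \<open>auto intro: le_less_trans\<close>)
  have "ennreal (norm (LINT y|lborel. indicator {0..x} y *\<^sub>R (S i (x, y) * exp (c * of_real y)))) \<le> ennreal (2 * c0 * exp (wt * x) * exp (norm c * x))"
    by (rule order.trans[OF ennreal_norm_integral_le bd])
  then show "norm (LINT y|lborel. indicator {0..x} y *\<^sub>R (S i (x, y) * exp (c * of_real y))) \<le> 2 * c0 * exp (wt * x) * exp (norm c * x)"
    using c0_nonneg by (subst (asm) ennreal_le_iff) auto
qed

lemma integral_reflect: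
  fixes f :: "real \<Rightarrow> complex"
  shows "(LINT x|lborel. indicator {0..s} x *\<^sub>R f (s - x)) = (LINT x|lborel. indicator {0..s} x *\<^sub>R f x)"
proof -
  have "(LINT x|lborel. indicator {0..s} x *\<^sub>R f x) = (LINT x|lborel. indicator {0..s} (s + (-1) * x) *\<^sub>R f (s + (-1) * x))"
    by (subst lborel_integral_real_affine[of "-1" _ s]) auto
  also have "\<dots> = (LINT x|lborel. indicator {0..s} x *\<^sub>R f (s - x))"
    by (intro Bochner_Integration.integral_cong) (auto simp: indicator_def)
  finally show ?thesis by simp
qed

text \<open>Fubini on 0 \<le> y \<le> t \<le> x. Since d (i + 1) = - d i, the phase splits as exp(d
  i * y) = exp(d i * t) * exp(d (i + 1) * (t - y)), which turns the operator \<open>A\<close> into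
  the coupling with the other component. This identity makes a density independent of the spectral
  parameter possible.\<close>

lemma A_exp_integral:
  assumes x: "0 \<le> x" and d: "d (i+1) = - d i"
  shows "integrable lborel (\<lambda>y. indicator {0..x} y *\<^sub>R (A S i (x, y) * exp (d i * of_real y)))"
    and "(LINT y|lborel. indicator {0..x} y *\<^sub>R (A S i (x, y) * exp (d i * of_real y))) =
     (LINT t|lborel. indicator {0..x} t *\<^sub>R (q i t * exp (d i * of_real t) *
       (LINT y|lborel. indicator {0..t} y *\<^sub>R (S (i+1) (t, y) * exp (d (i+1) * of_real y)))))"
    and "integrable lborel (\<lambda>t. indicator {0..x} t *\<^sub>R (q i t * exp (d i * of_real t) *
       (LINT y|lborel. indicator {0..t} y *\<^sub>R (S (i+1) (t, y) * exp (d (i+1) * of_real y)))))"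
proof -
  define f where "f y t = (indicator {0..x} y *\<^sub>R exp (d i * of_real y)) * (indicator {y..x} t *\<^sub>R (q i t * S (i+1) (t, t - y)))" for y t
  have fm[measurable]: "case_prod f \<in> borel_measurable (lborel \<Otimes>\<^sub>M lborel)"
    unfolding f_def indicator_def atLeastAtMost_iff by measurable
  have "(\<integral>\<^sup>+p. norm (case_prod f p) \<partial>(lborel \<Otimes>\<^sub>M lborel)) = (\<integral>\<^sup>+y. \<integral>\<^sup>+t. norm (f y t) \<partial>lborel \<partial>lborel)"
    by (subst lborel.nn_integral_fst[symmetric]) auto
  also have "\<dots> \<le> (\<integral>\<^sup>+y. ennreal (exp (norm (d i) * x)) * (M i (x, y) * indicator {0..x} y) \<partial>lborel)"
  proof (intro nn_integral_mono)
    fix y :: real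
    have "(\<integral>\<^sup>+t. norm (f y t) \<partial>lborel) \<le> (\<integral>\<^sup>+t. (ennreal (exp (norm (d i) * x)) * indicator {0..x} y) * (indicator {y..x} t * (ennreal (norm (q i t)) * ennreal (norm (S (i+1) (t, t - y))))) \<partial>lborel)"
    proof (intro nn_integral_mono)
      fix t :: real
      show "ennreal (norm (f y t)) \<le> (ennreal (exp (norm (d i) * x)) * indicator {0..x} y) * (indicator {y..x} t * (ennreal (norm (q i t)) * ennreal (norm (S (i+1) (t, t - y)))))"
        using mult_right_mono[OF exp_bound[of y x "d i"], of "norm (q i t) * norm (S (i+1) (t, t - y))"]
        by (auto simp: f_def indicator_def norm_mult ennreal_mult[symmetric] intro!: ennreal_leI)
    qed
    also have "\<dots> = (ennreal (exp (norm (d i) * x)) * indicator {0..x} y) * Ap (\<lambda>i z. ennreal (norm (S i z))) i (x, y)"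
      unfolding Ap_def by (subst nn_integral_cmult) auto
    also have "\<dots> \<le> (ennreal (exp (norm (d i) * x)) * indicator {0..x} y) * M i (x, y)"
    proof (intro mult_left_mono)
      have "Ap (\<lambda>i z. ennreal (norm (S i z))) i (x, y) \<le> Ap M i (x, y)" by (intro Ap_mono norm_S_le)
      also have "\<dots> \<le> M i (x, y)" by (simp add: M_eq[of i "(x, y)"])
      finally show "Ap (\<lambda>i z. ennreal (norm (S i z))) i (x, y) \<le> M i (x, y)" .
    qed auto
    finally show "(\<integral>\<^sup>+t. norm (f y t) \<partial>lborel) \<le> ennreal (exp (norm (d i) * x)) * (M i (x, y) * indicator {0..x} y)"
      by (simp add: mult_ac)
  qed
  also have "\<dots> = ennreal (exp (norm (d i) * x)) * (\<integral>\<^sup>+y\<in>{0..x}. M i (x, y) \<partial>lborel)"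
    by (rule nn_integral_cmult) measurable
  also have "\<dots> \<le> ennreal (exp (norm (d i) * x)) * ennreal (2 * c0 * exp (wt * x))"
    by (intro mult_left_mono M_bound x) auto
  also have "\<dots> < \<infinity>" by (simp add: ennreal_mult_less_top)
  finally have fint: "integrable (lborel \<Otimes>\<^sub>M lborel) (case_prod f)"
    by (intro integrableI_bounded) auto
  have inner_y: "(LINT t|lborel. f y t) = indicator {0..x} y *\<^sub>R (A S i (x, y) * exp (d i * of_real y))" for y
    unfolding f_def A_def by (subst integral_mult_right_zero) (simp add: mult_ac)
  have inner_t: "(LINT y|lborel. f y t) = indicator {0..x} t *\<^sub>R (q i t * exp (d i * of_real t) *
       (LINT y|lborel. indicator {0..t} y *\<^sub>R (S (i+1) (t, y) * exp (d (i+1) * of_real y))))" for t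
  proof -
    have "(LINT y|lborel. f y t) = (LINT y|lborel. (indicator {0..x} t *\<^sub>R (q i t * exp (d i * of_real t))) *
        (indicator {0..t} y *\<^sub>R (S (i+1) (t, t - y) * exp (d (i+1) * of_real (t - y)))))"
    proof (intro Bochner_Integration.integral_cong refl)
      fix y
      have "exp (d i * of_real y) = exp (d i * of_real t) * exp (d (i+1) * of_real (t - y))"
        unfolding d exp_add[symmetric] by (simp add: algebra_simps)
      then show "f y t = (indicator {0..x} t *\<^sub>R (q i t * exp (d i * of_real t))) *
        (indicator {0..t} y *\<^sub>R (S (i+1) (t, t - y) * exp (d (i+1) * of_real (t - y))))"
        by (auto simp: f_def indicator_def mult_ac)
    qed
    also have "\<dots> = (indicator {0..x} t *\<^sub>R (q i t * exp (d i * of_real t))) *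
        (LINT y|lborel. indicator {0..t} y *\<^sub>R (S (i+1) (t, t - y) * exp (d (i+1) * of_real (t - y))))"
      by (rule integral_mult_right_zero)
    finally show ?thesis
      unfolding integral_reflect[of t "\<lambda>y. S (i+1) (t, y) * exp (d (i+1) * of_real y)"]
      by simp
  qed
  show "integrable lborel (\<lambda>y. indicator {0..x} y *\<^sub>R (A S i (x, y) * exp (d i * of_real y)))"
    using lborel_pair.integrable_fst[OF fint] unfolding inner_y .
  show "integrable lborel (\<lambda>t. indicator {0..x} t *\<^sub>R (q i t * exp (d i * of_real t) *
       (LINT y|lborel. indicator {0..t} y *\<^sub>R (S (i+1) (t, y) * exp (d (i+1) * of_real y)))))"
    using lborel_pair.integrable_snd[OF fint] unfolding inner_t .
  show "(LINT y|lborel. indicator {0..x} y *\<^sub>R (A S i (x, y) * exp (d i * of_real y))) =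
     (LINT t|lborel. indicator {0..x} t *\<^sub>R (q i t * exp (d i * of_real t) *
       (LINT y|lborel. indicator {0..t} y *\<^sub>R (S (i+1) (t, y) * exp (d (i+1) * of_real y)))))"
    using lborel_pair.Fubini_integral[OF fint] unfolding inner_y inner_t by simp
qed

lemma q_exp_integrable:
  "integrable lborel (\<lambda>t. indicator {0..x} t *\<^sub>R (q i t * exp (c * of_real t)))"
proof (rule Bochner_Integration.integrable_bound)
  show "integrable lborel (\<lambda>t. exp (norm c * x) * norm (q i t))" using integrable_q[of i] by auto
  show "AE t in lborel. norm (indicator {0..x} t *\<^sub>R (q i t * exp (c * of_real t))) \<le> norm (exp (norm c * x) * norm (q i t))"
  proof (intro AE_I2)
    fix t :: real
    show "norm (indicator {0..x} t *\<^sub>R (q i t * exp (c * of_real t))) \<le> norm (exp (norm c * x) * norm (q i t))"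
      using mult_left_mono[OF exp_bound[of t x c], of "norm (q i t)"]
      by (cases "t \<in> {0..x}") (simp_all add: norm_mult mult.commute)
  qed
qed measurable

text \<open>The constant part \<gamma> (i + 1) of the other component produces the free term a i of
  the Goursat problem, and its integral part produces \<open>A S\<close>.\<close>

theorem z_equation:
  assumes x: "0 \<le> x" and d: "d (i+1) = - d i" and a: "\<And>t. a i t = \<gamma> (i+1) * q i t"
  shows "z \<gamma> d i x = \<gamma> i + (LINT t|lborel. indicator {0..x} t *\<^sub>R (q i t * exp (d i * of_real t) * z \<gamma> d (i+1) t))"
proof -
  let ?I = "\<lambda>t. LINT y|lborel. indicator {0..t} y *\<^sub>R (S (i+1) (t, y) * exp (d (i+1) * of_real y))"
  have "(LINT y|lborel. indicator {0..x} y *\<^sub>R (S i (x, y) * exp (d i * of_real y))) =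
    (LINT y|lborel. \<gamma> (i+1) * (indicator {0..x} y *\<^sub>R (q i y * exp (d i * of_real y))) + indicator {0..x} y *\<^sub>R (A S i (x, y) * exp (d i * of_real y)))"
  proof (rule integral_cong_AE)
    show "AE y in lborel. indicator {0..x} y *\<^sub>R (S i (x, y) * exp (d i * of_real y)) =
      \<gamma> (i+1) * (indicator {0..x} y *\<^sub>R (q i y * exp (d i * of_real y))) + indicator {0..x} y *\<^sub>R (A S i (x, y) * exp (d i * of_real y))"
      using M_finite_section[OF x, of i]
    proof eventually_elim
      case (elim y)
      then show ?case using S_eq[of i "(x, y)"] a[of y] by (auto simp: indicator_def algebra_simps)
    qed
  qed measurable
  also have "\<dots> = \<gamma> (i+1) * (LINT y|lborel. indicator {0..x} y *\<^sub>R (q i y * exp (d i * of_real y))) +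
      (LINT t|lborel. indicator {0..x} t *\<^sub>R (q i t * exp (d i * of_real t) * ?I t))"
    unfolding A_exp_integral(2)[of x d i, OF x d, symmetric]
    by (subst Bochner_Integration.integral_add)
      (intro integrable_mult_right q_exp_integrable A_exp_integral(1) x d refl,
        intro A_exp_integral(1) x d, simp only: integral_mult_right_zero)
  also have "\<dots> = (LINT t|lborel. \<gamma> (i+1) * (indicator {0..x} t *\<^sub>R (q i t * exp (d i * of_real t))) +
      indicator {0..x} t *\<^sub>R (q i t * exp (d i * of_real t) * ?I t))"
    by (subst Bochner_Integration.integral_add)
      (intro integrable_mult_right q_exp_integrable, intro A_exp_integral(3) x d, simp only: integral_mult_right_zero)
  also have "\<dots> = (LINT t|lborel. indicator {0..x} t *\<^sub>R (q i t * exp (d i * of_real t) * z \<gamma> d (i+1) t))"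
    by (intro Bochner_Integration.integral_cong refl) (simp add: z_def algebra_simps)
  finally show ?thesis by (simp add: z_def)
qed

lemma z_bounded: "\<exists>C. \<forall>i. \<forall>x\<in>{0..1}. norm (z \<gamma> d i x) \<le> C"
proof (intro exI allI ballI)
  fix i and x :: real assume "x \<in> {0..1}"
  then have x: "0 \<le> x" "x \<le> 1" by auto
  have "norm (z \<gamma> d i x) \<le> norm (\<gamma> i) + 2 * c0 * exp (wt * x) * exp (norm (d i) * x)"
    unfolding z_def using S_exp_integrable(2)[OF x(1), of i "d i"] by norm
  also have "\<dots> \<le> (\<Sum>i\<in>UNIV. norm (\<gamma> i)) + 2 * c0 * exp wt * exp (\<Sum>i\<in>UNIV. norm (d i))"
  proof (intro add_mono mult_mono)
    have "norm (d i) * x \<le> norm (d i)" using x by (simp add: mult_left_le)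
    also have "\<dots> \<le> (\<Sum>i\<in>UNIV. norm (d i))" by (intro member_le_sum) auto
    finally show "exp (norm (d i) * x) \<le> exp (\<Sum>i\<in>UNIV. norm (d i))" by simp
  qed (use c0_nonneg wt(1) x in \<open>auto intro!: member_le_sum mult_nonneg_nonneg mult_left_le\<close>)
  finally show "norm (z \<gamma> d i x) \<le> (\<Sum>i\<in>UNIV. norm (\<gamma> i)) + 2 * c0 * exp wt * exp (\<Sum>i\<in>UNIV. norm (d i))" .
qed

text \<open>Every substitution into the equation halves the bound C in the weight w. The Bielecki
  constant 1 / (2 * B) absorbs the bound B of the phases; the weight may depend on d because d is
  fixed here.\<close>

lemma homogeneous_solution_zero:
  fixes u :: "2 \<Rightarrow> real \<Rightarrow> complex"
  assumes C: "\<And>i x. x \<in> {0..1} \<Longrightarrow> norm (u i x) \<le> C"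
    and eq: "\<And>i x. x \<in> {0..1} \<Longrightarrow> u i x = (LINT t|lborel. indicator {0..x} t *\<^sub>R (q i t * exp (d i * of_real t) * u (i+1) t))"
    and x: "x \<in> {0..1}"
  shows "u i x = 0"
proof -
  define B where "B = exp (\<Sum>i\<in>UNIV. norm (d i :: complex))"
  have B: "B > 0" by (simp add: B_def)
  have eB: "norm (exp (d i * of_real t)) \<le> B" if "t \<in> {0..1}" for i t
  proof -
    have "norm (exp (d i * of_real t)) \<le> exp (norm (d i))" using exp_bound[of t 1 "d i"] that by simp
    also have "\<dots> \<le> B" unfolding B_def by (simp, intro member_le_sum) auto
    finally show ?thesis .
  qed
  have C0: "0 \<le> C" using C[OF x, of i] norm_ge_zero order.trans by blast
  have "(\<integral>\<^sup>+t. (\<Sum>i\<in>UNIV. ennreal (norm (q i t))) \<partial>lborel) < \<infinity>"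
    using integrable_q by (subst nn_integral_sum) (auto simp: integrable_iff_bounded)
  from Bielecki_weight[OF _ this, of "1 / (2 * B)"] B obtain w where w: "w > 0"
    "\<And>x. x \<ge> 0 \<Longrightarrow> (\<integral>\<^sup>+t\<in>{0..x}. (\<Sum>i\<in>UNIV. ennreal (norm (q i t))) * ennreal (exp (w * t)) \<partial>lborel) \<le> ennreal (1 / (2 * B) * exp (w * x))"
    by auto
  have bound: "norm (u i x) \<le> C * (1/2)^n * exp (w * x)" if "x \<in> {0..1}" for n i x
    using that
  proof (induction n arbitrary: i x)
    case 0
    then have "C * 1 \<le> C * exp (w * x)" using C0 w(1) by (intro mult_left_mono) auto
    then show ?case using C[OF 0, of i] by simp
  next
    case (Suc n)
    let ?Cn = "C * (1/2)^n"
    have "ennreal (norm (u i x)) \<le> (\<integral>\<^sup>+t. norm (indicator {0..x} t *\<^sub>R (q i t * exp (d i * of_real t) * u (i+1) t)) \<partial>lborel)"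
      unfolding eq[OF Suc.prems, of i] by (rule ennreal_norm_integral_le)
    also have "\<dots> \<le> (\<integral>\<^sup>+t. ennreal (B * ?Cn) * ((\<Sum>i\<in>UNIV. ennreal (norm (q i t))) * ennreal (exp (w * t)) * indicator {0..x} t) \<partial>lborel)"
    proof (intro nn_integral_mono)
      fix t :: real
      show "ennreal (norm (indicator {0..x} t *\<^sub>R (q i t * exp (d i * of_real t) * u (i+1) t))) \<le>
        ennreal (B * ?Cn) * ((\<Sum>i\<in>UNIV. ennreal (norm (q i t))) * ennreal (exp (w * t)) * indicator {0..x} t)"
      proof (cases "t \<in> {0..x}")
        case True
        then have t: "t \<in> {0..1}" using Suc.prems by auto
        have "norm (q i t * exp (d i * of_real t) * u (i+1) t) = norm (q i t) * (norm (exp (d i * of_real t)) * norm (u (i+1) t))"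
          by (simp only: norm_mult mult.assoc)
        also have "\<dots> \<le> (\<Sum>i\<in>UNIV. norm (q i t)) * (B * (?Cn * exp (w * t)))"
          using Suc.IH[OF t] eB[OF t] B by (intro mult_mono member_le_sum) (auto intro!: sum_nonneg)
        finally have "ennreal (norm (q i t * exp (d i * of_real t) * u (i+1) t)) \<le> ennreal ((B * ?Cn) * ((\<Sum>i\<in>UNIV. norm (q i t)) * exp (w * t)))"
          by (intro ennreal_leI) (simp add: mult_ac)
        also have "\<dots> = ennreal (B * ?Cn) * ((\<Sum>i\<in>UNIV. ennreal (norm (q i t))) * ennreal (exp (w * t)))"
          using B C0 by (simp add: ennreal_mult sum_nonneg)
        finally show ?thesis using True by simp
      qed simp
    qed
    also have "\<dots> = ennreal (B * ?Cn) * (\<integral>\<^sup>+t\<in>{0..x}. (\<Sum>i\<in>UNIV. ennreal (norm (q i t))) * ennreal (exp (w * t)) \<partial>lborel)"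
      by (rule nn_integral_cmult) measurable
    also have "\<dots> \<le> ennreal (B * ?Cn) * ennreal (1 / (2 * B) * exp (w * x))"
      using Suc.prems by (intro mult_left_mono w) auto
    also have "\<dots> = ennreal (C * (1/2)^Suc n * exp (w * x))"
      using B C0 by (simp add: ennreal_mult[symmetric])
    finally show ?case using C0 by (subst (asm) ennreal_le_iff) auto
  qed
  have "(\<lambda>n. C * (1/2)^n * exp (w * x)) \<longlonglongrightarrow> C * 0 * exp (w * x)"
    by (intro tendsto_intros LIMSEQ_realpow_zero) auto
  then have "norm (u i x) \<le> C * 0 * exp (w * x)"
    by (rule LIMSEQ_le_const) (use bound[OF x, of i] in blast)
  then show ?thesis by simp
qed

theorem z_unique:
  fixes u :: "2 \<Rightarrow> real \<Rightarrow> complex"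
  assumes C: "\<And>i x. x \<in> {0..1} \<Longrightarrow> norm (u i x) \<le> C"
    and eq: "\<And>i x. x \<in> {0..1} \<Longrightarrow> u i x = \<gamma> i + (LINT t|lborel. indicator {0..x} t *\<^sub>R (q i t * exp (d i * of_real t) * u (i+1) t))"
    and int: "\<And>i x. x \<in> {0..1} \<Longrightarrow> integrable lborel (\<lambda>t. indicator {0..x} t *\<^sub>R (q i t * exp (d i * of_real t) * u (i+1) t))"
    and d: "\<And>i. d (i+1) = - d i" and a: "\<And>i t. a i t = \<gamma> (i+1) * q i t"
    and x: "x \<in> {0..1}"
  shows "u i x = z \<gamma> d i x"
proof -
  obtain D where D: "\<And>i x. x \<in> {0..1} \<Longrightarrow> norm (z \<gamma> d i x) \<le> D" using z_bounded by metis
  have zint: "integrable lborel (\<lambda>t. indicator {0..x} t *\<^sub>R (q i t * exp (d i * of_real t) * z \<gamma> d (i+1) t))" if "x \<in> {0..1}" for i x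
  proof -
    have "integrable lborel (\<lambda>t. \<gamma> (i+1) * (indicator {0..x} t *\<^sub>R (q i t * exp (d i * of_real t))) +
      indicator {0..x} t *\<^sub>R (q i t * exp (d i * of_real t) * (LINT y|lborel. indicator {0..t} y *\<^sub>R (S (i+1) (t, y) * exp (d (i+1) * of_real y)))))"
      using that by (intro Bochner_Integration.integrable_add integrable_mult_right q_exp_integrable A_exp_integral(3) d) auto
    then show ?thesis by (simp add: z_def algebra_simps)
  qed
  have "u i x - z \<gamma> d i x = 0"
  proof (rule homogeneous_solution_zero[where u="\<lambda>i x. u i x - z \<gamma> d i x" and C="C + D" and d=d, OF _ _ x])
    fix i x assume x: "x \<in> {0..1::real}"
    show "norm (u i x - z \<gamma> d i x) \<le> C + D" using C[OF x, of i] D[OF x, of i] by norm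
    have "u i x - z \<gamma> d i x = (LINT t|lborel. indicator {0..x} t *\<^sub>R (q i t * exp (d i * of_real t) * u (i+1) t)) -
       (LINT t|lborel. indicator {0..x} t *\<^sub>R (q i t * exp (d i * of_real t) * z \<gamma> d (i+1) t))"
      using eq[OF x, of i] z_equation[of x d i \<gamma>, OF _ d a] x by simp
    also have "\<dots> = (LINT t|lborel. indicator {0..x} t *\<^sub>R (q i t * exp (d i * of_real t) * (u (i+1) t - z \<gamma> d (i+1) t)))"
      by (subst Bochner_Integration.integral_diff[OF int[OF x] zint[OF x], symmetric])
        (simp add: scaleR_diff_right right_diff_distrib)
    finally show "u i x - z \<gamma> d i x = (LINT t|lborel. indicator {0..x} t *\<^sub>R (q i t * exp (d i * of_real t) * (u (i+1) t - z \<gamma> d (i+1) t)))" .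
  qed
  then show ?thesis by simp
qed

end

section \<open>Reduction of the differential system\<close>

lemma abs_continuous_imp_continuous:
  assumes ac: "abs_continuous_on_interval l r f"
  shows "continuous_on {l..r} f"
proof (unfold continuous_on_iff, intro ballI allI impI)
  fix x and e :: real assume x: "x \<in> {l..r}" and e: "e > 0"
  from ac e obtain \<delta> where \<delta>: "\<delta> > 0" "\<forall>(n::nat) a b. (\<forall>i<n. l \<le> a i \<and> a i \<le> b i \<and> b i \<le> r) \<and>
        disjoint_family_on (\<lambda>i. {a i<..<b i}) {..<n} \<and>
        (\<Sum>i<n. b i - a i) < \<delta> \<longrightarrow> (\<Sum>i<n. norm (f (b i) - f (a i))) < e"
    unfolding abs_continuous_on_interval_def by blast
  have *: "norm (f v - f u) < e" if "l \<le> u" "u \<le> v" "v \<le> r" "v - u < \<delta>" for u v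
    using \<delta>(2)[rule_format, of "1" "\<lambda>_. u" "\<lambda>_. v"] that by (auto simp: disjoint_family_on_def)
  show "\<exists>d>0. \<forall>x'\<in>{l..r}. dist x' x < d \<longrightarrow> dist (f x') (f x) < e"
  proof (intro exI conjI ballI impI)
    fix x' assume "x' \<in> {l..r}" "dist x' x < \<delta>"
    then show "dist (f x') (f x) < e"
      using *[of x x'] *[of x' x] x by (cases "x \<le> x'") (auto simp: dist_norm norm_minus_commute)
  qed (rule \<delta>)
qed

lemma abs_continuous_subinterval:
  assumes "abs_continuous_on_interval l r f" "l \<le> l'" "r' \<le> r"
  shows "abs_continuous_on_interval l' r' f"
  unfolding abs_continuous_on_interval_def
proof (intro allI impI)
  fix e :: real assume "e > 0"
  with assms(1) obtain \<delta> where \<delta>: "\<delta> > 0" "\<forall>(n::nat) a b. (\<forall>i<n. l \<le> a i \<and> a i \<le> b i \<and> b i \<le> r) \<and>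
        disjoint_family_on (\<lambda>i. {a i<..<b i}) {..<n} \<and>
        (\<Sum>i<n. b i - a i) < \<delta> \<longrightarrow> (\<Sum>i<n. norm (f (b i) - f (a i))) < e"
    unfolding abs_continuous_on_interval_def by blast
  show "\<exists>\<delta>>0. \<forall>(n::nat) a b. (\<forall>i<n. l' \<le> a i \<and> a i \<le> b i \<and> b i \<le> r') \<and>
        disjoint_family_on (\<lambda>i. {a i<..<b i}) {..<n} \<and>
        (\<Sum>i<n. b i - a i) < \<delta> \<longrightarrow> (\<Sum>i<n. norm (f (b i) - f (a i))) < e"
  proof (intro exI conjI allI impI)
    fix n :: nat and a b
    assume h: "(\<forall>i<n. l' \<le> a i \<and> a i \<le> b i \<and> b i \<le> r') \<and> disjoint_family_on (\<lambda>i. {a i<..<b i}) {..<n} \<and> (\<Sum>i<n. b i - a i) < \<delta>"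
    have "\<forall>i<n. l \<le> a i \<and> a i \<le> b i \<and> b i \<le> r"
      using h assms(2,3) by (meson order.trans)
    then show "(\<Sum>i<n. norm (f (b i) - f (a i))) < e" using \<delta>(2) h by blast
  qed (rule \<delta>)
qed

text \<open>Meant for the exponential factor that removes the diagonal part of the system. The
  increment of h * f is split as h (b i) * (f (b i) - f (a i)) + (h (b i) - h (a i)) * f (a i), and
  the second part is controlled by the total length of the intervals.\<close>

lemma abs_continuous_mult_Lipschitz:
  fixes f h :: "real \<Rightarrow> complex"
  assumes ac: "abs_continuous_on_interval l r f"
    and L: "\<And>x y. x \<in> {l..r} \<Longrightarrow> y \<in> {l..r} \<Longrightarrow> norm (h x - h y) \<le> L * \<bar>x - y\<bar>"
    and H: "\<And>x. x \<in> {l..r} \<Longrightarrow> norm (h x) \<le> H"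
  shows "abs_continuous_on_interval l r (\<lambda>x. h x * f x)"
  unfolding abs_continuous_on_interval_def
proof (intro allI impI)
  fix e :: real assume e: "e > 0"
  have "bounded (f ` {l..r})"
    by (intro compact_imp_bounded compact_continuous_image abs_continuous_imp_continuous[OF ac]) auto
  then obtain F0 where F0: "\<And>x. x \<in> {l..r} \<Longrightarrow> norm (f x) \<le> F0" unfolding bounded_iff by blast
  define F where "F = max F0 0"
  have F: "\<And>x. x \<in> {l..r} \<Longrightarrow> norm (f x) \<le> F" "F \<ge> 0" using F0 unfolding F_def by (auto simp: le_max_iff_disj)
  define H' where "H' = max H 0"
  have H': "\<And>x. x \<in> {l..r} \<Longrightarrow> norm (h x) \<le> H'" "H' \<ge> 0" using H unfolding H'_def by (auto simp: le_max_iff_disj)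
  define e1 where "e1 = e / (2 * (H' + 1))"
  have e1: "e1 > 0" "H' * e1 \<le> e / 2"
  proof -
    have "e1 * (H' + 1) = e / 2" using H'(2) by (simp add: e1_def add_nonneg_pos field_simps)
    moreover show "e1 > 0" using e H'(2) by (simp add: e1_def)
    ultimately show "H' * e1 \<le> e / 2" by (simp add: algebra_simps)
  qed
  with ac obtain \<delta> where \<delta>: "\<delta> > 0" "\<forall>(n::nat) a b. (\<forall>i<n. l \<le> a i \<and> a i \<le> b i \<and> b i \<le> r) \<and>
        disjoint_family_on (\<lambda>i. {a i<..<b i}) {..<n} \<and>
        (\<Sum>i<n. b i - a i) < \<delta> \<longrightarrow> (\<Sum>i<n. norm (f (b i) - f (a i))) < e1"
    unfolding abs_continuous_on_interval_def by blast
  \<comment> \<open>The maximum with 0 covers a negative L, and the added 1 makes K a positive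
    divisor.\<close>
  define K where "K = F * max L 0 + 1"
  have K: "K > 0" "F * L \<le> K" using F(2) by (auto simp: K_def add_nonneg_pos intro: order.trans[OF mult_left_mono[of L "max L 0"]])
  show "\<exists>\<delta>>0. \<forall>(n::nat) a b. (\<forall>i<n. l \<le> a i \<and> a i \<le> b i \<and> b i \<le> r) \<and>
        disjoint_family_on (\<lambda>i. {a i<..<b i}) {..<n} \<and>
        (\<Sum>i<n. b i - a i) < \<delta> \<longrightarrow> (\<Sum>i<n. norm (h (b i) * f (b i) - h (a i) * f (a i))) < e"
  proof (intro exI[of _ "min \<delta> (e / (2 * K))"] conjI allI impI)
    show "0 < min \<delta> (e / (2 * K))" using \<delta> e K by simp
    fix n :: nat and a b
    assume h: "(\<forall>i<n. l \<le> a i \<and> a i \<le> b i \<and> b i \<le> r) \<and> disjoint_family_on (\<lambda>i. {a i<..<b i}) {..<n} \<and> (\<Sum>i<n. b i - a i) < min \<delta> (e / (2 * K))"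
    have ab: "a i \<in> {l..r}" "b i \<in> {l..r}" "a i \<le> b i" if "i < n" for i
      using h that by (auto intro: order.trans)
    have "(\<Sum>i<n. norm (h (b i) * f (b i) - h (a i) * f (a i))) \<le> (\<Sum>i<n. H' * norm (f (b i) - f (a i)) + K * (b i - a i))"
    proof (rule sum_mono)
      fix i assume "i \<in> {..<n}"
      then have i: "i < n" by simp
      have "h (b i) * f (b i) - h (a i) * f (a i) = h (b i) * (f (b i) - f (a i)) + (h (b i) - h (a i)) * f (a i)"
        by (simp add: algebra_simps)
      then have "norm (h (b i) * f (b i) - h (a i) * f (a i)) \<le> norm (h (b i)) * norm (f (b i) - f (a i)) + norm (h (b i) - h (a i)) * norm (f (a i))"
        by (metis norm_mult norm_triangle_ineq)
      also have "\<dots> \<le> H' * norm (f (b i) - f (a i)) + (L * (b i - a i)) * F"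
      proof (intro add_mono mult_mono)
        show "norm (h (b i) - h (a i)) \<le> L * (b i - a i)" using L[OF ab(2,1)[OF i]] ab(3)[OF i] by simp
        then show "0 \<le> L * (b i - a i)" using norm_ge_zero order.trans by blast
      qed (use H' F ab[OF i] in auto)
      also have "(L * (b i - a i)) * F \<le> K * (b i - a i)"
        using mult_right_mono[OF K(2), of "b i - a i"] ab(3)[OF i] by (simp add: mult_ac)
      finally show "norm (h (b i) * f (b i) - h (a i) * f (a i)) \<le> H' * norm (f (b i) - f (a i)) + K * (b i - a i)" by simp
    qed
    also have "\<dots> = H' * (\<Sum>i<n. norm (f (b i) - f (a i))) + K * (\<Sum>i<n. b i - a i)"
      by (simp add: sum.distrib sum_distrib_left)
    also have "\<dots> < e / 2 + e / 2"
    proof (rule add_le_less_mono)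
      have "(\<Sum>i<n. norm (f (b i) - f (a i))) \<le> e1" using \<delta>(2) h by (intro less_imp_le) auto
      then show "H' * (\<Sum>i<n. norm (f (b i) - f (a i))) \<le> e / 2"
        using e1(2) H'(2) by (meson mult_left_mono order.trans)
      show "K * (\<Sum>i<n. b i - a i) < e / 2" using h K by (simp add: field_simps)
    qed
    finally show "(\<Sum>i<n. norm (h (b i) * f (b i) - h (a i) * f (a i))) < e" by simp
  qed
qed

lemma abs_continuous_component:
  assumes ac: "abs_continuous_on_interval l r (y :: real \<Rightarrow> complex^2)"
  shows "abs_continuous_on_interval l r (\<lambda>x. y x $ i)"
  unfolding abs_continuous_on_interval_def
proof (intro allI impI)
  fix e :: real assume "e > 0"
  with ac obtain \<delta> where \<delta>: "\<delta> > 0" "\<forall>(n::nat) a b. (\<forall>i<n. l \<le> a i \<and> a i \<le> b i \<and> b i \<le> r) \<and>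
        disjoint_family_on (\<lambda>i. {a i<..<b i}) {..<n} \<and>
        (\<Sum>i<n. b i - a i) < \<delta> \<longrightarrow> (\<Sum>i<n. norm (y (b i) - y (a i))) < e"
    unfolding abs_continuous_on_interval_def by blast
  show "\<exists>\<delta>>0. \<forall>(n::nat) a b. (\<forall>i<n. l \<le> a i \<and> a i \<le> b i \<and> b i \<le> r) \<and>
        disjoint_family_on (\<lambda>i. {a i<..<b i}) {..<n} \<and>
        (\<Sum>i<n. b i - a i) < \<delta> \<longrightarrow> (\<Sum>j<n. norm (y (b j) $ i - y (a j) $ i)) < e"
  proof (intro exI conjI allI impI)
    fix n :: nat and a b
    assume h: "(\<forall>i<n. l \<le> a i \<and> a i \<le> b i \<and> b i \<le> r) \<and> disjoint_family_on (\<lambda>i. {a i<..<b i}) {..<n} \<and> (\<Sum>i<n. b i - a i) < \<delta>"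
    have "(\<Sum>j<n. norm (y (b j) $ i - y (a j) $ i)) \<le> (\<Sum>j<n. norm (y (b j) - y (a j)))"
      by (intro sum_mono) (simp add: Finite_Cartesian_Product.norm_nth_le flip: vector_minus_component)
    also have "\<dots> < e" using \<delta>(2) h by blast
    finally show "(\<Sum>j<n. norm (y (b j) $ i - y (a j) $ i)) < e" .
  qed (rule \<delta>)
qed

lemma exp_Lipschitz:
  fixes c :: complex
  assumes "x \<in> {0..1}" "y \<in> {0..1}"
  shows "norm (exp (c * of_real x) - exp (c * of_real y)) \<le> norm c * exp (norm c) * \<bar>x - y\<bar>"
proof -
  have "norm (exp (c * of_real x) - exp (c * of_real y)) \<le> norm c * exp (norm c) * norm (of_real x - of_real y :: complex)"
  proof (rule field_differentiable_bound[of "cball 0 1"])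
    fix z :: complex assume z: "z \<in> cball 0 1"
    show "((\<lambda>z. exp (c * z)) has_field_derivative exp (c * z) * c) (at z within cball 0 1)"
      by (auto intro!: derivative_eq_intros)
    have "norm (exp (c * z)) \<le> exp (norm (c * z))" by (rule norm_exp)
    also have "\<dots> \<le> exp (norm c)" using z by (simp add: norm_mult mult_left_le)
    finally show "norm (exp (c * z) * c) \<le> norm c * exp (norm c)" by (simp add: norm_mult mult.commute mult_left_mono)
  qed (use assms in auto)
  then show ?thesis by (simp add: of_real_diff[symmetric] del: of_real_diff)
qed

text \<open>Simplification rewrites \<open>2 + 1\<close> to the numeral 3, which in the index type
  \<open>2\<close> has to be recognised as 1.\<close>

lemma three_eq_one: "(3::2) = 1"
  by simp

definition pair_fun :: "'a \<Rightarrow> 'a \<Rightarrow> 2 \<Rightarrow> 'a" where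
  "pair_fun u v i = (if i = 1 then u else v)"

lemma pair_fun_simps [simp]: "pair_fun u v 1 = u" "pair_fun u v 2 = v" "pair_fun u v (1+1) = v" "pair_fun u v (2+1) = u"
  by (auto simp: pair_fun_def)

text \<open>\<open>matrix_inv\<close> is defined by a choice, so it is not computed: an explicit
  inverse shows that B is invertible, and then B times \<open>matrix_inv\<close> B being the
  identity gives the formula.\<close>

lemma B_mat_inv_eq:
  assumes "b1 \<noteq> 0" "b2 \<noteq> 0"
  shows "y $ i = of_real (pair_fun b1 b2 i) * (matrix_inv (B_mat b1 b2) *v y) $ i"
proof -
  let ?B = "B_mat b1 b2" and ?C = "vector [vector [of_real (1/b1), 0], vector [0, of_real (1/b2)]] :: complex^2^2"
  have "?B ** ?C = mat 1" "?C ** ?B = mat 1"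
    using assms by (auto simp: vec_eq_iff forall_2 B_mat_def matrix_matrix_mult_def sum_2 mat_def of_real_mult[symmetric] simp del: of_real_mult)
  then have "invertible ?B" unfolding invertible_def by blast
  then have "?B ** matrix_inv ?B = mat 1"
    unfolding invertible_def matrix_inv_def by (rule someI2_ex) simp
  then have "?B *v (matrix_inv ?B *v y) = y" by (simp add: matrix_vector_mul_assoc)
  then have "y $ i = (?B *v (matrix_inv ?B *v y)) $ i" by simp
  also have "\<dots> = of_real (pair_fun b1 b2 i) * (matrix_inv ?B *v y) $ i"
    using exhaust_2[of i] by (auto simp: B_mat_def matrix_vector_mult_def sum_2)
  finally show ?thesis .
qed

lemma solution_component_derivative:
  assumes b: "b1 \<noteq> 0" "b2 \<noteq> 0"
    and eq: "(- \<i>) *s (matrix_inv (B_mat b1 b2) *v y') + Q_mat Q12 Q21 x *v y = lam *s y"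
  shows "y' $ i = \<i> * of_real (pair_fun b1 b2 i) * (lam * y $ i - pair_fun Q12 Q21 i x * y $ (i+1))"
proof -
  let ?w = "matrix_inv (B_mat b1 b2) *v y'"
  have "- \<i> * ?w $ i + (Q_mat Q12 Q21 x *v y) $ i = lam * y $ i"
    using arg_cong[OF eq, of "\<lambda>v. v $ i"] by simp
  moreover have "(Q_mat Q12 Q21 x *v y) $ i = pair_fun Q12 Q21 i x * y $ (i+1)"
    using exhaust_2[of i] by (elim disjE) (simp_all add: three_eq_one Q_mat_def matrix_vector_mult_def sum_2)
  ultimately have "\<i> * ?w $ i = pair_fun Q12 Q21 i x * y $ (i+1) - lam * y $ i" by (simp add: algebra_simps)
  then have "\<i> * (\<i> * ?w $ i) = \<i> * (pair_fun Q12 Q21 i x * y $ (i+1) - lam * y $ i)" by simp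
  then have "?w $ i = \<i> * (lam * y $ i - pair_fun Q12 Q21 i x * y $ (i+1))" by (simp add: algebra_simps)
  then show ?thesis using B_mat_inv_eq[OF b, of y' i] by simp
qed

text \<open>Dividing out exp(\<i> * lam * b i * x) removes the diagonal term, leaving u i' = q i *
  exp(d i * t) * u (i + 1) almost everywhere. Absolute continuity turns this into an integral
  equation of the form satisfied by \<open>z\<close>.\<close>

theorem solution_integral_equation:
  fixes q :: "2 \<Rightarrow> real \<Rightarrow> complex" and b1 b2 :: real
  defines "b \<equiv> \<lambda>i. complex_of_real (pair_fun b1 b2 i)"
  assumes b: "b1 \<noteq> 0" "b2 \<noteq> 0"
    and q: "\<And>i. integrable lborel (q i)"
    and qQ: "\<And>i. AE t in lebesgue_on {0..1}. q i t = - \<i> * b i * pair_fun Q12 Q21 i t"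
    and sol: "is_solution b1 b2 Q12 Q21 lam e"
  defines "u \<equiv> \<lambda>i x. exp (- \<i> * lam * b i * of_real x) * e x $ i"
    and "d \<equiv> \<lambda>i. \<i> * lam * (b (i+1) - b i)"
  assumes x: "x \<in> {0..1}"
  shows "integrable lborel (\<lambda>t. indicator {0..x} t *\<^sub>R (q i t * exp (d i * of_real t) * u (i+1) t))"
    and "u i x = u i 0 + (LINT t|lborel. indicator {0..x} t *\<^sub>R (q i t * exp (d i * of_real t) * u (i+1) t))"
    and "continuous_on {0..1} (u i)"
proof -
  have ac: "abs_continuous_on_interval 0 1 e" and
    ode: "AE x in lebesgue_on {0..1}. \<exists>y'.
        (e has_vector_derivative y') (at x within {0..1}) \<and>
        (- \<i>) *s (matrix_inv (B_mat b1 b2) *v y') + Q_mat Q12 Q21 x *v e x = lam *s e x"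
    using sol unfolding is_solution_def by auto
  have acu: "abs_continuous_on_interval 0 1 (u i)" for i
    unfolding u_def
  proof (rule abs_continuous_mult_Lipschitz[OF abs_continuous_component[OF ac]])
    fix x y :: real assume xy: "x \<in> {0..1}" "y \<in> {0..1}"
    show "norm (exp (- \<i> * lam * b i * of_real x) - exp (- \<i> * lam * b i * of_real y)) \<le> norm (- \<i> * lam * b i) * exp (norm (- \<i> * lam * b i)) * \<bar>x - y\<bar>"
      by (rule exp_Lipschitz[OF xy])
  next
    fix x :: real assume x: "x \<in> {0..1}"
    show "norm (exp (- \<i> * lam * b i * of_real x)) \<le> exp (norm (- \<i> * lam * b i))"
      using x by (intro order.trans[OF norm_exp]) (simp add: norm_mult mult_left_le)
  qed
  have cont: "continuous_on {0..1} (u i)" for i by (rule abs_continuous_imp_continuous[OF acu])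
  then show "continuous_on {0..1} (u i)" .
  let ?g = "\<lambda>t. q i t * exp (d i * of_real t) * u (i+1) t"
  have [measurable]: "q i \<in> borel_measurable borel" using q[of i] by auto
  \<comment> \<open>u is known to be continuous only on the unit interval. Cutting off there gives a
    bounded Borel function on the line, and its product with \<open>q i\<close> is
    integrable.\<close>
  define h where "h t = indicator {0..1} t *\<^sub>R (exp (d i * of_real t) * u (i+1) t)" for t
  have hm[measurable]: "h \<in> borel_measurable borel"
    unfolding h_def by (intro borel_measurable_continuous_on_indicator continuous_intros cont) auto
  have "bounded ((\<lambda>t. exp (d i * of_real t) * u (i+1) t) ` {0..1})"
    by (intro compact_imp_bounded compact_continuous_image continuous_intros cont) auto
  then obtain H0 where H0: "\<And>t. t \<in> {0..1} \<Longrightarrow> norm (exp (d i * of_real t) * u (i+1) t) \<le> H0"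
    unfolding bounded_iff by blast
  have H: "norm (h t) \<le> max H0 0" for t
    using H0[of t] by (auto simp: h_def indicator_def le_max_iff_disj)
  have eqh: "indicator {0..x} t *\<^sub>R ?g t = indicator {0..x} t *\<^sub>R (q i t * h t)" for t
    using x by (auto simp: h_def indicator_def)
  show int: "integrable lborel (\<lambda>t. indicator {0..x} t *\<^sub>R ?g t)"
    unfolding eqh
  proof (rule Bochner_Integration.integrable_bound)
    show "integrable lborel (\<lambda>t. max H0 0 * norm (q i t))" using q[of i] by auto
    show "AE t in lborel. norm (indicator {0..x} t *\<^sub>R (q i t * h t)) \<le> norm (max H0 0 * norm (q i t))"
    proof (intro AE_I2)
      fix t
      show "norm (indicator {0..x} t *\<^sub>R (q i t * h t)) \<le> norm (max H0 0 * norm (q i t))"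
        using mult_left_mono[OF H[of t], of "norm (q i t)"] by (cases "t \<in> {0..x}") (simp_all add: norm_mult mult.commute)
    qed
  qed measurable
  have deriv: "AE t in lebesgue_on {0..x}. (u i has_vector_derivative ?g t) (at t within {0..x})"
  proof -
    have "AE t in lebesgue_on {0..1}. (u i has_vector_derivative ?g t) (at t within {0..1})"
      using ode qQ[of i]
    proof eventually_elim
      case (elim t)
      then obtain y' where y': "(e has_vector_derivative y') (at t within {0..1})"
        "(- \<i>) *s (matrix_inv (B_mat b1 b2) *v y') + Q_mat Q12 Q21 t *v e t = lam *s e t" by blast
      let ?c = "- \<i> * lam * b i"
      have e: "((\<lambda>t. e t $ i) has_vector_derivative y' $ i) (at t within {0..1})"
        using y'(1) by (rule bounded_linear.has_vector_derivative[OF bounded_linear_vec_nth])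
      have "((\<lambda>t. exp (?c * of_real t)) has_vector_derivative (?c * exp (?c * of_real t))) (at t within {0..1})"
      proof -
        have "((\<lambda>z. exp (?c * z)) has_field_derivative (?c * exp (?c * of_real t))) (at (of_real t))"
          by (auto intro!: derivative_eq_intros)
        then show ?thesis
          by (rule has_vector_derivative_real_field[THEN has_vector_derivative_at_within])
      qed
      from has_vector_derivative_mult[OF this e]
      have "(u i has_vector_derivative (exp (?c * of_real t) * y' $ i + ?c * exp (?c * of_real t) * e t $ i)) (at t within {0..1})"
        unfolding u_def .
      moreover have "exp (?c * of_real t) * y' $ i + ?c * exp (?c * of_real t) * e t $ i = ?g t"
      proof -
        have "exp (?c * of_real t) * y' $ i + ?c * exp (?c * of_real t) * e t $ i
           = exp (?c * of_real t) * (y' $ i - \<i> * lam * b i * e t $ i)" by (simp add: algebra_simps)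
        also have "y' $ i - \<i> * lam * b i * e t $ i = q i t * e t $ (i+1)"
          unfolding solution_component_derivative[OF b y'(2), of i] using elim(2) by (simp add: b_def algebra_simps)
        also have "exp (?c * of_real t) * (q i t * e t $ (i+1)) = ?g t"
        proof -
          have "exp (?c * of_real t) = exp (d i * of_real t) * exp (- \<i> * lam * b (i+1) * of_real t)"
            unfolding d_def exp_add[symmetric] by (simp add: algebra_simps)
          then show ?thesis by (simp only: u_def mult_ac)
        qed
        finally show ?thesis .
      qed
      ultimately show ?case by simp
    qed
    then have "AE t in lebesgue. t \<in> {0..1} \<longrightarrow> (u i has_vector_derivative ?g t) (at t within {0..1})"
      by (simp add: AE_restrict_space_iff)
    then have "AE t in lebesgue. t \<in> {0..x} \<longrightarrow> (u i has_vector_derivative ?g t) (at t within {0..x})"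
      by eventually_elim (use x in \<open>auto intro: has_vector_derivative_within_subset\<close>)
    then show ?thesis by (simp add: AE_restrict_space_iff)
  qed
  have "(?g has_integral (u i x - u i 0)) {0..x}"
    using x by (intro abs_continuous_has_integral[OF abs_continuous_subinterval[OF acu] _ deriv]) auto
  then have "integral {0..x} ?g = u i x - u i 0" by (rule integral_unique)
  \<comment> \<open>The preceding integral is a gauge integral; integrability in the sense of
    Lebesgue identifies the two values.\<close>
  moreover have "(LINT t:{0..x}|lborel. ?g t) = integral {0..x} ?g"
    by (rule set_borel_integral_eq_integral(2)) (use int in \<open>simp add: set_integrable_def\<close>)
  ultimately show "u i x = u i 0 + (LINT t|lborel. indicator {0..x} t *\<^sub>R ?g t)"
    by (simp add: set_lebesgue_integral_def)
qed

text \<open>The coefficients are Lebesgue measurable, whereas Tonelli's theorem for two copies of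
  \<open>lborel\<close> asks for Borel functions. The system holds almost everywhere, so a change on
  a null set is harmless.\<close>

lemma borel_representative:
  fixes Q :: "real \<Rightarrow> complex"
  assumes "set_integrable lebesgue {0..1} Q"
  obtains q where "integrable lborel q" "AE t in lebesgue_on {0..1}. q t = Q t"
proof -
  let ?f = "\<lambda>x. indicator {0..1} x *\<^sub>R Q x"
  have int: "integrable lebesgue ?f" using assms by (simp add: set_integrable_def)
  then have [measurable]: "?f \<in> borel_measurable lebesgue" by auto
  have "(\<lambda>x. Re (?f x)) \<in> borel_measurable lebesgue"
    by measurable
  from completion_ex_borel_measurable_real[OF this]
  obtain r where r: "r \<in> borel_measurable lborel" "AE x in lborel. Re (?f x) = r x" by blast
  have "(\<lambda>x. Im (?f x)) \<in> borel_measurable lebesgue"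
    by measurable
  from completion_ex_borel_measurable_real[OF this]
  obtain j where j: "j \<in> borel_measurable lborel" "AE x in lborel. Im (?f x) = j x" by blast
  define q where "q x = Complex (r x) (j x)" for x
  have qm[measurable]: "q \<in> borel_measurable lborel"
    using r(1) j(1) unfolding q_def by (simp add: borel_measurable_complex_iff)
  have "AE x in lborel. q x = ?f x" using r(2) j(2)
    by eventually_elim (simp add: q_def complex_eq_iff)
  then have ae: "AE x in lebesgue. q x = ?f x" by (rule AE_completion)
  have "integrable lebesgue q \<longleftrightarrow> integrable lebesgue ?f"
    by (rule integrable_cong_AE) (use ae in \<open>auto intro: measurable_completion\<close>)
  then have "integrable lborel q" using int qm by (simp add: integrable_completion)
  moreover have "AE t in lebesgue_on {0..1}. q t = Q t"
    using ae by (subst AE_restrict_space_iff) (auto elim!: eventually_mono)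
  ultimately show ?thesis by (rule that)
qed

section \<open>Approximable kernels\<close>

text \<open>A function continuous on the triangle only is extended by composing it with this retraction.\<close>
definition Omega_retract :: "real \<times> real \<Rightarrow> real \<times> real" where
  "Omega_retract z = (let x = max 0 (min 1 (fst z)) in (x, max 0 (min x (snd z))))"

lemma Omega_retract: "Omega_retract z \<in> Omega" "z \<in> Omega \<Longrightarrow> Omega_retract z = z"
  by (auto simp: Omega_retract_def Omega_def Let_def max_def min_def prod_eq_iff)

lemma continuous_Omega_retract: "continuous_on UNIV Omega_retract"
  unfolding Omega_retract_def Let_def by (intro continuous_intros)

lemma compact_Omega: "compact Omega"
proof -
  have "Omega = Omega_retract ` ({0..1} \<times> {0..1})"
  proof (intro equalityI subsetI)
    fix z assume z: "z \<in> Omega"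
    then have "z \<in> {0..1} \<times> {0..1}" by (auto simp: Omega_def)
    then show "z \<in> Omega_retract ` ({0..1} \<times> {0..1})" using Omega_retract(2)[OF z] by (metis imageI)
  qed (use Omega_retract(1) in auto)
  moreover have "compact (Omega_retract ` ({0..1} \<times> {0..1}))"
    by (intro compact_continuous_image continuous_on_subset[OF continuous_Omega_retract] compact_Times) auto
  ultimately show ?thesis by (rule ssubst)
qed

lemma extend_from_Omega:
  fixes g :: "real \<times> real \<Rightarrow> 'a::real_normed_vector"
  assumes "continuous_on Omega g"
  obtains g' where "continuous_on UNIV g'" "bounded (range g')" "\<And>z. z \<in> Omega \<Longrightarrow> g' z = g z"
proof
  show "continuous_on UNIV (\<lambda>z. g (Omega_retract z))"
    by (rule continuous_on_compose2[OF assms continuous_Omega_retract]) (use Omega_retract in auto)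
  have "bounded (g ` Omega)"
    by (intro compact_imp_bounded compact_continuous_image assms compact_Omega)
  then show "bounded (range (\<lambda>z. g (Omega_retract z)))"
    by (rule bounded_subset) (use Omega_retract in auto)
  show "z \<in> Omega \<Longrightarrow> g (Omega_retract z) = g z" for z using Omega_retract by simp
qed

text \<open>Both bounds are required on every section, not on almost every one. This is stronger
  than closeness in the two norms and makes k (a, _) itself the trace at a.\<close>

definition kernel_close :: "real \<Rightarrow> (real \<times> real \<Rightarrow> 'a::real_normed_vector) \<Rightarrow> (real \<times> real \<Rightarrow> 'a) \<Rightarrow> bool" where
  "kernel_close e k g \<longleftrightarrow>
    (\<forall>x\<in>{0..1}. (\<integral>\<^sup>+t\<in>{0..x}. ennreal (norm (k (x, t) - g (x, t))) \<partial>lborel) \<le> ennreal e) \<and>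
    (\<forall>t\<in>{0..1}. (\<integral>\<^sup>+x\<in>{t..1}. ennreal (norm (k (x, t) - g (x, t))) \<partial>lborel) \<le> ennreal e)"

definition approximable_kernel :: "(real \<times> real \<Rightarrow> 'a::real_normed_vector) \<Rightarrow> bool" where
  "approximable_kernel k \<longleftrightarrow> k \<in> borel_measurable (borel \<Otimes>\<^sub>M borel) \<and>
    (\<forall>e>0. \<exists>g. continuous_on UNIV g \<and> bounded (range g) \<and> kernel_close e k g)"

lemma approximable_kernelD:
  assumes "approximable_kernel k"
  shows "k \<in> borel_measurable (borel \<Otimes>\<^sub>M borel)"
    "e > 0 \<Longrightarrow> \<exists>g. continuous_on UNIV g \<and> bounded (range g) \<and> kernel_close e k g"
  using assms unfolding approximable_kernel_def by auto

lemma continuous_pair_measurable: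
  fixes g :: "real \<times> real \<Rightarrow> 'a::real_normed_vector"
  shows "continuous_on UNIV g \<Longrightarrow> g \<in> borel_measurable (borel \<Otimes>\<^sub>M borel)"
  unfolding borel_prod by (rule borel_measurable_continuous_onI)

lemma section_measurable:
  assumes [measurable]: "(f :: real \<times> real \<Rightarrow> ennreal) \<in> borel_measurable (borel \<Otimes>\<^sub>M borel)"
  shows "(\<lambda>x. \<integral>\<^sup>+t\<in>{0..x}. f (x, t) \<partial>lborel) \<in> borel_measurable borel"
    "(\<lambda>t. \<integral>\<^sup>+x\<in>{t..1}. f (x, t) \<partial>lborel) \<in> borel_measurable borel"
  unfolding indicator_def atLeastAtMost_iff by measurable

lemma borel_imp_lebesgue_on: "f \<in> borel_measurable borel \<Longrightarrow> f \<in> borel_measurable (lebesgue_on S)"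
  by (intro measurable_restrict_space1 measurable_completion) simp

lemma Xinf_norm_le:
  assumes [measurable]: "f \<in> borel_measurable (borel \<Otimes>\<^sub>M borel)"
    and le: "\<And>x. x \<in> {0..1} \<Longrightarrow> (\<integral>\<^sup>+t\<in>{0..x}. ennreal (norm (f (x, t))) \<partial>lborel) \<le> c"
  shows "Xinf_norm f \<le> c"
  unfolding Xinf_norm_def nn_integral_completion
  by (intro esssup_I borel_imp_lebesgue_on section_measurable) (use le in \<open>auto intro!: AE_I2\<close>)

lemma X1_norm_le:
  assumes [measurable]: "f \<in> borel_measurable (borel \<Otimes>\<^sub>M borel)"
    and le: "\<And>t. t \<in> {0..1} \<Longrightarrow> (\<integral>\<^sup>+x\<in>{t..1}. ennreal (norm (f (x, t))) \<partial>lborel) \<le> c"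
  shows "X1_norm f \<le> c"
  unfolding X1_norm_def nn_integral_completion
  by (intro esssup_I borel_imp_lebesgue_on section_measurable(2)[of "\<lambda>z. ennreal (norm (f z))"]) (use le in \<open>auto intro!: AE_I2\<close>)

lemma approximable_kernel_bounds:
  fixes k :: "real \<times> real \<Rightarrow> 'a::{real_normed_vector, second_countable_topology}"
  assumes "approximable_kernel k"
  obtains C where "C \<ge> 0" "\<forall>x\<in>{0..1}. (\<integral>\<^sup>+t\<in>{0..x}. ennreal (norm (k (x, t))) \<partial>lborel) \<le> ennreal C"
    "\<forall>t\<in>{0..1}. (\<integral>\<^sup>+x\<in>{t..1}. ennreal (norm (k (x, t))) \<partial>lborel) \<le> ennreal C"
proof -
  note [measurable] = approximable_kernelD(1)[OF assms]
  obtain g where g: "continuous_on UNIV g" "bounded (range g)" "kernel_close 1 k g"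
    using approximable_kernelD(2)[OF assms, of 1] by auto
  note [measurable] = continuous_pair_measurable[OF g(1)]
  obtain B where B: "\<And>z. norm (g z) \<le> B" using g(2) unfolding bounded_iff by blast
  have B0: "B \<ge> 0" using order.trans[OF norm_ge_zero B] .
  have pt: "ennreal (norm (k z)) * i \<le> ennreal (norm (k z - g z)) * i + ennreal B * i" for z and i :: ennreal
  proof -
    have "norm (k z) \<le> norm (k z - g z) + B" using B[of z] norm_triangle_sub[of "k z" "g z"] by linarith
    then have "ennreal (norm (k z)) \<le> ennreal (norm (k z - g z)) + ennreal B"
      using B0 by (simp add: ennreal_plus[symmetric] ennreal_leI del: ennreal_plus)
    from mult_right_mono[OF this zero_le[of i]] show ?thesis by (simp add: distrib_right)
  qed
  show ?thesis
  proof (rule that[of "1 + B"]; (intro ballI)?)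
    fix x :: real assume x: "x \<in> {0..1}"
    have "(\<integral>\<^sup>+t\<in>{0..x}. ennreal (norm (k (x, t))) \<partial>lborel) \<le> (\<integral>\<^sup>+t. ennreal (norm (k (x, t) - g (x, t))) * indicator {0..x} t + ennreal B * indicator {0..x} t \<partial>lborel)"
      by (intro nn_integral_mono pt)
    also have "\<dots> = (\<integral>\<^sup>+t\<in>{0..x}. ennreal (norm (k (x, t) - g (x, t))) \<partial>lborel) + (\<integral>\<^sup>+t\<in>{0..x}. ennreal B \<partial>lborel)"
      by (rule nn_integral_add) measurable
    also have "\<dots> \<le> ennreal 1 + ennreal B"
    proof (rule add_mono)
      show "(\<integral>\<^sup>+t\<in>{0..x}. ennreal (norm (k (x, t) - g (x, t))) \<partial>lborel) \<le> ennreal 1" using g(3) x unfolding kernel_close_def by blast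
      show "(\<integral>\<^sup>+t\<in>{0..x}. ennreal B \<partial>lborel) \<le> ennreal B"
        using x B0 by (subst nn_integral_cmult_indicator) (auto simp: ennreal_mult[symmetric] mult_left_le intro!: ennreal_leI)
    qed
    finally show "(\<integral>\<^sup>+t\<in>{0..x}. ennreal (norm (k (x, t))) \<partial>lborel) \<le> ennreal (1 + B)" using B0 by (simp add: ennreal_plus)
  next
    fix t :: real assume t: "t \<in> {0..1}"
    have "(\<integral>\<^sup>+x\<in>{t..1}. ennreal (norm (k (x, t))) \<partial>lborel) \<le> (\<integral>\<^sup>+x. ennreal (norm (k (x, t) - g (x, t))) * indicator {t..1} x + ennreal B * indicator {t..1} x \<partial>lborel)"
      by (intro nn_integral_mono pt)
    also have "\<dots> = (\<integral>\<^sup>+x\<in>{t..1}. ennreal (norm (k (x, t) - g (x, t))) \<partial>lborel) + (\<integral>\<^sup>+x\<in>{t..1}. ennreal B \<partial>lborel)"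
      by (rule nn_integral_add) measurable
    also have "\<dots> \<le> ennreal 1 + ennreal B"
    proof (rule add_mono)
      show "(\<integral>\<^sup>+x\<in>{t..1}. ennreal (norm (k (x, t) - g (x, t))) \<partial>lborel) \<le> ennreal 1" using g(3) t unfolding kernel_close_def by blast
      show "(\<integral>\<^sup>+x\<in>{t..1}. ennreal B \<partial>lborel) \<le> ennreal B"
        using t B0 by (subst nn_integral_cmult_indicator) (auto simp: ennreal_mult[symmetric] mult_left_le intro!: ennreal_leI)
    qed
    finally show "(\<integral>\<^sup>+x\<in>{t..1}. ennreal (norm (k (x, t))) \<partial>lborel) \<le> ennreal (1 + B)" using B0 by (simp add: ennreal_plus)
  qed (use B0 in simp)
qed

lemma approximable_kernel_spaces:
  fixes k :: "real \<times> real \<Rightarrow> complex"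
  assumes k: "approximable_kernel k"
  shows "k \<in> X1_0_space" "k \<in> Xinf_0_space"
proof -
  note km[measurable] = approximable_kernelD(1)[OF k]
  have m: "k \<in> borel_measurable (lebesgue_on Omega)"
    using km unfolding borel_prod by (rule borel_imp_lebesgue_on)
  obtain C where "C \<ge> 0" and C: "\<forall>x\<in>{0..1}. (\<integral>\<^sup>+t\<in>{0..x}. ennreal (norm (k (x, t))) \<partial>lborel) \<le> ennreal C"
    "\<forall>t\<in>{0..1}. (\<integral>\<^sup>+x\<in>{t..1}. ennreal (norm (k (x, t))) \<partial>lborel) \<le> ennreal C"
    using approximable_kernel_bounds[OF k] .
  have fin: "X1_norm k < \<infinity>" "Xinf_norm k < \<infinity>"
    using X1_norm_le[OF km bspec[OF C(2)]] Xinf_norm_le[OF km bspec[OF C(1)]] by (auto intro: le_less_trans)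
  have "\<exists>g. continuous_on Omega g \<and> X1_norm (\<lambda>z. k z - g z) < ennreal e \<and> Xinf_norm (\<lambda>z. k z - g z) < ennreal e" if e: "e > 0" for e
  proof -
    obtain g where g: "continuous_on UNIV g" "bounded (range g)" "kernel_close (e/2) k g"
      using approximable_kernelD(2)[OF k, of "e/2"] e by auto
    note [measurable] = continuous_pair_measurable[OF g(1)]
    have lt: "ennreal (e/2) < ennreal e" using e by (intro ennreal_lessI) auto
    have "X1_norm (\<lambda>z. k z - g z) \<le> ennreal (e/2)"
      by (rule X1_norm_le) (use g(3) in \<open>measurable, auto simp: kernel_close_def\<close>)
    moreover have "Xinf_norm (\<lambda>z. k z - g z) \<le> ennreal (e/2)"
      by (rule Xinf_norm_le) (use g(3) in \<open>measurable, auto simp: kernel_close_def\<close>)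
    ultimately show ?thesis using g(1) lt
      by (intro exI[of _ g] conjI) (auto intro: continuous_on_subset le_less_trans)
  qed
  then show "k \<in> X1_0_space" "k \<in> Xinf_0_space"
    using m fin unfolding X1_0_space_def Xinf_0_space_def X1_space_def Xinf_space_def by blast+
qed

section \<open>Traces at a fixed value of the first variable\<close>

lemma AE_dense_sequence:
  fixes a :: real
  assumes ae: "AE x in lebesgue_on {0..1}. P x" and a: "a \<in> {0..1}"
  obtains x where "\<And>n::nat. x n \<in> {0..1} \<and> P (x n)" "x \<longlonglongrightarrow> a"
proof -
  obtain N where N: "N \<in> null_sets lebesgue" "\<And>x. x \<in> {0..1} \<Longrightarrow> x \<notin> N \<Longrightarrow> P x"
  proof -
    have "AE x in lebesgue. x \<in> {0..1} \<longrightarrow> P x" using ae by (simp add: AE_restrict_space_iff)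
    then show ?thesis using that by (auto elim!: AE_E3)
  qed
  have "\<exists>x. x \<in> {0..1} \<and> P x \<and> dist x a \<le> 1 / real (Suc n)" for n
  proof -
    define l r where "l = max 0 (a - 1 / real (Suc n))" and "r = min 1 (a + 1 / real (Suc n))"
    have "0 < 1 / real (Suc n)" by simp
    moreover have "0 \<le> a" "a \<le> 1" using a by auto
    ultimately have "a - 1 / real (Suc n) < 1 \<and> 0 < a + 1 / real (Suc n)" by linarith
    then have lr: "l < r" using a unfolding l_def r_def by (simp add: less_max_iff_disj del: of_nat_Suc)
    \<comment> \<open>A nondegenerate interval has positive measure and so contains a point off N;
      intersecting with {0..1} keeps it nondegenerate even if a is an end point.\<close>
    have "\<not> {l..r} \<subseteq> N"
    proof
      assume "{l..r} \<subseteq> N"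
      then have "{l..r} \<in> null_sets lebesgue" using N(1) by (rule null_sets_subset[rotated 2]) auto
      then show False using lr by (simp add: null_sets_def)
    qed
    then obtain x where x: "x \<in> {l..r}" "x \<notin> N" by blast
    then have "x \<in> {0..1}" "dist x a \<le> 1 / real (Suc n)" by (auto simp: l_def r_def dist_real_def)
    then show ?thesis using N(2) x by blast
  qed
  then obtain x where x: "\<And>n. x n \<in> {0..1} \<and> P (x n) \<and> dist (x n) a \<le> 1 / real (Suc n)" by metis
  have "(\<lambda>n. dist (x n) a) \<longlonglongrightarrow> 0"
    by (rule tendsto_sandwich[OF _ _ tendsto_const LIMSEQ_inverse_real_of_nat])
      (use x in \<open>auto simp: inverse_eq_divide\<close>)
  then have "x \<longlonglongrightarrow> a" by (rule tendsto_dist_iff[THEN iffD2])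
  then show ?thesis using that x by blast
qed

text \<open>Closeness in \<open>Xinf_norm\<close> controls the sections of g n at almost every x,
  which may miss a. Hence g n is compared with a continuous approximant G of k: the two are close at
  almost every x, thus at a by Fatou's lemma along points tending to a, and G is close to k at a
  itself.\<close>

lemma approximable_kernel_trace:
  fixes k :: "real \<times> real \<Rightarrow> complex"
  assumes k: "approximable_kernel k" and a: "a \<in> {0..1}"
  shows "is_trace k a (\<lambda>t. k (a, t))"
  unfolding is_trace_def
proof (intro conjI allI impI)
  note km[measurable] = approximable_kernelD(1)[OF k]
  show "k \<in> Xinf_0_space" by (rule approximable_kernel_spaces[OF k])
  obtain C where "C \<ge> 0" and C: "\<forall>x\<in>{0..1}. (\<integral>\<^sup>+t\<in>{0..x}. ennreal (norm (k (x, t))) \<partial>lborel) \<le> ennreal C"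
    "\<forall>t\<in>{0..1}. (\<integral>\<^sup>+x\<in>{t..1}. ennreal (norm (k (x, t))) \<partial>lborel) \<le> ennreal C"
    using approximable_kernel_bounds[OF k] .
  have "integrable lborel (\<lambda>t. indicator {0..a} t *\<^sub>R k (a, t))"
  proof (rule integrableI_bounded)
    have "(\<integral>\<^sup>+t. ennreal (norm (indicator {0..a} t *\<^sub>R k (a, t))) \<partial>lborel) = (\<integral>\<^sup>+t\<in>{0..a}. ennreal (norm (k (a, t))) \<partial>lborel)"
      by (intro nn_integral_cong) (auto simp: indicator_def)
    then show "(\<integral>\<^sup>+t. ennreal (norm (indicator {0..a} t *\<^sub>R k (a, t))) \<partial>lborel) < \<infinity>"
      using bspec[OF C(1) a] by (auto intro: le_less_trans)
  qed measurable
  then show "set_integrable lebesgue {0..a} (\<lambda>t. k (a, t))"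
    unfolding set_integrable_def by (subst integrable_completion) auto
  fix g :: "nat \<Rightarrow> real \<times> real \<Rightarrow> complex"
  assume g: "(\<forall>n. continuous_on Omega (g n)) \<and> (\<lambda>n. Xinf_norm (\<lambda>z. k z - g n z)) \<longlonglongrightarrow> 0"
  show "(\<lambda>n. \<integral>\<^sup>+t\<in>{0..a}. ennreal (norm (g n (a, t) - k (a, t))) \<partial>lebesgue) \<longlonglongrightarrow> 0"
  proof (rule order_tendstoI)
    fix y :: ennreal assume y: "0 < y"
    \<comment> \<open>The error at a will be 2 * e between g n and G, and e between G and k.\<close>
    obtain e where e: "e > 0" "ennreal (3 * e) < y"
    proof -
      obtain y' where "0 < y'" "y' < y" using dense[OF y] by blast
      then obtain r where "y' = ennreal r" "r > 0" by (cases y') auto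
      then show ?thesis using that[of "r/3"] \<open>y' < y\<close> by auto
    qed
    obtain G where G: "continuous_on UNIV G" "bounded (range G)" "kernel_close e k G"
      using approximable_kernelD(2)[OF k e(1)] by auto
    note [measurable] = continuous_pair_measurable[OF G(1)]
    from order_tendstoD(2)[OF conjunct2[OF g], of "ennreal e"] e(1)
    have "\<forall>\<^sub>F n in sequentially. Xinf_norm (\<lambda>z. k z - g n z) < ennreal e" by simp
    then show "\<forall>\<^sub>F n in sequentially. (\<integral>\<^sup>+t\<in>{0..a}. ennreal (norm (g n (a, t) - k (a, t))) \<partial>lebesgue) < y"
    proof eventually_elim
      case (elim n)
      \<comment> \<open>g n is continuous on the triangle only; its extension provides measurability
        and limits on the whole plane.\<close>
      obtain h where h: "continuous_on UNIV h" "bounded (range h)" "\<And>z. z \<in> Omega \<Longrightarrow> h z = g n z"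
        by (rule extend_from_Omega[of "g n"]) (use g in blast, rule that)
      note [measurable] = continuous_pair_measurable[OF h(1)]
      have tri: "(\<integral>\<^sup>+t\<in>{0..x}. ennreal (norm (u t - w t)) \<partial>lborel) \<le> (\<integral>\<^sup>+t\<in>{0..x}. ennreal (norm (u t - v t)) \<partial>lborel) + (\<integral>\<^sup>+t\<in>{0..x}. ennreal (norm (v t - w t)) \<partial>lborel)"
        if [measurable]: "u \<in> borel_measurable borel" "v \<in> borel_measurable borel" "w \<in> borel_measurable borel" for u v w :: "real \<Rightarrow> complex" and x
      proof -
        have "(\<integral>\<^sup>+t\<in>{0..x}. ennreal (norm (u t - w t)) \<partial>lborel) \<le> (\<integral>\<^sup>+t. ennreal (norm (u t - v t)) * indicator {0..x} t + ennreal (norm (v t - w t)) * indicator {0..x} t \<partial>lborel)"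
        proof (intro nn_integral_mono)
          fix t
          have "ennreal (norm (u t - w t)) \<le> ennreal (norm (u t - v t)) + ennreal (norm (v t - w t))"
            using norm_triangle_ineq[of "u t - v t" "v t - w t"]
            by (simp add: ennreal_plus[symmetric] ennreal_leI del: ennreal_plus)
          from mult_right_mono[OF this zero_le[of "indicator {0..x} t"]]
          show "ennreal (norm (u t - w t)) * indicator {0..x} t \<le> ennreal (norm (u t - v t)) * indicator {0..x} t + ennreal (norm (v t - w t)) * indicator {0..x} t"
            by (simp add: distrib_right)
        qed
        also have "\<dots> = (\<integral>\<^sup>+t\<in>{0..x}. ennreal (norm (u t - v t)) \<partial>lborel) + (\<integral>\<^sup>+t\<in>{0..x}. ennreal (norm (v t - w t)) \<partial>lborel)"
          by (rule nn_integral_add) measurable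
        finally show ?thesis .
      qed
      have Gk: "(\<integral>\<^sup>+t\<in>{0..x}. ennreal (norm (G (x, t) - k (x, t))) \<partial>lborel) \<le> ennreal e" if "x \<in> {0..1}" for x
        using G(3) that unfolding kernel_close_def by (simp add: norm_minus_commute)
      have "AE x in lebesgue_on {0..1}. (\<integral>\<^sup>+t\<in>{0..x}. ennreal (norm (k (x, t) - g n (x, t))) \<partial>lebesgue) \<le> Xinf_norm (\<lambda>z. k z - g n z)"
        unfolding Xinf_norm_def by (rule esssup_AE)
      then have "AE x in lebesgue_on {0..1}. (\<integral>\<^sup>+t\<in>{0..x}. ennreal (norm (G (x, t) - h (x, t))) \<partial>lborel) \<le> ennreal (2 * e)"
        using AE_space
      proof eventually_elim
        case (elim x)
        then have x: "x \<in> {0..1}" by simp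
        have "(\<integral>\<^sup>+t\<in>{0..x}. ennreal (norm (k (x, t) - h (x, t))) \<partial>lborel) = (\<integral>\<^sup>+t\<in>{0..x}. ennreal (norm (k (x, t) - g n (x, t))) \<partial>lborel)"
          by (intro nn_integral_cong) (use x in \<open>auto simp: indicator_def h(3) Omega_def\<close>)
        also have "\<dots> \<le> ennreal e" using elim(1) \<open>Xinf_norm (\<lambda>z. k z - g n z) < ennreal e\<close> by (simp add: nn_integral_completion)
        finally have "(\<integral>\<^sup>+t\<in>{0..x}. ennreal (norm (G (x, t) - h (x, t))) \<partial>lborel) \<le> ennreal e + ennreal e"
          by (intro order.trans[OF tri[of "\<lambda>t. G (x, t)" "\<lambda>t. k (x, t)" "\<lambda>t. h (x, t)"] add_mono] Gk x) measurable
        then show ?case using e by (simp add: ennreal_plus[symmetric] del: ennreal_plus)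
      qed
      then obtain x where x: "\<And>n. x n \<in> {0..1} \<and> (\<integral>\<^sup>+t\<in>{0..x n}. ennreal (norm (G (x n, t) - h (x n, t))) \<partial>lborel) \<le> ennreal (2 * e)" "x \<longlonglongrightarrow> a"
        using AE_dense_sequence[OF _ a] by blast
      have "(\<integral>\<^sup>+t\<in>{0..a}. ennreal (norm (G (a, t) - h (a, t))) \<partial>lborel) \<le>
         (\<integral>\<^sup>+t. liminf (\<lambda>n. ennreal (norm (G (x n, t) - h (x n, t))) * indicator {0..x n} t) \<partial>lborel)"
      proof (rule nn_integral_mono_AE)
        show "AE t in lborel. ennreal (norm (G (a, t) - h (a, t))) * indicator {0..a} t \<le>
          liminf (\<lambda>n. ennreal (norm (G (x n, t) - h (x n, t))) * indicator {0..x n} t)"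
          \<comment> \<open>At t = a the indicators of {0..x n} need not converge.\<close>
          using AE_lborel_singleton[of a]
        proof eventually_elim
          case (elim t)
          show ?case
          proof (cases "t \<in> {0..a}")
            case True
            then have "t < a" using elim by simp
            have ev: "\<forall>\<^sub>F n in sequentially. indicator {0..x n} t = (1::ennreal)"
              using order_tendstoD(1)[OF x(2) \<open>t < a\<close>] by eventually_elim (use True in auto)
            have lim: "(\<lambda>n. ennreal (norm (G (x n, t) - h (x n, t)))) \<longlonglongrightarrow> ennreal (norm (G (a, t) - h (a, t)))"
              by (intro tendsto_intros tendsto_norm continuous_on_tendsto_compose[OF G(1)] continuous_on_tendsto_compose[OF h(1)] x(2)) auto
            have "(\<lambda>n. ennreal (norm (G (x n, t) - h (x n, t))) * indicator {0..x n} t) \<longlonglongrightarrow> ennreal (norm (G (a, t) - h (a, t)))"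
              by (rule Lim_transform_eventually[OF lim]) (use ev in eventually_elim, simp)
            from lim_imp_Liminf[OF sequentially_bot this] show ?thesis using True by simp
          qed simp
        qed
      qed
      also have "\<dots> \<le> liminf (\<lambda>n. \<integral>\<^sup>+t\<in>{0..x n}. ennreal (norm (G (x n, t) - h (x n, t))) \<partial>lborel)"
        by (rule nn_integral_liminf) measurable
      also have "\<dots> \<le> ennreal (2 * e)"
        by (rule Liminf_le) (use x(1) in simp_all)
      finally have Gh: "(\<integral>\<^sup>+t\<in>{0..a}. ennreal (norm (h (a, t) - G (a, t))) \<partial>lborel) \<le> ennreal (2 * e)"
        by (simp add: norm_minus_commute)
      have "(\<integral>\<^sup>+t\<in>{0..a}. ennreal (norm (g n (a, t) - k (a, t))) \<partial>lebesgue) = (\<integral>\<^sup>+t\<in>{0..a}. ennreal (norm (h (a, t) - k (a, t))) \<partial>lborel)"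
        unfolding nn_integral_completion by (intro nn_integral_cong) (use a in \<open>auto simp: indicator_def h(3) Omega_def\<close>)
      also have "\<dots> \<le> ennreal (2 * e) + ennreal e"
        by (intro order.trans[OF tri[of "\<lambda>t. h (a, t)" "\<lambda>t. G (a, t)" "\<lambda>t. k (a, t)"] add_mono] Gh Gk a) measurable
      also have "\<dots> = ennreal (3 * e)" using e by (simp add: ennreal_plus[symmetric] del: ennreal_plus)
      also have "\<dots> < y" by (rule e)
      finally show ?case .
    qed
  qed simp
qed

section \<open>The transformation kernel\<close>

lemma nn_integral_affine:
  assumes [measurable]: "f \<in> borel_measurable borel" and r: "r \<noteq> 0"
  shows "(\<integral>\<^sup>+t. f (c + r * t) \<partial>lborel) = ennreal (1 / \<bar>r\<bar>) * (\<integral>\<^sup>+t. f t \<partial>lborel)"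
proof -
  have "ennreal (1/\<bar>r\<bar>) * (ennreal \<bar>r\<bar> * y) = y" for y
    using r by (simp add: mult.assoc[symmetric] ennreal_mult[symmetric])
  moreover have "(\<integral>\<^sup>+t. f t \<partial>lborel) = ennreal \<bar>r\<bar> * (\<integral>\<^sup>+t. f (c + r * t) \<partial>lborel)"
    using nn_integral_real_affine[of f r c] r by simp
  ultimately show ?thesis by simp
qed

text \<open>For fixed x the substitution in t has Jacobian |r| and stays in the section at x; for
  fixed t the points (x, p * x + r * t) run along a line of slope p > 0. These are exactly the sets
  on which \<open>S_approx\<close> is uniform.\<close>

lemma (in goursat) approximable_S_affine:
  assumes p: "p > 0" and r: "r \<noteq> 0"
    and range: "\<And>x t. 0 \<le> t \<Longrightarrow> t \<le> x \<Longrightarrow> x \<le> 1 \<Longrightarrow> 0 \<le> p * x + r * t \<and> p * x + r * t \<le> x"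
  shows "approximable_kernel (\<lambda>z. c * S i (fst z, p * fst z + r * snd z))"
  unfolding approximable_kernel_def
proof (intro conjI allI impI)
  show "(\<lambda>z. c * S i (fst z, p * fst z + r * snd z)) \<in> borel_measurable (borel \<Otimes>\<^sub>M borel)"
    by measurable
  fix e :: real assume e: "e > 0"
  define m where "m = min \<bar>r\<bar> p"
  have m: "m > 0" "m \<le> \<bar>r\<bar>" "m \<le> p" using p r by (auto simp: m_def)
  \<comment> \<open>The two substitutions divide the error by |r| and by p, hence the factor m; the
    added 1 covers c = 0.\<close>
  define e' where "e' = e * m / (norm c + 1)"
  have e': "e' > 0" using e m by (simp add: e'_def add_nonneg_pos)
  have small: "norm c * (e' / s) \<le> e" if "m \<le> s" for s
  proof -
    have "norm c * (e' / s) = e * (norm c / (norm c + 1)) * (m / s)" by (simp add: e'_def)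
    also have "\<dots> \<le> e * 1 * 1"
      using e m that by (intro mult_mono mult_nonneg_nonneg) (auto simp: divide_le_eq add_nonneg_pos)
    finally show ?thesis by simp
  qed
  obtain G where G: "\<forall>i. continuous_on UNIV (G i) \<and> bounded (range (G i))"
    and sec: "\<forall>i. \<forall>x\<in>{0..1}. (\<integral>\<^sup>+y\<in>{0..x}. ennreal (norm (S i (x, y) - G i (x, y))) \<partial>lborel) \<le> ennreal e'"
    and line: "\<forall>i k \<alpha> s. k > 0 \<longrightarrow> (\<forall>x\<in>{s..1}. 0 \<le> \<alpha> + k * x) \<longrightarrow>
       (\<integral>\<^sup>+x\<in>{s..1}. ennreal (norm (S i (x, \<alpha> + k * x) - G i (x, \<alpha> + k * x))) \<partial>lborel) \<le> ennreal (e' / k)"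
    using S_approx[OF e'] by blast
  have cont: "continuous_on UNIV (G i)" using G by blast
  note [measurable] = continuous_pair_measurable[OF cont]
  let ?g = "\<lambda>z. c * G i (fst z, p * fst z + r * snd z)"
  show "\<exists>g. continuous_on UNIV g \<and> bounded (range g) \<and> kernel_close e (\<lambda>z. c * S i (fst z, p * fst z + r * snd z)) g"
  proof (intro exI[of _ ?g] conjI)
    show "continuous_on UNIV ?g"
      by (intro continuous_intros continuous_on_compose2[OF cont]) auto
    obtain B where "\<And>z. norm (G i z) \<le> B" using G unfolding bounded_iff by blast
    then have "norm (?g z) \<le> norm c * B" for z by (simp add: norm_mult mult_left_mono)
    then show "bounded (range ?g)" by (auto intro!: boundedI)
    show "kernel_close e (\<lambda>z. c * S i (fst z, p * fst z + r * snd z)) ?g"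
      unfolding kernel_close_def
    proof (intro conjI ballI)
      fix x :: real assume x: "x \<in> {0..1}"
      have "(\<integral>\<^sup>+t\<in>{0..x}. ennreal (norm (c * S i (fst (x, t), p * fst (x, t) + r * snd (x, t)) - ?g (x, t))) \<partial>lborel)
        \<le> (\<integral>\<^sup>+t. ennreal (norm c) * (ennreal (norm (S i (x, p * x + r * t) - G i (x, p * x + r * t))) * indicator {0..x} (p * x + r * t)) \<partial>lborel)"
      proof (intro nn_integral_mono)
        fix t
        have "norm (c * S i (x, p * x + r * t) - c * G i (x, p * x + r * t)) = norm c * norm (S i (x, p * x + r * t) - G i (x, p * x + r * t))"
          by (simp only: right_diff_distrib[symmetric] norm_mult)
        then show "ennreal (norm (c * S i (fst (x, t), p * fst (x, t) + r * snd (x, t)) - ?g (x, t))) * indicator {0..x} t \<le>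
          ennreal (norm c) * (ennreal (norm (S i (x, p * x + r * t) - G i (x, p * x + r * t))) * indicator {0..x} (p * x + r * t))"
          using range[of t x] x by (cases "t \<in> {0..x}") (simp_all add: ennreal_mult)
      qed
      also have "\<dots> = ennreal (norm c) * (ennreal (1 / \<bar>r\<bar>) * (\<integral>\<^sup>+y\<in>{0..x}. ennreal (norm (S i (x, y) - G i (x, y))) \<partial>lborel))"
        using nn_integral_affine[of "\<lambda>y. ennreal (norm (S i (x, y) - G i (x, y))) * indicator {0..x} y", OF _ r, of "p * x"]
        by (subst nn_integral_cmult) auto
      also have "\<dots> \<le> ennreal (norm c) * (ennreal (1 / \<bar>r\<bar>) * ennreal e')"
        using sec x by (intro mult_left_mono) auto
      also have "\<dots> = ennreal (norm c * (e' / \<bar>r\<bar>))" using e' by (simp add: ennreal_mult[symmetric])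
      also have "\<dots> \<le> ennreal e" by (intro ennreal_leI small m)
      finally show "(\<integral>\<^sup>+t\<in>{0..x}. ennreal (norm (c * S i (fst (x, t), p * fst (x, t) + r * snd (x, t)) - ?g (x, t))) \<partial>lborel) \<le> ennreal e" .
    next
      fix t :: real assume t: "t \<in> {0..1}"
      have eq: "(\<integral>\<^sup>+x\<in>{t..1}. ennreal (norm (c * S i (fst (x, t), p * fst (x, t) + r * snd (x, t)) - ?g (x, t))) \<partial>lborel)
        = (\<integral>\<^sup>+x. ennreal (norm c) * (ennreal (norm (S i (x, r * t + p * x) - G i (x, r * t + p * x))) * indicator {t..1} x) \<partial>lborel)"
        by (intro nn_integral_cong) (simp add: right_diff_distrib[symmetric] norm_mult ennreal_mult add.commute mult_ac)
      also have "\<dots> = ennreal (norm c) * (\<integral>\<^sup>+x\<in>{t..1}. ennreal (norm (S i (x, r * t + p * x) - G i (x, r * t + p * x))) \<partial>lborel)"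
        by (rule nn_integral_cmult) measurable
      also have "\<dots> \<le> ennreal (norm c) * ennreal (e' / p)"
      proof (rule mult_left_mono)
        have "\<forall>x\<in>{t..1}. 0 \<le> r * t + p * x" using range[of t] t by (simp add: add.commute)
        then show "(\<integral>\<^sup>+x\<in>{t..1}. ennreal (norm (S i (x, r * t + p * x) - G i (x, r * t + p * x))) \<partial>lborel) \<le> ennreal (e' / p)"
          using line[rule_format, OF p, of t "r * t" i] by blast
      qed simp
      also have "\<dots> = ennreal (norm c * (e' / p))" using e' p by (simp add: ennreal_mult[symmetric])
      also have "\<dots> \<le> ennreal e" by (intro ennreal_leI small m)
      finally show "(\<integral>\<^sup>+x\<in>{t..1}. ennreal (norm (c * S i (fst (x, t), p * fst (x, t) + r * snd (x, t)) - ?g (x, t))) \<partial>lborel) \<le> ennreal e" .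
    qed
  qed
qed

section \<open>Functions with values in vectors and matrices\<close>

lemma measurable_vec:
  fixes f :: "'a \<Rightarrow> 'b::euclidean_space ^ 'n::finite"
  assumes "\<And>i. (\<lambda>x. f x $ i) \<in> borel_measurable M"
  shows "f \<in> borel_measurable M"
proof (rule borel_measurable_euclidean_space[THEN iffD2], intro ballI)
  fix b :: "'b ^ 'n" assume "b \<in> Basis"
  then obtain i c where b: "b = axis i c" by (auto simp: Basis_vec_def)
  note [measurable] = assms
  show "(\<lambda>x. f x \<bullet> b) \<in> borel_measurable M"
    unfolding b inner_axis by measurable
qed

lemma norm_vec_le_sum:
  fixes v :: "'b::real_normed_vector ^ 'n::finite"
  shows "norm v \<le> (\<Sum>i\<in>UNIV. norm (v $ i))"
  unfolding norm_vec_def by (rule L2_set_le_sum) auto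

lemma approximable_vec:
  fixes k :: "real \<times> real \<Rightarrow> 'b::euclidean_space ^ 'n::finite"
  assumes k: "\<And>i. approximable_kernel (\<lambda>z. k z $ i)"
  shows "approximable_kernel k"
  unfolding approximable_kernel_def
proof (intro conjI allI impI)
  show "k \<in> borel_measurable (borel \<Otimes>\<^sub>M borel)"
    by (intro measurable_vec approximable_kernelD(1)[OF k])
  note [measurable] = approximable_kernelD(1)[OF k]
  fix e :: real assume e: "e > 0"
  define e' where "e' = e / real CARD('n)"
  have e': "e' > 0" "real CARD('n) * e' = e" using e by (auto simp: e'_def)
  have "\<forall>i. \<exists>g. continuous_on UNIV g \<and> bounded (range g) \<and> kernel_close e' (\<lambda>z. k z $ i) g"
    using approximable_kernelD(2)[OF k e'(1)] by blast
  from choice[OF this] obtain G where G: "\<forall>i. continuous_on UNIV (G i) \<and> bounded (range (G i)) \<and> kernel_close e' (\<lambda>z. k z $ i) (G i)" ..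
  have cont: "continuous_on UNIV (G i)" for i using G by blast
  note [measurable] = continuous_pair_measurable[OF cont]
  have pt: "ennreal (norm (k z - (\<chi> i. G i z))) * c \<le> (\<Sum>i\<in>UNIV. ennreal (norm (k z $ i - G i z)) * c)" for z and c :: ennreal
  proof -
    have "ennreal (norm (k z - (\<chi> i. G i z))) \<le> ennreal (\<Sum>i\<in>UNIV. norm (k z $ i - G i z))"
      using norm_vec_le_sum[of "k z - (\<chi> i. G i z)"] by (intro ennreal_leI) simp
    also have "\<dots> = (\<Sum>i\<in>UNIV. ennreal (norm (k z $ i - G i z)))" by simp
    finally show ?thesis by (simp only: sum_distrib_right[symmetric] mult_right_mono zero_le)
  qed
  have sum_e: "(\<Sum>i\<in>(UNIV::'n set). ennreal e') = ennreal e"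
    using e' by (simp add: ennreal_of_nat_eq_real_of_nat ennreal_mult[symmetric])
  show "\<exists>g. continuous_on UNIV g \<and> bounded (range g) \<and> kernel_close e k g"
  proof (intro exI[of _ "\<lambda>z. \<chi> i. G i z"] conjI)
    show "continuous_on UNIV (\<lambda>z. \<chi> i. G i z)" by (intro continuous_on_vec_lambda cont)
    have "\<forall>i. \<exists>B. \<forall>z. norm (G i z) \<le> B" using G unfolding bounded_iff by blast
    from choice[OF this] obtain B where B: "\<forall>i z. norm (G i z) \<le> B i" ..
    have "norm (\<chi> i. G i z) \<le> (\<Sum>i\<in>UNIV. B i)" for z
      by (intro order.trans[OF norm_vec_le_sum] sum_mono) (simp del: split_paired_All add: B[rule_format])
    then show "bounded (range (\<lambda>z. \<chi> i. G i z))" by (auto intro!: boundedI)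
    show "kernel_close e k (\<lambda>z. \<chi> i. G i z)"
      unfolding kernel_close_def
    proof (intro conjI ballI)
      fix x :: real assume x: "x \<in> {0..1}"
      have "(\<integral>\<^sup>+t\<in>{0..x}. ennreal (norm (k (x, t) - (\<chi> i. G i (x, t)))) \<partial>lborel) \<le> (\<integral>\<^sup>+t. (\<Sum>i\<in>UNIV. ennreal (norm (k (x, t) $ i - G i (x, t))) * indicator {0..x} t) \<partial>lborel)"
        by (intro nn_integral_mono pt)
      also have "\<dots> = (\<Sum>i\<in>UNIV. \<integral>\<^sup>+t\<in>{0..x}. ennreal (norm (k (x, t) $ i - G i (x, t))) \<partial>lborel)"
        by (rule nn_integral_sum) measurable
      also have "\<dots> \<le> (\<Sum>i\<in>(UNIV::'n set). ennreal e')"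
        using G x unfolding kernel_close_def by (intro sum_mono) blast
      finally show "(\<integral>\<^sup>+t\<in>{0..x}. ennreal (norm (k (x, t) - (\<chi> i. G i (x, t)))) \<partial>lborel) \<le> ennreal e"
        unfolding sum_e .
    next
      fix t :: real assume t: "t \<in> {0..1}"
      have "(\<integral>\<^sup>+x\<in>{t..1}. ennreal (norm (k (x, t) - (\<chi> i. G i (x, t)))) \<partial>lborel) \<le> (\<integral>\<^sup>+x. (\<Sum>i\<in>UNIV. ennreal (norm (k (x, t) $ i - G i (x, t))) * indicator {t..1} x) \<partial>lborel)"
        by (intro nn_integral_mono pt)
      also have "\<dots> = (\<Sum>i\<in>UNIV. \<integral>\<^sup>+x\<in>{t..1}. ennreal (norm (k (x, t) $ i - G i (x, t))) \<partial>lborel)"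
        by (rule nn_integral_sum) measurable
      also have "\<dots> \<le> (\<Sum>i\<in>(UNIV::'n set). ennreal e')"
        using G t unfolding kernel_close_def by (intro sum_mono) blast
      finally show "(\<integral>\<^sup>+x\<in>{t..1}. ennreal (norm (k (x, t) - (\<chi> i. G i (x, t)))) \<partial>lborel) \<le> ennreal e"
        unfolding sum_e .
    qed
  qed
qed

text \<open>The interval is cut at \<beta> * x and each piece is parametrised over {0..x}, the left
  one backwards, so that t = 0 is the cut in both. For the \<beta> used later the total phase
  vanishes at the cut.\<close>

lemma integral_split_affine:
  fixes f :: "real \<Rightarrow> complex"
  assumes int: "integrable lborel (\<lambda>y. indicator {0..x} y *\<^sub>R f y)" and x: "0 \<le> x" and b: "0 < \<beta>" "\<beta> < 1"
  shows "(LINT y|lborel. indicator {0..x} y *\<^sub>R f y) =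
      of_real \<beta> * (LINT t|lborel. indicator {0..x} t *\<^sub>R f (\<beta> * x - \<beta> * t)) +
      of_real (1 - \<beta>) * (LINT t|lborel. indicator {0..x} t *\<^sub>R f (\<beta> * x + (1 - \<beta>) * t))"
    and "integrable lborel (\<lambda>t. indicator {0..x} t *\<^sub>R f (\<beta> * x - \<beta> * t))"
    and "integrable lborel (\<lambda>t. indicator {0..x} t *\<^sub>R f (\<beta> * x + (1 - \<beta>) * t))"
proof -
  let ?f = "\<lambda>y. indicator {0..x} y *\<^sub>R f y"
  let ?f1 = "\<lambda>y. indicator {0..\<beta> * x} y *\<^sub>R ?f y" and ?f2 = "\<lambda>y. indicator {\<beta> * x..x} y *\<^sub>R ?f y"
  have i1: "integrable lborel ?f1" and i2: "integrable lborel ?f2"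
    by (rule integrable_mult_indicator[OF _ int], simp)+
  have bx: "0 \<le> \<beta> * x" "\<beta> * x \<le> x" using b x by (auto simp: mult_left_le_one_le)
  have e1: "?f1 (\<beta> * x + (-\<beta>) * t) = indicator {0..x} t *\<^sub>R f (\<beta> * x - \<beta> * t)" for t
  proof -
    have "0 \<le> \<beta> * x - \<beta> * t \<longleftrightarrow> t \<le> x" using b by (simp add: right_diff_distrib[symmetric] zero_le_mult_iff)
    moreover have "\<beta> * x - \<beta> * t \<le> \<beta> * x \<longleftrightarrow> 0 \<le> t" using b by (simp add: zero_le_mult_iff)
    ultimately show ?thesis using bx by (auto simp: indicator_def)
  qed
  have e2: "?f2 (\<beta> * x + (1 - \<beta>) * t) = indicator {0..x} t *\<^sub>R f (\<beta> * x + (1 - \<beta>) * t)" for t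
  proof -
    have "\<beta> * x + (1 - \<beta>) * t \<le> x \<longleftrightarrow> (1 - \<beta>) * t \<le> (1 - \<beta>) * x" by (simp add: algebra_simps)
    then have "\<beta> * x + (1 - \<beta>) * t \<le> x \<longleftrightarrow> t \<le> x" using b by simp
    moreover have "\<beta> * x \<le> \<beta> * x + (1 - \<beta>) * t \<longleftrightarrow> 0 \<le> t" using b by (simp add: zero_le_mult_iff)
    ultimately show ?thesis using bx by (auto simp: indicator_def)
  qed
  show "integrable lborel (\<lambda>t. indicator {0..x} t *\<^sub>R f (\<beta> * x - \<beta> * t))"
    using lborel_integrable_real_affine[OF i1, of "-\<beta>" "\<beta> * x"] b unfolding e1 by simp
  show "integrable lborel (\<lambda>t. indicator {0..x} t *\<^sub>R f (\<beta> * x + (1 - \<beta>) * t))"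
    using lborel_integrable_real_affine[OF i2, of "1 - \<beta>" "\<beta> * x"] b unfolding e2 by simp
  have "(LINT y|lborel. ?f y) = (LINT y|lborel. ?f1 y + ?f2 y)"
  proof (rule integral_cong_AE)
    show "AE y in lborel. ?f y = ?f1 y + ?f2 y"
      using AE_lborel_singleton[of "\<beta> * x"]
      by eventually_elim (use bx in \<open>auto simp: indicator_def\<close>)
  qed (use int i1 i2 in auto)
  also have "\<dots> = (LINT y|lborel. ?f1 y) + (LINT y|lborel. ?f2 y)"
    by (rule Bochner_Integration.integral_add[OF i1 i2])
  also have "(LINT y|lborel. ?f1 y) = \<bar>-\<beta>\<bar> *\<^sub>R (LINT t|lborel. ?f1 (\<beta> * x + (-\<beta>) * t))"
    using b by (intro lborel_integral_real_affine) auto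
  also have "(LINT y|lborel. ?f2 y) = \<bar>1 - \<beta>\<bar> *\<^sub>R (LINT t|lborel. ?f2 (\<beta> * x + (1 - \<beta>) * t))"
    using b by (intro lborel_integral_real_affine) auto
  finally show "(LINT y|lborel. indicator {0..x} y *\<^sub>R f y) =
      of_real \<beta> * (LINT t|lborel. indicator {0..x} t *\<^sub>R f (\<beta> * x - \<beta> * t)) +
      of_real (1 - \<beta>) * (LINT t|lborel. indicator {0..x} t *\<^sub>R f (\<beta> * x + (1 - \<beta>) * t))"
    unfolding e1 e2 using b by (simp add: scaleR_conv_of_real)
qed

lemma sum_two: "(\<Sum>j\<in>UNIV. f j) = f i + f (i + 1)" for f :: "2 \<Rightarrow> 'a::comm_monoid_add"
  using exhaust_2[of i] by (elim disjE) (simp_all add: sum_2 three_eq_one add.commute)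

lemma e0_component: "e0 b1 b2 s lam x $ i = pair_fun 1 s i * exp (\<i> * of_real (pair_fun b1 b2 i) * lam * of_real x)"
  using exhaust_2[of i] by (auto simp: e0_def)

lemma integrable_vec:
  fixes h :: "'a \<Rightarrow> complex ^ 'n::finite"
  assumes h: "\<And>i. integrable M (\<lambda>x. h x $ i)"
  shows "integrable M h"
proof (rule Bochner_Integration.integrable_bound)
  show "integrable M (\<lambda>x. \<Sum>i\<in>UNIV. norm (h x $ i))" by (intro Bochner_Integration.integrable_sum integrable_norm h)
  show "h \<in> borel_measurable M" by (intro measurable_vec borel_measurable_integrable h)
  show "AE x in M. norm (h x) \<le> norm (\<Sum>i\<in>UNIV. norm (h x $ i))"
    by (intro AE_I2) (simp add: norm_vec_le_sum sum_nonneg)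
qed

lemma integral_vec_nth:
  fixes h :: "'a \<Rightarrow> complex ^ 'n::finite"
  assumes h: "\<And>i. integrable M (\<lambda>x. h x $ i)"
  shows "integral\<^sup>L M h $ i = (LINT x|M. h x $ i)"
  using integral_bounded_linear[OF bounded_linear_vec_nth integrable_vec[OF h]] by simp

text \<open>A crude constant: each of the two components is a sum of two products bounded by
  \<open>norm A * norm v\<close>.\<close>

lemma norm_matrix_vector_le:
  fixes A :: "complex^2^2"
  shows "norm (A *v v) \<le> 4 * norm A * norm v"
proof -
  have "norm ((A *v v) $ i) \<le> 2 * norm A * norm v" for i
  proof -
    have "norm ((A *v v) $ i) \<le> (\<Sum>j\<in>UNIV. norm (A $ i $ j * v $ j))"
      unfolding matrix_vector_mult_def by (simp add: norm_sum)
    also have "\<dots> \<le> (\<Sum>j\<in>(UNIV::2 set). norm A * norm v)"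
      unfolding norm_mult
      by (intro sum_mono mult_mono Finite_Cartesian_Product.norm_nth_le
          order.trans[OF Finite_Cartesian_Product.norm_nth_le Finite_Cartesian_Product.norm_nth_le]) auto
    finally show ?thesis by simp
  qed
  then have "(\<Sum>i\<in>UNIV. norm ((A *v v) $ i)) \<le> (\<Sum>i\<in>(UNIV::2 set). 2 * norm A * norm v)" by (intro sum_mono)
  then show ?thesis using norm_vec_le_sum[of "A *v v"] by simp
qed

lemma measurable_matrix_vector [measurable (raw)]:
  fixes A :: "'a \<Rightarrow> complex^2^2"
  assumes [measurable]: "A \<in> borel_measurable M" "v \<in> borel_measurable M"
  shows "(\<lambda>x. A x *v v x) \<in> borel_measurable M"
proof (rule measurable_vec)
  fix i
  have [measurable]: "(\<lambda>x. A x $ i $ j) \<in> borel_measurable M" "(\<lambda>x. v x $ j) \<in> borel_measurable M" for j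
    by (rule measurable_compose[OF assms(1) borel_measurable_continuous_onI], intro continuous_intros,
        rule measurable_compose[OF assms(2) borel_measurable_continuous_onI], intro continuous_intros)
  show "(\<lambda>x. (A x *v v x) $ i) \<in> borel_measurable M"
    unfolding matrix_vector_mult_def by simp
qed

text \<open>Component i of the solution is an integral over y with the phase lam * (b i * x + (b (i
  + 1) - b i) * y). Its zero y = \<beta> i * x lies strictly between 0 and x for x > 0, because b1
  and b2 have opposite signs. To the left of it the phase takes the form lam * b i * t and to the
  right lam * b (i + 1) * t, both with t in {0..x}; the two pieces are the diagonal and the
  off-diagonal entry of row i.\<close>

theorem transformation_kernel_exists:
  fixes b1 b2 :: real and Q12 Q21 :: "real \<Rightarrow> complex" and s :: complex
  assumes b: "b1 < 0" "0 < b2"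
    and Q: "set_integrable lebesgue {0..1} Q12" "set_integrable lebesgue {0..1} Q21"
    and s: "s = 1 \<or> s = -1"
  shows "\<exists>K :: real \<times> real \<Rightarrow> complex^2^2.
     (\<forall>i j. approximable_kernel (\<lambda>z. K z $ i $ j)) \<and>
     (\<forall>lam e. is_solution b1 b2 Q12 Q21 lam e \<and> e 0 = vector [1, s] \<longrightarrow>
        (\<forall>x\<in>{0..1}. e x = e0 b1 b2 s lam x + triangular_op K (e0 b1 b2 s lam) x))"
proof -
  obtain q1 where q1: "integrable lborel q1" "AE t in lebesgue_on {0..1}. q1 t = Q12 t" using borel_representative[OF Q(1)] .
  obtain q2 where q2: "integrable lborel q2" "AE t in lebesgue_on {0..1}. q2 t = Q21 t" using borel_representative[OF Q(2)] .
  define b where "b i = complex_of_real (pair_fun b1 b2 i)" for i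
  \<comment> \<open>The factor arises from solving the system for the derivative, which multiplies
    the potential by - \<i> * b i.\<close>
  define q where "q i t = - \<i> * b i * pair_fun q1 q2 i t" for i t
  define \<gamma> where "\<gamma> = pair_fun 1 s"
  \<comment> \<open>Solves b i + (b (i + 1) - b i) * \<beta> i = 0; the two values add up to
    1.\<close>
  define \<beta> where "\<beta> = pair_fun (- b1 / (b2 - b1)) (b2 / (b2 - b1))"
  have qint: "integrable lborel (q i)" for i
    unfolding q_def using q1(1) q2(1) exhaust_2[of i] by auto
  have qQ: "AE t in lebesgue_on {0..1}. q i t = - \<i> * b i * pair_fun Q12 Q21 i t" for i
    unfolding q_def using q1(2) q2(2) exhaust_2[of i] by auto
  interpret goursat q "\<lambda>i t. \<gamma> (i+1) * q i t"
    using qint by unfold_locales auto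
  \<comment> \<open>As s is 1 or -1, the factor \<gamma> j put into column j of K cancels the same
    factor in the free exponential.\<close>
  have \<gamma>2: "\<gamma> i * \<gamma> i = 1" for i using exhaust_2[of i] s by (auto simp: \<gamma>_def)
  have \<beta>: "0 < \<beta> i" "\<beta> i < 1" for i using exhaust_2[of i] b by (auto simp: \<beta>_def field_simps)
  have \<beta>1: "\<beta> (i+1) = 1 - \<beta> i" for i
    using exhaust_2[of i] b by (elim disjE) (simp_all add: \<beta>_def three_eq_one field_simps)
  have b\<beta>: "(b (i+1) - b i) * of_real (\<beta> i) = - b i" "(b (i+1) - b i) * of_real (\<beta> (i+1)) = b (i+1)" for i
  proof -
    have "(pair_fun b1 b2 (i+1) - pair_fun b1 b2 i) * \<beta> i = - pair_fun b1 b2 i"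
      "(pair_fun b1 b2 (i+1) - pair_fun b1 b2 i) * \<beta> (i+1) = pair_fun b1 b2 (i+1)"
      using exhaust_2[of i] b by (elim disjE; simp add: \<beta>_def three_eq_one field_simps)+
    then show "(b (i+1) - b i) * of_real (\<beta> i) = - b i" "(b (i+1) - b i) * of_real (\<beta> (i+1)) = b (i+1)"
      unfolding b_def of_real_diff[symmetric] of_real_mult[symmetric] of_real_minus[symmetric] by simp_all
  qed
  \<comment> \<open>Off the diagonal \<beta> i is written as 1 - \<beta> j, so that both cases fit
    \<open>approximable_S_affine\<close> with constants depending on the column only.\<close>
  define k where "k i j z = (if i = j then (\<gamma> j * of_real (\<beta> j)) * S i (fst z, \<beta> j * fst z + (- \<beta> j) * snd z)
     else (\<gamma> j * of_real (\<beta> j)) * S i (fst z, (1 - \<beta> j) * fst z + \<beta> j * snd z))" for i j and z :: "real \<times> real"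
  define K :: "real \<times> real \<Rightarrow> complex^2^2" where "K z = (\<chi> i j. k i j z)" for z
  have appr: "approximable_kernel (k i j)" for i j
  proof (cases "i = j")
    case True
    have "approximable_kernel (\<lambda>z. (\<gamma> j * of_real (\<beta> j)) * S i (fst z, \<beta> j * fst z + (- \<beta> j) * snd z))"
    proof (rule approximable_S_affine)
      fix x t :: real assume "0 \<le> t" "t \<le> x" "x \<le> 1"
      then have "0 \<le> \<beta> j * (x - t)" "\<beta> j * (x - t) \<le> x - t"
        using \<beta>[of j] by (auto simp: mult_left_le_one_le)
      then show "0 \<le> \<beta> j * x + - \<beta> j * t \<and> \<beta> j * x + - \<beta> j * t \<le> x"
        using \<open>0 \<le> t\<close> by (simp add: algebra_simps)
    qed (use \<beta>[of j] in auto)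
    moreover have "k i j = (\<lambda>z. (\<gamma> j * of_real (\<beta> j)) * S i (fst z, \<beta> j * fst z + (- \<beta> j) * snd z))"
      using True by (auto simp: k_def fun_eq_iff)
    ultimately show ?thesis by simp
  next
    case False
    have "approximable_kernel (\<lambda>z. (\<gamma> j * of_real (\<beta> j)) * S i (fst z, (1 - \<beta> j) * fst z + \<beta> j * snd z))"
    proof (rule approximable_S_affine)
      fix x t :: real assume "0 \<le> t" "t \<le> x" "x \<le> 1"
      then have "0 \<le> \<beta> j * (x - t)" "0 \<le> (1 - \<beta> j) * x" "0 \<le> \<beta> j * t"
        using \<beta>[of j] by auto
      then show "0 \<le> (1 - \<beta> j) * x + \<beta> j * t \<and> (1 - \<beta> j) * x + \<beta> j * t \<le> x"
        by (simp add: algebra_simps)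
    qed (use \<beta>[of j] in auto)
    moreover have "k i j = (\<lambda>z. (\<gamma> j * of_real (\<beta> j)) * S i (fst z, (1 - \<beta> j) * fst z + \<beta> j * snd z))"
      using False by (auto simp: k_def fun_eq_iff)
    ultimately show ?thesis by simp
  qed
  have "e x = e0 b1 b2 s lam x + triangular_op K (e0 b1 b2 s lam) x"
    if sol: "is_solution b1 b2 Q12 Q21 lam e" and init: "e 0 = vector [1, s]" and x: "x \<in> {0..1}" for lam e x
  proof -
    define u where "u i x = exp (- \<i> * lam * b i * of_real x) * e x $ i" for i x
    define d where "d i = \<i> * lam * (b (i+1) - b i)" for i
    have bnz: "b1 \<noteq> 0" "b2 \<noteq> 0" using b by auto
    note ieq = solution_integral_equation[OF bnz qint qQ[unfolded b_def] sol, folded b_def, folded u_def d_def]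
    have u0: "u i 0 = \<gamma> i" for i
      using exhaust_2[of i] by (auto simp: u_def init \<gamma>_def)
    have "\<forall>i. \<exists>C. \<forall>x\<in>{0..1}. norm (u i x) \<le> C"
    proof
      fix i
      have "bounded (u i ` {0..1})"
        by (intro compact_imp_bounded compact_continuous_image ieq(3)[of 0]) auto
      then show "\<exists>C. \<forall>x\<in>{0..1}. norm (u i x) \<le> C" unfolding bounded_iff by blast
    qed
    from choice[OF this] obtain C where C: "\<forall>i. \<forall>x\<in>{0..1}. norm (u i x) \<le> C i" ..
    \<comment> \<open>The given solution and the series solution are bounded on the unit interval
      and satisfy the same integral equation.\<close>
    have uz: "u i x = z \<gamma> d i x" for i
    proof (rule z_unique[OF _ _ ieq(1) _ _ x])
      fix i and x :: real assume x: "x \<in> {0..1}"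
      have "norm (u i x) \<le> C i" using C x by blast
      also have "\<dots> \<le> max (C 1) (C 2)" using exhaust_2[of i] by auto
      finally show "norm (u i x) \<le> max (C 1) (C 2)" .
      show "u i x = \<gamma> i + (LINT t|lborel. indicator {0..x} t *\<^sub>R (q i t * exp (d i * of_real t) * u (i+1) t))"
        using ieq(2)[OF x, of i] unfolding u0 .
    next
      show "d (i+1) = - d i" for i unfolding d_def two_swap by (simp add: algebra_simps)
    qed (assumption | rule refl)+
    let ?T = "\<lambda>i j t. indicator {0..x} t *\<^sub>R (k i j (x, t) * e0 b1 b2 s lam t $ j)"
    have key: "e x $ i = e0 b1 b2 s lam x $ i + ((LINT t|lborel. ?T i i t) + (LINT t|lborel. ?T i (i+1) t))"
      "integrable lborel (?T i i)" "integrable lborel (?T i (i+1))" for i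
    proof -
      let ?j = "i + 1"
      have x0: "0 \<le> x" using x by simp
      let ?f = "\<lambda>y. S i (x, y) * exp (d i * of_real y)"
      note split = integral_split_affine[OF S_exp_integrable(1)[OF x0, of i "d i"] x0 \<beta>(1,2)[of i]]
      \<comment> \<open>Restores the free phase that was divided out in u.\<close>
      let ?E = "exp (\<i> * lam * b i * of_real x)"
      let ?T = "\<lambda>j t. indicator {0..x} t *\<^sub>R (k i j (x, t) * e0 b1 b2 s lam t $ j)"
      have T1: "?T i t = (?E * of_real (\<beta> i)) * (indicator {0..x} t *\<^sub>R ?f (\<beta> i * x - \<beta> i * t))" for t
      proof -
        have "?E * exp (d i * of_real (\<beta> i * x - \<beta> i * t)) = exp (\<i> * b i * lam * of_real t)"
        proof -
          have "d i * of_real (\<beta> i * x - \<beta> i * t) = (\<i> * lam * of_real (x - t)) * ((b (i+1) - b i) * of_real (\<beta> i))"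
            by (simp add: d_def algebra_simps)
          also have "\<dots> = \<i> * lam * of_real (x - t) * (- b i)" unfolding b\<beta> ..
          finally show ?thesis unfolding exp_add[symmetric] by (simp add: algebra_simps)
        qed
        then have ee: "e0 b1 b2 s lam t $ i = \<gamma> i * (?E * exp (d i * of_real (\<beta> i * x - \<beta> i * t)))"
          by (simp only: e0_component \<gamma>_def b_def)
        have kk: "k i i (x, t) = \<gamma> i * of_real (\<beta> i) * S i (x, \<beta> i * x - \<beta> i * t)"
          by (simp add: k_def)
        have "k i i (x, t) * e0 b1 b2 s lam t $ i = (\<gamma> i * \<gamma> i) * ((?E * of_real (\<beta> i)) * ?f (\<beta> i * x - \<beta> i * t))"
          unfolding kk ee by (simp only: mult_ac)
        then show ?thesis by (simp add: \<gamma>2)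
      qed
      have T2: "?T ?j t = (?E * of_real (1 - \<beta> i)) * (indicator {0..x} t *\<^sub>R ?f (\<beta> i * x + (1 - \<beta> i) * t))" for t
      proof -
        have "?E * exp (d i * of_real (\<beta> i * x + (1 - \<beta> i) * t)) = exp (\<i> * b ?j * lam * of_real t)"
        proof -
          have "d i * of_real (\<beta> i * x + (1 - \<beta> i) * t) = (\<i> * lam * of_real x) * ((b (i+1) - b i) * of_real (\<beta> i)) + (\<i> * lam * of_real t) * ((b (i+1) - b i) * of_real (\<beta> (i+1)))"
            unfolding \<beta>1 by (simp add: d_def algebra_simps)
          also have "\<dots> = (\<i> * lam * of_real x) * (- b i) + (\<i> * lam * of_real t) * b (i+1)" unfolding b\<beta> ..
          finally show ?thesis unfolding exp_add[symmetric] by (simp add: algebra_simps)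
        qed
        then have ee: "e0 b1 b2 s lam t $ ?j = \<gamma> ?j * (?E * exp (d i * of_real (\<beta> i * x + (1 - \<beta> i) * t)))"
          by (simp only: e0_component \<gamma>_def b_def)
        have "i \<noteq> ?j" using two_swap(2)[of i] by metis
        then have kk: "k i ?j (x, t) = \<gamma> ?j * of_real (1 - \<beta> i) * S i (x, \<beta> i * x + (1 - \<beta> i) * t)"
          by (simp add: k_def \<beta>1)
        have "k i ?j (x, t) * e0 b1 b2 s lam t $ ?j = (\<gamma> ?j * \<gamma> ?j) * ((?E * of_real (1 - \<beta> i)) * ?f (\<beta> i * x + (1 - \<beta> i) * t))"
          unfolding kk ee by (simp only: mult_ac)
        then show ?thesis by (simp add: \<gamma>2)
      qed
      show "integrable lborel (?T i)" "integrable lborel (?T ?j)"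
        unfolding T1 T2 by (intro integrable_mult_right split)+
      have "?E * u i x = ?E * \<gamma> i + ?E * (LINT y|lborel. indicator {0..x} y *\<^sub>R ?f y)"
        unfolding uz z_def by (simp add: distrib_left)
      also have "?E * (LINT y|lborel. indicator {0..x} y *\<^sub>R ?f y) = (LINT t|lborel. ?T i t) + (LINT t|lborel. ?T ?j t)"
        unfolding split(1) T1 T2 integral_mult_right_zero by (simp add: algebra_simps)
      also have "?E * u i x = e x $ i"
        unfolding u_def by (simp add: mult.assoc[symmetric] exp_add[symmetric])
      also have "?E * \<gamma> i = e0 b1 b2 s lam x $ i" by (simp add: e0_component \<gamma>_def b_def mult_ac)
      finally show "e x $ i = e0 b1 b2 s lam x $ i + ((LINT t|lborel. ?T i t) + (LINT t|lborel. ?T ?j t))" .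
    qed
    have Tint: "integrable lborel (?T i j)" for i j
    proof -
      have "j = i \<or> j = i + 1" using exhaust_2[of i] exhaust_2[of j] by (auto simp: three_eq_one)
      then show ?thesis using key(2,3)[of i] by auto
    qed
    let ?h = "\<lambda>t. indicator {0..x} t *\<^sub>R (K (x, t) *v e0 b1 b2 s lam t)"
    have comp: "?h t $ i = (\<Sum>j\<in>UNIV. ?T i j t)" for t i
      by (simp add: matrix_vector_mult_def K_def scaleR_sum_right)
    have hint: "integrable lborel (\<lambda>t. ?h t $ i)" for i
      unfolding comp by (intro Bochner_Integration.integrable_sum Tint)
    have "triangular_op K (e0 b1 b2 s lam) x = (LINT t|lborel. ?h t)"
      unfolding triangular_op_def set_lebesgue_integral_def
      by (intro integral_completion borel_measurable_integrable integrable_vec hint)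
    then have tri: "triangular_op K (e0 b1 b2 s lam) x $ i = (LINT t|lborel. ?h t $ i)" for i
      using integral_vec_nth[OF hint] by simp
    show ?thesis
    proof (subst vec_eq_iff, intro allI)
      fix i
      have "(LINT t|lborel. ?h t $ i) = (LINT t|lborel. ?T i i t) + (LINT t|lborel. ?T i (i+1) t)"
        unfolding comp sum_two[of _ i] by (rule Bochner_Integration.integral_add[OF Tint Tint])
      then show "e x $ i = (e0 b1 b2 s lam x + triangular_op K (e0 b1 b2 s lam) x) $ i"
        unfolding vector_add_component tri by (simp only: key(1)[of i])
    qed
  qed
  then show ?thesis
    by (intro exI[of _ K]) (auto simp: K_def appr)
qed

section \<open>The spaces $L^p[0,1]$\<close>

abbreviation I01 :: "real measure" where "I01 \<equiv> lebesgue_on {0..1}"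

lemma AE_I01: "(AE x in I01. P x) \<longleftrightarrow> (AE x in lebesgue. x \<in> {0..1} \<longrightarrow> P x)"
  by (simp add: AE_restrict_space_iff)

lemma nn_integral_I01: "(\<integral>\<^sup>+x. f x \<partial>I01) = (\<integral>\<^sup>+x\<in>{0..1}. f x \<partial>lborel)"
  by (simp add: nn_integral_restrict_space nn_integral_completion)

lemma emeasure_I01: "emeasure I01 (space I01) = 1"
  by (simp add: emeasure_restrict_space)

text \<open>Adds the boundary point 0 to convexity on the open half-line: if one argument vanishes,
  the claim reduces to c powr r \<le> c for 0 < c < 1.\<close>

lemma powr_convex_nonneg:
  fixes t u v r :: real
  assumes r: "r \<ge> 1" and t: "0 < t" "t < 1" and uv: "0 \<le> u" "0 \<le> v"
  shows "(t * u + (1 - t) * v) powr r \<le> t * u powr r + (1 - t) * v powr r"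
proof -
  have le: "c powr r \<le> c" if "0 < c" "c < 1" for c :: real
    using powr_mono'[of 1 r c] r that by simp
  consider "u = 0" | "v = 0" | "0 < u" "0 < v" using uv by linarith
  then show ?thesis
  proof cases
    case 1
    then show ?thesis using le[of "1 - t"] t r uv by (simp add: powr_mult mult_right_mono)
  next
    case 2
    then show ?thesis using le[of t] t r uv by (simp add: powr_mult mult_right_mono)
  next
    case 3
    then show ?thesis using convex_onD[OF powr_convex[OF r], of "1 - t" u v] t by (simp add: algebra_simps)
  qed
qed

text \<open>The bound c on the norm with the root removed: for finite p, integrals are estimated
  directly, and the case of infinite p stays pointwise.\<close>

definition Lp_bd :: "ennreal \<Rightarrow> (real \<Rightarrow> 'b::real_normed_vector) \<Rightarrow> real \<Rightarrow> bool" where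
  "Lp_bd p f c \<longleftrightarrow> (if p = \<infinity> then AE x in I01. norm (f x) \<le> c
     else (\<integral>\<^sup>+x. ennreal (norm (f x) powr enn2real p) \<partial>I01) \<le> ennreal (c powr enn2real p))"

lemma enn2real_ge_1: "p \<ge> 1 \<Longrightarrow> p \<noteq> \<infinity> \<Longrightarrow> enn2real p \<ge> 1"
  by (cases p) auto

lemma Lp_norm_le_iff:
  assumes p: "p \<ge> 1" and c: "c \<ge> 0" and [measurable]: "f \<in> borel_measurable I01"
  shows "Lp_norm I01 p f \<le> ennreal c \<longleftrightarrow> Lp_bd p f c"
proof (cases "p = \<infinity>")
  case True
  show ?thesis
  proof
    assume "Lp_norm I01 p f \<le> ennreal c"
    then have "esssup I01 (\<lambda>x. ennreal (norm (f x))) \<le> ennreal c" using True by (simp add: Lp_norm_def)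
    with esssup_AE[of "\<lambda>x. ennreal (norm (f x))" I01]
    have "AE x in I01. ennreal (norm (f x)) \<le> ennreal c"
      by (auto elim!: eventually_mono intro: order.trans)
    then show "Lp_bd p f c" using True c by (simp add: Lp_bd_def)
  next
    assume "Lp_bd p f c"
    then have "AE x in I01. ennreal (norm (f x)) \<le> ennreal c" using True by (auto simp: Lp_bd_def ennreal_leI)
    then show "Lp_norm I01 p f \<le> ennreal c" using True by (simp add: Lp_norm_def esssup_I)
  qed
next
  case False
  define r where "r = enn2real p"
  have r: "r \<ge> 1" using enn2real_ge_1[OF p False] by (simp add: r_def)
  define J where "J = (\<integral>\<^sup>+x. ennreal (norm (f x) powr r) \<partial>I01)"
  have N: "Lp_norm I01 p f = (if J = \<infinity> then \<infinity> else ennreal (enn2real J powr (1 / r)))"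
    using False by (simp add: Lp_norm_def J_def r_def Let_def)
  show ?thesis
  proof (cases J)
    case (real j)
    have "j powr (1 / r) \<le> c \<longleftrightarrow> j \<le> c powr r"
    proof
      assume "j powr (1 / r) \<le> c"
      then have "(j powr (1 / r)) powr r \<le> c powr r" using r by (intro powr_mono2) auto
      then show "j \<le> c powr r" using r real by (simp add: powr_powr)
    next
      assume "j \<le> c powr r"
      then have "j powr (1 / r) \<le> (c powr r) powr (1 / r)" using r real by (intro powr_mono2) auto
      then show "j powr (1 / r) \<le> c" using r c by (simp add: powr_powr)
    qed
    then show ?thesis using False c real N unfolding Lp_bd_def r_def[symmetric] J_def[symmetric] by simp
  next
    case top
    then show ?thesis using False N unfolding Lp_bd_def r_def[symmetric] J_def[symmetric] by (simp add: top_unique)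
  qed
qed

lemma Lp_spaceI: "f \<in> borel_measurable I01 \<Longrightarrow> Lp_norm I01 p f \<le> ennreal c \<Longrightarrow> f \<in> Lp_space I01 p"
  by (auto simp: Lp_space_def intro: le_less_trans)

lemma Lp_spaceD: "f \<in> Lp_space I01 p \<Longrightarrow> f \<in> borel_measurable I01"
  by (simp add: Lp_space_def)

text \<open>Meaningful on \<open>Lp_space\<close> only, because an infinite norm would be sent to
  0.\<close>

definition Lpn :: "ennreal \<Rightarrow> (real \<Rightarrow> 'b::real_normed_vector) \<Rightarrow> real" where
  "Lpn p f = enn2real (Lp_norm I01 p f)"

lemma Lpn_nonneg [simp]: "0 \<le> Lpn p f" by (simp add: Lpn_def)

lemma Lp_norm_eq: "f \<in> Lp_space I01 p \<Longrightarrow> Lp_norm I01 p f = ennreal (Lpn p f)"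
  by (simp add: Lp_space_def Lpn_def)

lemma Lp_bd_Lpn: "p \<ge> 1 \<Longrightarrow> f \<in> Lp_space I01 p \<Longrightarrow> Lp_bd p f (Lpn p f)"
  using Lp_norm_le_iff[of p "Lpn p f" f] by (simp add: Lp_spaceD Lp_norm_eq)

lemma Lp_bd_imp:
  assumes "p \<ge> 1" "c \<ge> 0" "f \<in> borel_measurable I01" "Lp_bd p f c"
  shows "f \<in> Lp_space I01 p" "Lpn p f \<le> c"
proof -
  have "Lp_norm I01 p f \<le> ennreal c" using Lp_norm_le_iff assms by blast
  then show "f \<in> Lp_space I01 p" "Lpn p f \<le> c"
    using assms by (auto intro: Lp_spaceI simp: Lpn_def enn2real_leI)
qed

lemma Lp_bd_mono:
  assumes "p \<ge> 1" "Lp_bd p f c" "0 \<le> c" "0 \<le> s" "AE x in I01. norm (h x) \<le> s * norm (f x)"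
    "f \<in> borel_measurable I01"
  shows "Lp_bd p h (s * c)"
proof (cases "p = \<infinity>")
  case True
  then have "AE x in I01. norm (f x) \<le> c" using assms(2) by (simp add: Lp_bd_def)
  with assms(5) have "AE x in I01. norm (h x) \<le> s * c"
    by eventually_elim (meson assms(4) mult_left_mono order.trans)
  then show ?thesis using True by (simp add: Lp_bd_def)
next
  case False
  define r where "r = enn2real p"
  have r: "r \<ge> 1" using enn2real_ge_1[OF assms(1) False] by (simp add: r_def)
  have "(\<integral>\<^sup>+x. ennreal (norm (h x) powr r) \<partial>I01) \<le> (\<integral>\<^sup>+x. ennreal (s powr r) * ennreal (norm (f x) powr r) \<partial>I01)"
  proof (intro nn_integral_mono_AE)
    show "AE x in I01. ennreal (norm (h x) powr r) \<le> ennreal (s powr r) * ennreal (norm (f x) powr r)"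
      using assms(5)
    proof eventually_elim
      case (elim x)
      then have "norm (h x) powr r \<le> (s * norm (f x)) powr r" using r by (intro powr_mono2) auto
      then show ?case using assms(4) by (simp add: powr_mult ennreal_mult[symmetric] ennreal_leI)
    qed
  qed
  also have "\<dots> = ennreal (s powr r) * (\<integral>\<^sup>+x. ennreal (norm (f x) powr r) \<partial>I01)"
    using assms(6) by (intro nn_integral_cmult) measurable
  also have "\<dots> \<le> ennreal (s powr r) * ennreal (c powr r)"
    using assms(2) False by (intro mult_left_mono) (simp_all add: Lp_bd_def r_def)
  also have "\<dots> = ennreal ((s * c) powr r)"
    using assms by (simp add: powr_mult ennreal_mult)
  finally show ?thesis using False by (simp add: Lp_bd_def r_def)
qed

lemma Lp_mono:
  assumes "p \<ge> 1" "f \<in> Lp_space I01 p" "0 \<le> s" "h \<in> borel_measurable I01" "AE x in I01. norm (h x) \<le> s * norm (f x)"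
  shows "h \<in> Lp_space I01 p" "Lpn p h \<le> s * Lpn p f"
  using Lp_bd_imp[of p "s * Lpn p f" h] Lp_bd_mono[of p f "Lpn p f" s h] Lp_bd_Lpn[of p f] assms
  by (auto simp: Lp_spaceD)

text \<open>Minkowski's inequality from convexity of the power: f + g is (a + b) times the convex
  combination of f / a and g / b with weights a / (a + b) and b / (a + b).\<close>

lemma Lp_bd_add:
  fixes f g :: "real \<Rightarrow> 'b::{real_normed_vector, second_countable_topology}"
  assumes p: "p \<ge> 1" and f: "Lp_bd p f a" "f \<in> borel_measurable I01" and g: "Lp_bd p g b" "g \<in> borel_measurable I01"
    and ab: "0 < a" "0 < b"
  shows "Lp_bd p (\<lambda>x. f x + g x) (a + b)"
proof (cases "p = \<infinity>")
  case True
  have "AE x in I01. norm (f x) \<le> a" "AE x in I01. norm (g x) \<le> b" using f g True by (auto simp: Lp_bd_def)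
  then have "AE x in I01. norm (f x + g x) \<le> a + b" by eventually_elim norm
  then show ?thesis using True by (simp add: Lp_bd_def)
next
  case False
  note [measurable] = f(2) g(2)
  define r where "r = enn2real p"
  have r: "r \<ge> 1" using enn2real_ge_1[OF p False] by (simp add: r_def)
  define t where "t = a / (a + b)"
  have t: "0 < t" "t < 1" "1 - t = b / (a + b)" using ab by (auto simp: t_def field_simps)
  define A B where "A = (a + b) powr r * t / a powr r" and "B = (a + b) powr r * (1 - t) / b powr r"
  have "0 \<le> t" "0 \<le> 1 - t" using t(1,2) by auto
  then have AB: "0 \<le> A" "0 \<le> B" by (auto simp: A_def B_def)
  have Aa: "A * a powr r = (a + b) powr r * t" and Bb: "B * b powr r = (a + b) powr r * (1 - t)"
    using ab by (auto simp: A_def B_def)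
  have pt: "norm (f x + g x) powr r \<le> A * norm (f x) powr r + B * norm (g x) powr r" for x
  proof -
    have "norm (f x + g x) \<le> (a + b) * (t * (norm (f x) / a) + (1 - t) * (norm (g x) / b))"
    proof -
      have "(a + b) * (t * (norm (f x) / a) + (1 - t) * (norm (g x) / b)) = ((a + b) * t) * (norm (f x) / a) + ((a + b) * (1 - t)) * (norm (g x) / b)"
        by (simp only: distrib_left mult.assoc)
      also have "(a + b) * t = a" using ab by (simp add: t_def)
      also have "(a + b) * (1 - t) = b" using ab t(3) by simp
      finally show ?thesis using ab norm_triangle_ineq[of "f x" "g x"] by simp
    qed
    then have "norm (f x + g x) powr r \<le> ((a + b) * (t * (norm (f x) / a) + (1 - t) * (norm (g x) / b))) powr r"
      using r by (intro powr_mono2) auto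
    also have "\<dots> = (a + b) powr r * (t * (norm (f x) / a) + (1 - t) * (norm (g x) / b)) powr r"
      using ab t by (intro powr_mult)
    also have "\<dots> \<le> (a + b) powr r * (t * (norm (f x) / a) powr r + (1 - t) * (norm (g x) / b) powr r)"
      using ab by (intro mult_left_mono powr_convex_nonneg r t) auto
    also have "\<dots> = A * norm (f x) powr r + B * norm (g x) powr r"
      using ab by (simp add: powr_divide distrib_left A_def B_def)
    finally show ?thesis .
  qed
  have "(\<integral>\<^sup>+x. ennreal (norm (f x + g x) powr r) \<partial>I01) \<le>
      (\<integral>\<^sup>+x. ennreal A * ennreal (norm (f x) powr r) + ennreal B * ennreal (norm (g x) powr r) \<partial>I01)"
    using AB by (intro nn_integral_mono) (simp add: ennreal_mult[symmetric] ennreal_plus[symmetric] ennreal_leI pt del: ennreal_plus)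
  also have "\<dots> = ennreal A * (\<integral>\<^sup>+x. ennreal (norm (f x) powr r) \<partial>I01) + ennreal B * (\<integral>\<^sup>+x. ennreal (norm (g x) powr r) \<partial>I01)"
    by (subst nn_integral_add) (auto simp: nn_integral_cmult)
  also have "\<dots> \<le> ennreal A * ennreal (a powr r) + ennreal B * ennreal (b powr r)"
    using f(1) g(1) False by (intro add_mono mult_left_mono) (simp_all add: Lp_bd_def r_def)
  also have "\<dots> = ennreal (A * a powr r + B * b powr r)"
    using AB by (simp add: ennreal_mult[symmetric] ennreal_plus[symmetric] del: ennreal_plus)
  also have "A * a powr r + B * b powr r = (a + b) powr r"
    unfolding Aa Bb by (simp add: algebra_simps)
  finally show ?thesis using False by (simp add: Lp_bd_def r_def)
qed

lemma Lp_add: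
  fixes f g :: "real \<Rightarrow> 'b::{real_normed_vector, second_countable_topology}"
  assumes p: "p \<ge> 1" and f: "f \<in> Lp_space I01 p" and g: "g \<in> Lp_space I01 p"
  shows "(\<lambda>x. f x + g x) \<in> Lp_space I01 p" "Lpn p (\<lambda>x. f x + g x) \<le> Lpn p f + Lpn p g"
proof -
  have m: "f \<in> borel_measurable I01" "g \<in> borel_measurable I01" using f g by (auto simp: Lp_spaceD)
  \<comment> \<open>Adding e makes both bounds positive, as \<open>Lp_bd_add\<close> requires even
    for functions of norm 0; afterwards e tends to 0.\<close>
  have *: "(\<lambda>x. f x + g x) \<in> Lp_space I01 p \<and> Lpn p (\<lambda>x. f x + g x) \<le> (Lpn p f + e) + (Lpn p g + e)" if e: "e > 0" for e
  proof -
    have "Lp_bd p f (Lpn p f + e)" "Lp_bd p g (Lpn p g + e)"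
      using Lp_norm_le_iff[of p "Lpn p f + e" f] Lp_norm_le_iff[of p "Lpn p g + e" g] f g m p e
      by (auto simp: Lp_norm_eq ennreal_leI add_nonneg_nonneg)
    then have "Lp_bd p (\<lambda>x. f x + g x) ((Lpn p f + e) + (Lpn p g + e))"
      using p m e by (intro Lp_bd_add) (auto intro: add_nonneg_pos)
    moreover have "0 \<le> (Lpn p f + e) + (Lpn p g + e)" using e by (simp add: add_nonneg_nonneg)
    ultimately show ?thesis using m p by (intro conjI Lp_bd_imp) auto
  qed
  show "(\<lambda>x. f x + g x) \<in> Lp_space I01 p" using *[of 1] by simp
  show "Lpn p (\<lambda>x. f x + g x) \<le> Lpn p f + Lpn p g"
  proof (rule field_le_epsilon)
    fix e :: real assume "0 < e"
    then show "Lpn p (\<lambda>x. f x + g x) \<le> Lpn p f + Lpn p g + e" using *[of "e/2"] by simp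
  qed
qed

lemma Lp_diff:
  fixes f g :: "real \<Rightarrow> 'b::{real_normed_vector, second_countable_topology}"
  assumes p: "p \<ge> 1" and f: "f \<in> Lp_space I01 p" and g: "g \<in> Lp_space I01 p"
  shows "(\<lambda>x. f x - g x) \<in> Lp_space I01 p" "Lpn p (\<lambda>x. f x - g x) \<le> Lpn p f + Lpn p g"
proof -
  have "(\<lambda>x. - g x) \<in> borel_measurable I01" using Lp_spaceD[OF g] by measurable
  then have n: "(\<lambda>x. - g x) \<in> Lp_space I01 p" "Lpn p (\<lambda>x. - g x) \<le> Lpn p g"
    using Lp_mono[OF p g, of 1 "\<lambda>x. - g x"] by auto
  show "(\<lambda>x. f x - g x) \<in> Lp_space I01 p" "Lpn p (\<lambda>x. f x - g x) \<le> Lpn p f + Lpn p g"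
    using Lp_add[OF p f n(1)] n(2) by auto
qed

lemma Lp_bounded_fun:
  assumes p: "p \<ge> 1" and m: "f \<in> borel_measurable I01" and c: "c \<ge> 0" and le: "AE x in I01. norm (f x) \<le> c"
  shows "f \<in> Lp_space I01 p" "Lpn p f \<le> c"
proof -
  have "Lp_bd p f c"
  proof (cases "p = \<infinity>")
    case False
    define r where "r = enn2real p"
    have r: "r \<ge> 1" using enn2real_ge_1[OF p False] by (simp add: r_def)
    have "(\<integral>\<^sup>+x. ennreal (norm (f x) powr r) \<partial>I01) \<le> (\<integral>\<^sup>+x. ennreal (c powr r) \<partial>I01)"
      using le r by (intro nn_integral_mono_AE) (auto elim!: eventually_mono intro!: ennreal_leI powr_mono2)
    also have "\<dots> = ennreal (c powr r)" using emeasure_I01 by simp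
    finally show ?thesis using False by (simp add: Lp_bd_def r_def)
  qed (use le in \<open>simp add: Lp_bd_def\<close>)
  then show "f \<in> Lp_space I01 p" "Lpn p f \<le> c" using Lp_bd_imp[OF p c m] by auto
qed

text \<open>Replaces Young's inequality at the cost of a factor two.\<close>
lemma le_powr_plus:
  fixes y c r :: real
  assumes "0 \<le> y" "0 < c" "1 \<le> r"
  shows "y \<le> c powr (1 - r) * y powr r + c"
proof (cases "y \<le> c")
  case True
  then show ?thesis using assms by (simp add: add_increasing)
next
  case False
  then have "c powr (r - 1) \<le> y powr (r - 1)" using assms by (intro powr_mono2) auto
  then have "c powr (1 - r) * c powr (r - 1) * y \<le> c powr (1 - r) * y powr (r - 1) * y"
    using assms by (intro mult_right_mono mult_left_mono) auto
  moreover have "c powr (1 - r) * c powr (r - 1) = 1" using assms by (simp add: powr_add[symmetric])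
  moreover have "y powr (r - 1) * y = y powr r" using False assms by (simp add: powr_diff)
  ultimately show ?thesis using assms by (simp add: mult.assoc)
qed

text \<open>With c in \<open>le_powr_plus\<close> a bound of the norm, each of the two terms
  integrates to at most c over the unit interval. The bound has to be positive, hence the norm plus
  1 in later uses.\<close>

lemma Lp_imp_L1:
  assumes p: "p \<ge> 1" and f: "f \<in> Lp_space I01 p" and c: "Lpn p f \<le> c" "0 < c"
  shows "(\<integral>\<^sup>+x. ennreal (norm (f x)) \<partial>I01) \<le> ennreal (2 * c)"
proof (cases "p = \<infinity>")
  case True
  have "AE x in I01. norm (f x) \<le> Lpn p f" using Lp_bd_Lpn[OF p f] True by (simp add: Lp_bd_def)
  then have "(\<integral>\<^sup>+x. ennreal (norm (f x)) \<partial>I01) \<le> (\<integral>\<^sup>+x. ennreal (2 * c) \<partial>I01)"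
    by (intro nn_integral_mono_AE) (use c in \<open>auto elim!: eventually_mono intro!: ennreal_leI\<close>)
  then show ?thesis using emeasure_I01 by simp
next
  case False
  note [measurable] = Lp_spaceD[OF f]
  define r where "r = enn2real p"
  have r: "r \<ge> 1" using enn2real_ge_1[OF p False] by (simp add: r_def)
  have "(\<integral>\<^sup>+x. ennreal (norm (f x)) \<partial>I01) \<le> (\<integral>\<^sup>+x. ennreal (c powr (1 - r)) * ennreal (norm (f x) powr r) + ennreal c \<partial>I01)"
    using le_powr_plus[OF norm_ge_zero c(2) r] c
    by (intro nn_integral_mono) (simp add: ennreal_mult[symmetric] ennreal_plus[symmetric] ennreal_leI del: ennreal_plus)
  also have "\<dots> = ennreal (c powr (1 - r)) * (\<integral>\<^sup>+x. ennreal (norm (f x) powr r) \<partial>I01) + ennreal c"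
    using emeasure_I01 by (subst nn_integral_add) (auto simp: nn_integral_cmult)
  also have "\<dots> \<le> ennreal (c powr (1 - r)) * ennreal (c powr r) + ennreal c"
  proof (intro add_right_mono mult_left_mono)
    have "(\<integral>\<^sup>+x. ennreal (norm (f x) powr r) \<partial>I01) \<le> ennreal (Lpn p f powr r)"
      using Lp_bd_Lpn[OF p f] False by (simp add: Lp_bd_def r_def)
    also have "\<dots> \<le> ennreal (c powr r)" using c r by (intro ennreal_leI powr_mono2) auto
    finally show "(\<integral>\<^sup>+x. ennreal (norm (f x) powr r) \<partial>I01) \<le> ennreal (c powr r)" .
  qed simp
  also have "\<dots> = ennreal (2 * c)"
    using c by (simp add: ennreal_mult[symmetric] powr_add[symmetric] ennreal_plus[symmetric] del: ennreal_plus)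
  finally show ?thesis .
qed

text \<open>Schur's test. For each x the inequality y \<le> c powr (1 - r) * y powr r + c, taken at
  y = norm (f t), is integrated against k (x, _) and c is optimised for that x; the integration over
  x then uses the bound \<open>k2\<close>. Doing without Hoelder's inequality costs the factor
  2.\<close>

lemma Lp_Schur:
  fixes f :: "real \<Rightarrow> 'b::real_normed_vector" and h :: "real \<Rightarrow> 'c::real_normed_vector"
  assumes p: "p \<ge> 1" and k[measurable]: "k \<in> borel_measurable (borel \<Otimes>\<^sub>M borel)" and e: "e > 0"
    and k1: "\<And>x. x \<in> {0..1} \<Longrightarrow> (\<integral>\<^sup>+t\<in>{0..1}. k (x, t) \<partial>lborel) \<le> ennreal e"
    and k2: "\<And>t. t \<in> {0..1} \<Longrightarrow> (\<integral>\<^sup>+x\<in>{0..1}. k (x, t) \<partial>lborel) \<le> ennreal e"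
    and f: "f \<in> Lp_space I01 p" and h: "h \<in> borel_measurable I01"
    and le: "AE x in I01. ennreal (norm (h x)) \<le> (\<integral>\<^sup>+t\<in>{0..1}. k (x, t) * ennreal (norm (f t)) \<partial>lborel)"
  shows "h \<in> Lp_space I01 p" "Lpn p h \<le> 2 * e * Lpn p f"
proof -
  have "Lp_bd p h (2 * e * Lpn p f)"
  proof (cases "p = \<infinity>")
    case True
    have "AE x in I01. norm (f x) \<le> Lpn p f" using Lp_bd_Lpn[OF p f] True by (simp add: Lp_bd_def)
    then have ae: "AE x in lborel. x \<in> {0..1} \<longrightarrow> norm (f x) \<le> Lpn p f" by (simp only: AE_I01 AE_completion_iff)
    from le AE_space have "AE x in I01. norm (h x) \<le> 2 * e * Lpn p f"
    proof eventually_elim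
      case (elim x)
      then have x: "x \<in> {0..1}" by simp
      have "ennreal (norm (h x)) \<le> (\<integral>\<^sup>+t. ennreal (Lpn p f) * (k (x, t) * indicator {0..1} t) \<partial>lborel)"
      proof (rule order.trans[OF elim(1)], rule nn_integral_mono_AE)
        show "AE t in lborel. k (x, t) * ennreal (norm (f t)) * indicator {0..1} t \<le> ennreal (Lpn p f) * (k (x, t) * indicator {0..1} t)"
          using ae
        proof eventually_elim
          case (elim t)
          show ?case
          proof (cases "t \<in> {0..1}")
            case True
            then have "ennreal (norm (f t)) \<le> ennreal (Lpn p f)" using elim by (intro ennreal_leI) auto
            from mult_right_mono[OF this, of "k (x, t)"] show ?thesis using True by (simp add: mult.commute)
          qed simp
        qed
      qed
      also have "\<dots> = ennreal (Lpn p f) * (\<integral>\<^sup>+t\<in>{0..1}. k (x, t) \<partial>lborel)" by (rule nn_integral_cmult) measurable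
      also have "\<dots> \<le> ennreal (Lpn p f) * ennreal e" by (intro mult_left_mono k1 x) simp
      also have "\<dots> = ennreal (e * Lpn p f)" using e by (simp add: ennreal_mult[symmetric] mult.commute)
      finally have "norm (h x) \<le> e * Lpn p f" using e by (simp add: ennreal_le_iff)
      also have "\<dots> \<le> 2 * e * Lpn p f" using e by (simp add: mult_right_mono)
      finally show ?case .
    qed
    then show ?thesis using True by (simp add: Lp_bd_def)
  next
    case False
    define r where "r = enn2real p"
    have r: "r \<ge> 1" using enn2real_ge_1[OF p False] by (simp add: r_def)
    \<comment> \<open>Tonelli's theorem needs a Borel function of two variables, so the modulus of f
      is replaced by a Borel function that agrees with it almost everywhere.\<close>
    have "(\<lambda>t. indicator {0..1} t *\<^sub>R norm (f t)) \<in> borel_measurable lebesgue"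
      using Lp_spaceD[OF f] by (subst borel_measurable_restrict_space_iff[symmetric]) auto
    from completion_ex_borel_measurable_real[OF this] obtain F0 where F0: "F0 \<in> borel_measurable lborel"
      "AE t in lborel. indicator {0..1} t *\<^sub>R norm (f t) = F0 t" by blast
    define F where "F t = \<bar>F0 t\<bar>" for t
    have [measurable]: "F \<in> borel_measurable borel" using F0(1) unfolding F_def by simp
    have F: "AE t in lborel. t \<in> {0..1} \<longrightarrow> F t = norm (f t)"
      using F0(2) by eventually_elim (auto simp: F_def dest: sym)
    have F0: "F t \<ge> 0" for t by (simp add: F_def)
    define J where "J x = (\<integral>\<^sup>+t\<in>{0..1}. k (x, t) * ennreal (F t powr r) \<partial>lborel)" for x
    have key: "AE x in I01. ennreal (norm (h x) powr r) \<le> ennreal (2 powr r * e powr (r - 1)) * J x"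
      using le AE_space
    proof eventually_elim
      case (elim x)
      then have x: "x \<in> {0..1}" by simp
      have h1: "ennreal (norm (h x)) \<le> (\<integral>\<^sup>+t\<in>{0..1}. k (x, t) * ennreal (F t) \<partial>lborel)"
        by (rule order.trans[OF elim(1)], rule nn_integral_mono_AE)
          (use F in \<open>auto elim!: eventually_mono simp: indicator_def\<close>)
      show ?case
      proof (cases "J x")
        case (real j)
        have step: "norm (h x) \<le> c powr (1 - r) * j + c * e" if c: "c > 0" for c
        proof -
          have "(\<integral>\<^sup>+t\<in>{0..1}. k (x, t) * ennreal (F t) \<partial>lborel) \<le>
            (\<integral>\<^sup>+t. ennreal (c powr (1 - r)) * (k (x, t) * ennreal (F t powr r) * indicator {0..1} t) + ennreal c * (k (x, t) * indicator {0..1} t) \<partial>lborel)"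
          proof (intro nn_integral_mono)
            fix t
            have "ennreal (F t) \<le> ennreal (c powr (1 - r)) * ennreal (F t powr r) + ennreal c"
              using le_powr_plus[OF F0[of t] c r] c
              by (simp add: ennreal_mult[symmetric] ennreal_plus[symmetric] ennreal_leI del: ennreal_plus)
            from mult_left_mono[OF this, of "k (x, t) * indicator {0..1} t"]
            show "k (x, t) * ennreal (F t) * indicator {0..1} t \<le> ennreal (c powr (1 - r)) * (k (x, t) * ennreal (F t powr r) * indicator {0..1} t) + ennreal c * (k (x, t) * indicator {0..1} t)"
              by (simp add: distrib_left mult_ac)
          qed
          also have "\<dots> = ennreal (c powr (1 - r)) * J x + ennreal c * (\<integral>\<^sup>+t\<in>{0..1}. k (x, t) \<partial>lborel)"
            unfolding J_def by (subst nn_integral_add) (auto simp: nn_integral_cmult)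
          also have "\<dots> \<le> ennreal (c powr (1 - r)) * ennreal j + ennreal c * ennreal e"
            using real by (intro add_mono mult_left_mono k1 x) auto
          also have "\<dots> = ennreal (c powr (1 - r) * j + c * e)"
            using c e real by (simp add: ennreal_mult[symmetric] ennreal_plus[symmetric] del: ennreal_plus)
          finally have "ennreal (norm (h x)) \<le> ennreal (c powr (1 - r) * j + c * e)" using h1 by (rule order.trans[rotated])
          then show ?thesis using c e real by (subst (asm) ennreal_le_iff) auto
        qed
        have "norm (h x) powr r \<le> 2 powr r * e powr (r - 1) * j"
        proof (cases "j = 0")
          case True
          \<comment> \<open>No c is optimal when j vanishes, but c may be taken arbitrarily
            small.\<close>
          have "norm (h x) \<le> 0 + d" if "d > 0" for d
            using step[of "d / e"] that e True by simp
          then have "norm (h x) \<le> 0" by (rule field_le_epsilon)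
          then show ?thesis using True by simp
        next
          case False
          then have j: "j > 0" using real by simp
          \<comment> \<open>Balances the two terms of \<open>step\<close>: both become c *
            e.\<close>
          define c where "c = (j / e) powr (1 / r)"
          have c: "c > 0" using j e by (simp add: c_def)
          have cr: "c powr r = j / e" using r j e by (simp add: c_def powr_powr)
          have "c powr (1 - r) * j = c * e"
            using c cr e j by (simp add: powr_diff)
          then have "norm (h x) \<le> 2 * (c * e)" using step[OF c] by simp
          then have "norm (h x) powr r \<le> (2 * (c * e)) powr r" using r by (intro powr_mono2) auto
          also have "\<dots> = 2 powr r * (c powr r * e powr r)" using c e by (simp add: powr_mult)
          also have "\<dots> = 2 powr r * e powr (r - 1) * j" unfolding cr using e by (simp add: powr_diff)
          finally show ?thesis .
        qed
        then show ?thesis using real e by (simp add: ennreal_mult[symmetric] ennreal_leI)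
      next
        case top
        then show ?thesis using e by (simp add: ennreal_mult_top)
      qed
    qed
    have "(\<integral>\<^sup>+x. ennreal (norm (h x) powr r) \<partial>I01) \<le> (\<integral>\<^sup>+x. ennreal (2 powr r * e powr (r - 1)) * J x \<partial>I01)"
      by (rule nn_integral_mono_AE[OF key])
    also have "\<dots> = (\<integral>\<^sup>+x. ennreal (2 powr r * e powr (r - 1)) * (J x * indicator {0..1} x) \<partial>lborel)"
      unfolding nn_integral_I01 by (simp add: mult.assoc)
    also have "\<dots> = ennreal (2 powr r * e powr (r - 1)) * (\<integral>\<^sup>+x. J x * indicator {0..1} x \<partial>lborel)"
      unfolding J_def by (rule nn_integral_cmult) measurable
    also have "(\<integral>\<^sup>+x. J x * indicator {0..1} x \<partial>lborel) = (\<integral>\<^sup>+x. \<integral>\<^sup>+t. k (x, t) * ennreal (F t powr r) * indicator {0..1} t * indicator {0..1} x \<partial>lborel \<partial>lborel)"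
      unfolding J_def by (simp add: nn_integral_multc)
    also have "\<dots> = (\<integral>\<^sup>+t. \<integral>\<^sup>+x. k (x, t) * ennreal (F t powr r) * indicator {0..1} t * indicator {0..1} x \<partial>lborel \<partial>lborel)"
      by (rule lborel_pair.Fubini') measurable
    also have "\<dots> = (\<integral>\<^sup>+t. (ennreal (F t powr r) * indicator {0..1} t) * (\<integral>\<^sup>+x. k (x, t) * indicator {0..1} x \<partial>lborel) \<partial>lborel)"
      by (subst nn_integral_cmult[symmetric]) (auto intro!: nn_integral_cong simp: mult_ac)
    also have "\<dots> \<le> (\<integral>\<^sup>+t. (ennreal (F t powr r) * indicator {0..1} t) * ennreal e \<partial>lborel)"
    proof (intro nn_integral_mono)
      fix t
      show "(ennreal (F t powr r) * indicator {0..1} t) * (\<integral>\<^sup>+x. k (x, t) * indicator {0..1} x \<partial>lborel) \<le> (ennreal (F t powr r) * indicator {0..1} t) * ennreal e"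
        using k2[of t] by (cases "t \<in> {0..1}") (auto intro: mult_left_mono)
    qed
    also have "\<dots> = (\<integral>\<^sup>+t\<in>{0..1}. ennreal (F t powr r) \<partial>lborel) * ennreal e"
      by (rule nn_integral_multc) measurable
    also have "(\<integral>\<^sup>+t\<in>{0..1}. ennreal (F t powr r) \<partial>lborel) = (\<integral>\<^sup>+t. ennreal (norm (f t) powr r) \<partial>I01)"
      unfolding nn_integral_I01 by (intro nn_integral_cong_AE) (use F in \<open>auto elim!: eventually_mono simp: indicator_def\<close>)
    also have "\<dots> \<le> ennreal (Lpn p f powr r)"
      using Lp_bd_Lpn[OF p f] False by (simp add: Lp_bd_def r_def)
    finally have "(\<integral>\<^sup>+x. ennreal (norm (h x) powr r) \<partial>I01) \<le> ennreal (2 powr r * e powr (r - 1)) * (ennreal (Lpn p f powr r) * ennreal e)"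
      by (simp add: mult_left_mono mult_right_mono)
    also have "\<dots> = ennreal ((2 * e * Lpn p f) powr r)"
      using e by (simp add: ennreal_mult[symmetric] powr_mult powr_diff)
    finally show ?thesis using False by (simp add: Lp_bd_def r_def)
  qed
  then show "h \<in> Lp_space I01 p" "Lpn p h \<le> 2 * e * Lpn p f"
    using Lp_bd_imp[OF p _ h, of "2 * e * Lpn p f"] e by auto
qed

section \<open>Fatou's lemma and completeness\<close>

lemma Lp_Fatou:
  fixes u :: "nat \<Rightarrow> real \<Rightarrow> 'b::{real_normed_vector, second_countable_topology}"
  assumes p: "p \<ge> 1" and u: "\<And>n. u n \<in> Lp_space I01 p" "\<And>n. Lpn p (u n) \<le> c" and g: "g \<in> borel_measurable I01"
    and lim: "AE x in I01. (\<lambda>n. u n x) \<longlonglongrightarrow> g x"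
  shows "g \<in> Lp_space I01 p" "Lpn p g \<le> c"
proof -
  have c: "c \<ge> 0" using u(2)[of 0] Lpn_nonneg order.trans by blast
  note [measurable] = Lp_spaceD[OF u(1)]
  have bd: "Lp_bd p (u n) c" for n
    using Lp_norm_le_iff[OF p c, of "u n"] u by (simp add: Lp_norm_eq Lp_spaceD ennreal_leI)
  have "Lp_bd p g c"
  proof (cases "p = \<infinity>")
    case True
    have "AE x in I01. \<forall>n. norm (u n x) \<le> c" using bd True by (simp add: AE_all_countable Lp_bd_def)
    with lim have "AE x in I01. norm (g x) \<le> c"
      by eventually_elim (auto intro: LIMSEQ_le_const2 tendsto_norm)
    then show ?thesis using True by (simp add: Lp_bd_def)
  next
    case False
    define r where "r = enn2real p"
    have r: "r \<ge> 1" using enn2real_ge_1[OF p False] by (simp add: r_def)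
    have "(\<integral>\<^sup>+x. ennreal (norm (g x) powr r) \<partial>I01) \<le> (\<integral>\<^sup>+x. liminf (\<lambda>n. ennreal (norm (u n x) powr r)) \<partial>I01)"
    proof (rule nn_integral_mono_AE)
      show "AE x in I01. ennreal (norm (g x) powr r) \<le> liminf (\<lambda>n. ennreal (norm (u n x) powr r))"
        using lim
      proof eventually_elim
        case (elim x)
        have "(\<lambda>n. ennreal (norm (u n x) powr r)) \<longlonglongrightarrow> ennreal (norm (g x) powr r)"
          using r by (intro tendsto_ennrealI tendsto_powr2 tendsto_norm elim tendsto_const) auto
        from lim_imp_Liminf[OF sequentially_bot this] show ?case by simp
      qed
    qed
    also have "\<dots> \<le> liminf (\<lambda>n. \<integral>\<^sup>+x. ennreal (norm (u n x) powr r) \<partial>I01)"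
      by (rule nn_integral_liminf) measurable
    also have "\<dots> \<le> ennreal (c powr r)"
      by (rule Liminf_le) (use bd False in \<open>auto simp: Lp_bd_def r_def\<close>)
    finally show ?thesis using False by (simp add: Lp_bd_def r_def)
  qed
  then show "g \<in> Lp_space I01 p" "Lpn p g \<le> c" using Lp_bd_imp[OF p c g] by auto
qed

lemma Lpn_0_iff:
  assumes p: "p \<ge> 1" and f: "f \<in> Lp_space I01 p" and z: "Lpn p f \<le> 0"
  shows "AE x in I01. f x = 0"
proof -
  note [measurable] = Lp_spaceD[OF f]
  have "(\<integral>\<^sup>+x. ennreal (norm (f x)) \<partial>I01) \<le> 0"
  proof (rule ennreal_le_epsilon)
    fix e :: real assume "0 < e"
    then show "(\<integral>\<^sup>+x. ennreal (norm (f x)) \<partial>I01) \<le> 0 + ennreal e"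
      using Lp_imp_L1[OF p f, of "e/2"] z by simp
  qed
  then have "(\<integral>\<^sup>+x. ennreal (norm (f x)) \<partial>I01) = 0" by simp
  then have "AE x in I01. ennreal (norm (f x)) = 0" by (subst (asm) nn_integral_0_iff_AE) auto
  then show ?thesis by simp
qed

text \<open>On the unit interval a Cauchy sequence in L^p is Cauchy in L^1, so a subsequence
  converges almost everywhere, and Fatou's lemma bounds the distance to its limit. The argument is
  the same for finite and infinite p.\<close>

lemma Lp_complete:
  fixes u :: "nat \<Rightarrow> real \<Rightarrow> 'b::{banach, second_countable_topology}"
  assumes p: "p \<ge> 1" and u: "\<And>n. u n \<in> Lp_space I01 p"
    and cauchy: "\<And>e. e > 0 \<Longrightarrow> \<exists>N. \<forall>m\<ge>N. \<forall>n\<ge>N. Lpn p (\<lambda>x. u m x - u n x) \<le> e"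
  obtains g where "g \<in> Lp_space I01 p" "\<And>e. e > 0 \<Longrightarrow> \<exists>N. \<forall>n\<ge>N. Lpn p (\<lambda>x. u n x - g x) \<le> e"
proof -
  note um[measurable] = Lp_spaceD[OF u]
  have L1: "(\<integral>\<^sup>+x. ennreal (norm (f x)) \<partial>I01) < \<infinity>" if "f \<in> Lp_space I01 p" for f :: "real \<Rightarrow> 'b"
    using Lp_imp_L1[OF p that, of "Lpn p f + 1"] by (auto intro: le_less_trans simp: add_nonneg_pos)
  have int: "integrable I01 f" if "f \<in> Lp_space I01 p" for f :: "real \<Rightarrow> 'b"
    using L1[OF that] Lp_spaceD[OF that] by (intro integrableI_bounded)
  have "\<exists>N. \<forall>i\<ge>N. \<forall>j\<ge>N. (LINT x|I01. norm (u i x - u j x)) < e" if e: "e > 0" for e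
  proof -
    obtain N where N: "\<forall>m\<ge>N. \<forall>n\<ge>N. Lpn p (\<lambda>x. u m x - u n x) \<le> e / 4" using cauchy[of "e/4"] e by auto
    show ?thesis
    proof (intro exI allI impI)
      fix i j assume ij: "i \<ge> N" "j \<ge> N"
      have d: "(\<lambda>x. u i x - u j x) \<in> Lp_space I01 p" by (rule Lp_diff[OF p u u])
      have "ennreal (LINT x|I01. norm (u i x - u j x)) = (\<integral>\<^sup>+x. ennreal (norm (u i x - u j x)) \<partial>I01)"
        by (rule nn_integral_eq_integral[symmetric]) (use int[OF d] in auto)
      also have "\<dots> \<le> ennreal (2 * (e / 4))"
        using N ij e by (intro Lp_imp_L1[OF p d]) auto
      finally have "(LINT x|I01. norm (u i x - u j x)) \<le> 2 * (e / 4)" using e by (subst (asm) ennreal_le_iff) auto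
      then show "(LINT x|I01. norm (u i x - u j x)) < e" using e by simp
    qed
  qed
  note ex = this
  obtain r where r: "strict_mono r" "AE x in I01. Cauchy (\<lambda>i. u (r i) x)"
    using cauchy_L1_AE_cauchy_subseq[of I01 u, OF int[OF u] ex] .
  define g where "g x = lim (\<lambda>i. u (r i) x)" for x
  have [measurable]: "g \<in> borel_measurable I01" unfolding g_def by measurable
  have lim: "AE x in I01. (\<lambda>i. u (r i) x) \<longlonglongrightarrow> g x"
    using r(2) by eventually_elim (simp add: g_def Cauchy_convergent_iff convergent_LIMSEQ_iff)
  have close: "(\<lambda>x. u n x - g x) \<in> Lp_space I01 p \<and> Lpn p (\<lambda>x. u n x - g x) \<le> e"
    if N: "\<forall>m\<ge>N. \<forall>n\<ge>N. Lpn p (\<lambda>x. u m x - u n x) \<le> e" and n: "n \<ge> N" for N n e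
  proof -
    have lim': "AE x in I01. (\<lambda>i. u n x - u (r (i + N)) x) \<longlonglongrightarrow> u n x - g x"
      using lim by eventually_elim (intro tendsto_intros LIMSEQ_ignore_initial_segment)
    have "r (i + N) \<ge> N" for i using seq_suble[OF r(1), of "i + N"] by simp
    then have "Lpn p (\<lambda>x. u n x - u (r (i + N)) x) \<le> e" for i using N n by blast
    from Lp_Fatou[OF p Lp_diff(1)[OF p u u] this _ lim'] show ?thesis by simp
  qed
  obtain N where N: "\<forall>m\<ge>N. \<forall>n\<ge>N. Lpn p (\<lambda>x. u m x - u n x) \<le> 1" using cauchy[of 1] by auto
  have "(\<lambda>x. u N x - (u N x - g x)) \<in> Lp_space I01 p"
    by (rule Lp_diff(1)[OF p u]) (use close[OF N order.refl] in simp)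
  then have "g \<in> Lp_space I01 p" by simp
  then show ?thesis
  proof (rule that)
    fix e :: real assume "0 < e"
    then obtain N where N: "\<forall>m\<ge>N. \<forall>n\<ge>N. Lpn p (\<lambda>x. u m x - u n x) \<le> e" using cauchy[of e] by auto
    have "Lpn p (\<lambda>x. u n x - g x) \<le> e" if "n \<ge> N" for n using close[OF N that] by simp
    then show "\<exists>N. \<forall>n\<ge>N. Lpn p (\<lambda>x. u n x - g x) \<le> e" by auto
  qed
qed

section \<open>Triangular operators in $L^p$\<close>

lemma borel_representative_vec:
  fixes f :: "real \<Rightarrow> 'b::euclidean_space"
  assumes f: "f \<in> borel_measurable I01"
  obtains f' where "f' \<in> borel_measurable borel" "AE t in lborel. t \<in> {0..1} \<longrightarrow> f t = f' t"
proof -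
  let ?f = "\<lambda>t. indicator {0..1} t *\<^sub>R f t"
  have fm: "?f \<in> borel_measurable lebesgue"
    using f by (subst borel_measurable_restrict_space_iff[symmetric]) auto
  have "\<forall>b. \<exists>h. h \<in> borel_measurable lborel \<and> (AE t in lborel. ?f t \<bullet> b = h t)"
  proof
    fix b :: 'b
    have "(\<lambda>t. ?f t \<bullet> b) \<in> borel_measurable lebesgue" using fm by measurable
    from completion_ex_borel_measurable_real[OF this]
    show "\<exists>h. h \<in> borel_measurable lborel \<and> (AE t in lborel. ?f t \<bullet> b = h t)" by blast
  qed
  from choice[OF this] obtain h where h: "\<forall>b. h b \<in> borel_measurable lborel \<and> (AE t in lborel. ?f t \<bullet> b = h b t)" ..
  define f' where "f' t = (\<Sum>b\<in>Basis. h b t *\<^sub>R b)" for t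
  have [measurable]: "h b \<in> borel_measurable borel" for b using h by simp
  have "AE t in lborel. \<forall>b\<in>Basis. ?f t \<bullet> b = h b t"
    using h by (intro AE_finite_allI) auto
  then have "AE t in lborel. t \<in> {0..1} \<longrightarrow> f t = f' t"
  proof eventually_elim
    case (elim t)
    show ?case
    proof
      assume "t \<in> {0..1}"
      then have "f t = ?f t" by simp
      also have "\<dots> = (\<Sum>b\<in>Basis. (?f t \<bullet> b) *\<^sub>R b)" by (rule euclidean_representation[symmetric])
      also have "\<dots> = f' t" unfolding f'_def using elim by (intro sum.cong) auto
      finally show "f t = f' t" .
    qed
  qed
  moreover have "f' \<in> borel_measurable borel" unfolding f'_def by measurable
  ultimately show ?thesis using that by blast
qed

lemma norm_smult_vec: "norm (c *s (v :: complex^'n)) = norm c * norm v"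
  unfolding norm_vec_def vector_smult_component norm_mult by (rule L2_set_right_distrib[symmetric]) simp

lemma integrand_measurable:
  fixes H :: "real \<times> real \<Rightarrow> complex^2^2"
  assumes H: "H \<in> borel_measurable (borel \<Otimes>\<^sub>M borel)" and f: "f \<in> borel_measurable I01" and x: "x \<in> {0..1}"
  shows "(\<lambda>t. indicator {0..x} t *\<^sub>R (H (x, t) *v f t)) \<in> borel_measurable lebesgue"
proof -
  have Fm: "(\<lambda>t. indicator {0..1} t *\<^sub>R f t) \<in> borel_measurable lebesgue"
    using f by (subst borel_measurable_restrict_space_iff[symmetric]) auto
  note H[measurable]
  have "(\<lambda>t. H (x, t)) \<in> borel_measurable borel" by measurable
  then have Hm: "(\<lambda>t. H (x, t)) \<in> borel_measurable lebesgue" by (intro measurable_completion) simp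
  have eq: "indicator {0..x} t *\<^sub>R (H (x, t) *v f t) = indicator {0..x} t *\<^sub>R (H (x, t) *v (indicator {0..1} t *\<^sub>R f t))" for t
    using x by (auto simp: indicator_def)
  show ?thesis unfolding eq
    by (rule borel_measurable_scaleR[OF borel_measurable_indicator measurable_matrix_vector[OF Hm Fm]]) simp
qed

lemma triangular_op_cong:
  fixes H :: "real \<times> real \<Rightarrow> complex^2^2"
  assumes H: "H \<in> borel_measurable (borel \<Otimes>\<^sub>M borel)" and f: "f \<in> borel_measurable I01" and g: "g \<in> borel_measurable I01"
    and ae: "AE t in lborel. t \<in> {0..1} \<longrightarrow> f t = g t" and x: "x \<in> {0..1}"
  shows "triangular_op H f x = triangular_op H g x"
  unfolding triangular_op_def set_lebesgue_integral_def
proof (rule integral_cong_AE)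
  show "AE t in lebesgue. indicator {0..x} t *\<^sub>R (H (x, t) *v f t) = indicator {0..x} t *\<^sub>R (H (x, t) *v g t)"
    using AE_completion[OF ae] by eventually_elim (use x in \<open>auto simp: indicator_def\<close>)
qed (intro integrand_measurable H f g x)+

text \<open>Measurability of a parameter integral requires a jointly measurable integrand, so f is
  exchanged for a Borel representative; by \<open>triangular_op_cong\<close> this changes the value
  at no x of the interval.\<close>

lemma triangular_op_measurable:
  fixes H :: "real \<times> real \<Rightarrow> complex^2^2"
  assumes H[measurable]: "H \<in> borel_measurable (borel \<Otimes>\<^sub>M borel)" and f: "f \<in> borel_measurable I01"
  shows "triangular_op H f \<in> borel_measurable I01"
proof -
  obtain f' where f'[measurable]: "f' \<in> borel_measurable borel" and ae: "AE t in lborel. t \<in> {0..1} \<longrightarrow> f t = f' t"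
    using borel_representative_vec[OF f] .
  have f'I: "f' \<in> borel_measurable I01" by (rule borel_imp_lebesgue_on) measurable
  define F where "F x = (LINT t|lborel. (if 0 \<le> t \<and> t \<le> x then 1 else 0 :: real) *\<^sub>R (H (x, t) *v f' t))" for x
  have "F \<in> borel_measurable borel" unfolding F_def by measurable
  then have "F \<in> borel_measurable I01" by (rule borel_imp_lebesgue_on)
  moreover have "triangular_op H f x = F x" if x: "x \<in> {0..1}" for x
  proof -
    have "triangular_op H f x = triangular_op H f' x" by (rule triangular_op_cong[OF H f f'I ae x])
    also have "\<dots> = (LINT t|lborel. indicator {0..x} t *\<^sub>R (H (x, t) *v f' t))"
      unfolding triangular_op_def set_lebesgue_integral_def by (rule integral_completion) measurable
    also have "\<dots> = F x" unfolding F_def by (intro Bochner_Integration.integral_cong) (auto simp: indicator_def)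
    finally show ?thesis .
  qed
  ultimately show ?thesis by (subst measurable_cong[where g=F]) auto
qed

lemma norm_triangular_op_le:
  "ennreal (norm (triangular_op H f x)) \<le> (\<integral>\<^sup>+t\<in>{0..x}. ennreal (4 * norm (H (x, t))) * ennreal (norm (f t)) \<partial>lborel)"
proof -
  have "ennreal (norm (triangular_op H f x)) \<le> (\<integral>\<^sup>+t. ennreal (norm (indicator {0..x} t *\<^sub>R (H (x, t) *v f t))) \<partial>lborel)"
    unfolding triangular_op_def set_lebesgue_integral_def nn_integral_completion[symmetric, of lborel]
    by (rule ennreal_norm_integral_le)
  also have "\<dots> \<le> (\<integral>\<^sup>+t\<in>{0..x}. ennreal (4 * norm (H (x, t))) * ennreal (norm (f t)) \<partial>lborel)"
  proof (intro nn_integral_mono)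
    fix t
    show "ennreal (norm (indicator {0..x} t *\<^sub>R (H (x, t) *v f t))) \<le> ennreal (4 * norm (H (x, t))) * ennreal (norm (f t)) * indicator {0..x} t"
      using norm_matrix_vector_le[of "H (x, t)" "f t"]
      by (auto simp: indicator_def ennreal_mult[symmetric] intro!: ennreal_leI)
  qed
  finally show ?thesis .
qed

section \<open>Exponential weights\<close>

definition weighted :: "real \<Rightarrow> (real \<Rightarrow> complex^2) \<Rightarrow> real \<Rightarrow> complex^2" where
  "weighted w f x = exp (- w * x) *\<^sub>R f x"

text \<open>Conjugating the operator by \<open>weighted w\<close> multiplies its kernel by exp(- w *
  (x - t)). For w = 0 the definition is the plain bound on all sections.\<close>

definition kernel_small :: "real \<Rightarrow> real \<Rightarrow> (real \<times> real \<Rightarrow> complex^2^2) \<Rightarrow> bool" where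
  "kernel_small w e H \<longleftrightarrow>
    (\<forall>x\<in>{0..1}. (\<integral>\<^sup>+t\<in>{0..x}. ennreal (norm (H (x, t)) * exp (- w * (x - t))) \<partial>lborel) \<le> ennreal e) \<and>
    (\<forall>t\<in>{0..1}. (\<integral>\<^sup>+x\<in>{t..1}. ennreal (norm (H (x, t)) * exp (- w * (x - t))) \<partial>lborel) \<le> ennreal e)"

lemma weighted_measurable: "f \<in> borel_measurable I01 \<Longrightarrow> weighted w f \<in> borel_measurable I01"
  unfolding weighted_def by (rule borel_measurable_scaleR[OF borel_imp_lebesgue_on]) (measurable, assumption)

lemma weighted_Lp:
  assumes p: "p \<ge> 1" and w: "w \<ge> 0" and f: "f \<in> Lp_space I01 p"
  shows "weighted w f \<in> Lp_space I01 p" "Lpn p (weighted w f) \<le> Lpn p f" "Lpn p f \<le> exp w * Lpn p (weighted w f)"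
proof -
  note fm = Lp_spaceD[OF f]
  have "AE x in I01. norm (weighted w f x) \<le> 1 * norm (f x)"
    using AE_space by eventually_elim (use w in \<open>auto simp: weighted_def intro!: mult_left_le_one_le\<close>)
  from Lp_mono[OF p f _ weighted_measurable[OF fm] this]
  show l: "weighted w f \<in> Lp_space I01 p" and "Lpn p (weighted w f) \<le> Lpn p f" by simp_all
  have "AE x in I01. norm (f x) \<le> exp w * norm (weighted w f x)"
    using AE_space
  proof eventually_elim
    case (elim x)
    then have "w * x \<le> w" using w by (simp add: mult_left_le)
    then have "1 * norm (f x) \<le> exp (w - w * x) * norm (f x)" by (intro mult_right_mono) auto
    then show ?case by (simp add: weighted_def exp_diff exp_minus divide_inverse mult_ac)
  qed
  from Lp_mono(2)[OF p l _ fm this] show "Lpn p f \<le> exp w * Lpn p (weighted w f)" by simp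
qed

text \<open>Schur's test for the conjugated kernel. The constant 8 is the 4 of
  \<open>norm_matrix_vector_le\<close> times the 2 of \<open>Lp_Schur\<close>.\<close>

lemma triangular_op_Lp_weighted:
  fixes H :: "real \<times> real \<Rightarrow> complex^2^2"
  assumes p: "p \<ge> 1" and H[measurable]: "H \<in> borel_measurable (borel \<Otimes>\<^sub>M borel)" and e: "e > 0"
    and small: "kernel_small w e H" and f: "f \<in> Lp_space I01 p" and w: "w \<ge> 0"
  shows "weighted w (triangular_op H f) \<in> Lp_space I01 p"
    "Lpn p (weighted w (triangular_op H f)) \<le> 8 * e * Lpn p (weighted w f)"
proof -
  define k where "k z = ennreal 4 * (ennreal (norm (H z) * exp (- w * (fst z - snd z))) * (if 0 \<le> snd z \<and> snd z \<le> fst z then 1 else 0))" for z :: "real \<times> real"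
  have km: "k \<in> borel_measurable (borel \<Otimes>\<^sub>M borel)" unfolding k_def by measurable
  have k1: "(\<integral>\<^sup>+t\<in>{0..1}. k (x, t) \<partial>lborel) \<le> ennreal (4 * e)" if x: "x \<in> {0..1}" for x
  proof -
    have "(\<integral>\<^sup>+t\<in>{0..1}. k (x, t) \<partial>lborel) = (\<integral>\<^sup>+t. ennreal 4 * (ennreal (norm (H (x, t)) * exp (- w * (x - t))) * indicator {0..x} t) \<partial>lborel)"
      by (intro nn_integral_cong) (use x in \<open>auto simp: k_def indicator_def\<close>)
    also have "\<dots> = ennreal 4 * (\<integral>\<^sup>+t\<in>{0..x}. ennreal (norm (H (x, t)) * exp (- w * (x - t))) \<partial>lborel)"
      by (rule nn_integral_cmult) measurable
    also have "\<dots> \<le> ennreal 4 * ennreal e" using small x unfolding kernel_small_def by (intro mult_left_mono) auto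
    finally show ?thesis using e by (simp add: ennreal_mult)
  qed
  have k2: "(\<integral>\<^sup>+x\<in>{0..1}. k (x, t) \<partial>lborel) \<le> ennreal (4 * e)" if t: "t \<in> {0..1}" for t
  proof -
    have "(\<integral>\<^sup>+x\<in>{0..1}. k (x, t) \<partial>lborel) = (\<integral>\<^sup>+x. ennreal 4 * (ennreal (norm (H (x, t)) * exp (- w * (x - t))) * indicator {t..1} x) \<partial>lborel)"
      by (intro nn_integral_cong) (use t in \<open>auto simp: k_def indicator_def\<close>)
    also have "\<dots> = ennreal 4 * (\<integral>\<^sup>+x\<in>{t..1}. ennreal (norm (H (x, t)) * exp (- w * (x - t))) \<partial>lborel)"
      by (rule nn_integral_cmult) measurable
    also have "\<dots> \<le> ennreal 4 * ennreal e" using small t unfolding kernel_small_def by (intro mult_left_mono) auto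
    finally show ?thesis using e by (simp add: ennreal_mult)
  qed
  have le: "AE x in I01. ennreal (norm (weighted w (triangular_op H f) x)) \<le> (\<integral>\<^sup>+t\<in>{0..1}. k (x, t) * ennreal (norm (weighted w f t)) \<partial>lborel)"
    using AE_space
  proof eventually_elim
    case (elim x)
    then have x: "x \<in> {0..1}" by simp
    obtain f' where f'[measurable]: "f' \<in> borel_measurable borel" and ae: "AE t in lborel. t \<in> {0..1} \<longrightarrow> f t = f' t"
      using borel_representative_vec[OF Lp_spaceD[OF f]] .
    have "(\<integral>\<^sup>+t\<in>{0..x}. ennreal (4 * norm (H (x, t))) * ennreal (norm (f t)) \<partial>lborel) = (\<integral>\<^sup>+t\<in>{0..x}. ennreal (4 * norm (H (x, t))) * ennreal (norm (f' t)) \<partial>lborel)"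
      by (rule nn_integral_cong_AE) (use ae x in \<open>auto elim!: eventually_mono simp: indicator_def\<close>)
    then have "ennreal (norm (triangular_op H f x)) \<le> (\<integral>\<^sup>+t\<in>{0..x}. ennreal (4 * norm (H (x, t))) * ennreal (norm (f' t)) \<partial>lborel)"
      using norm_triangular_op_le[of H f x] by simp
    then have "ennreal (norm (weighted w (triangular_op H f) x)) \<le> ennreal (exp (- w * x)) * (\<integral>\<^sup>+t\<in>{0..x}. ennreal (4 * norm (H (x, t))) * ennreal (norm (f' t)) \<partial>lborel)"
      unfolding weighted_def by (simp add: ennreal_mult mult_left_mono)
    also have "\<dots> = (\<integral>\<^sup>+t. ennreal (exp (- w * x)) * (ennreal (4 * norm (H (x, t))) * ennreal (norm (f' t)) * indicator {0..x} t) \<partial>lborel)"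
      by (rule nn_integral_cmult[symmetric]) measurable
    also have "\<dots> = (\<integral>\<^sup>+t\<in>{0..1}. k (x, t) * ennreal (norm (weighted w f t)) \<partial>lborel)"
    proof (rule nn_integral_cong_AE)
      show "AE t in lborel. ennreal (exp (- w * x)) * (ennreal (4 * norm (H (x, t))) * ennreal (norm (f' t)) * indicator {0..x} t) =
        k (x, t) * ennreal (norm (weighted w f t)) * indicator {0..1} t"
        using ae
      proof eventually_elim
        case (elim t)
        show ?case
        proof (cases "t \<in> {0..x}")
          case True
          then have ft: "f t = f' t" using elim x by auto
          have "exp (- w * (x - t)) * exp (- w * t) = exp (- w * x)" by (simp add: exp_add[symmetric] algebra_simps)
          then have "exp (- w * x) * (4 * norm (H (x, t)) * norm (f' t)) = 4 * (norm (H (x, t)) * exp (- w * (x - t))) * (exp (- w * t) * norm (f' t))"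
            by (simp add: mult_ac)
          then have "ennreal (exp (- w * x) * (4 * norm (H (x, t)) * norm (f' t))) = ennreal (4 * (norm (H (x, t)) * exp (- w * (x - t))) * (exp (- w * t) * norm (f' t)))"
            by (rule arg_cong)
          then show ?thesis using True x ft
            by (simp add: k_def weighted_def ennreal_mult mult.assoc)
        next
          case False
          then show ?thesis using x by (auto simp: k_def indicator_def)
        qed
      qed
    qed
    finally show ?case .
  qed
  have hm: "weighted w (triangular_op H f) \<in> borel_measurable I01"
    by (intro weighted_measurable triangular_op_measurable H Lp_spaceD[OF f])
  from Lp_Schur[OF p km _ k1 k2 weighted_Lp(1)[OF p w f] hm le] e
  show "weighted w (triangular_op H f) \<in> Lp_space I01 p"
    "Lpn p (weighted w (triangular_op H f)) \<le> 8 * e * Lpn p (weighted w f)"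
    by simp_all
qed

lemma triangular_op_Lp:
  fixes H :: "real \<times> real \<Rightarrow> complex^2^2"
  assumes p: "p \<ge> 1" and H: "H \<in> borel_measurable (borel \<Otimes>\<^sub>M borel)" and e: "e > 0"
    and close: "kernel_small 0 e H" and f: "f \<in> Lp_space I01 p"
  shows "triangular_op H f \<in> Lp_space I01 p" "Lpn p (triangular_op H f) \<le> 8 * e * Lpn p f"
proof -
  have "weighted 0 g = g" for g by (simp add: weighted_def fun_eq_iff)
  then show "triangular_op H f \<in> Lp_space I01 p" "Lpn p (triangular_op H f) \<le> 8 * e * Lpn p f"
    using triangular_op_Lp_weighted[OF p H e close f, of] by simp_all
qed

text \<open>The integral of a non-integrable function is 0 by convention, which could destroy
  additivity in f. By Tonelli this can happen only for a null set of x, and operators on L^p are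
  compared almost everywhere.\<close>

lemma triangular_integrable_AE:
  fixes H :: "real \<times> real \<Rightarrow> complex^2^2"
  assumes H[measurable]: "H \<in> borel_measurable (borel \<Otimes>\<^sub>M borel)" and e: "e \<ge> 0"
    and small: "kernel_small 0 e H" and p: "p \<ge> 1" and f: "f \<in> Lp_space I01 p"
  shows "AE x in I01. set_integrable lebesgue {0..x} (\<lambda>t. H (x, t) *v f t)"
proof -
  obtain f' where f'[measurable]: "f' \<in> borel_measurable borel" and ae: "AE t in lborel. t \<in> {0..1} \<longrightarrow> f t = f' t"
    using borel_representative_vec[OF Lp_spaceD[OF f]] .
  define J where "J x = (\<integral>\<^sup>+t. (ennreal (norm (H (x, t))) * ennreal (norm (f' t))) * (if 0 \<le> t \<and> t \<le> x then 1 else 0) \<partial>lborel)" for x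
  have [measurable]: "J \<in> borel_measurable borel" unfolding J_def by measurable
  have "(\<integral>\<^sup>+x\<in>{0..1}. J x \<partial>lborel) = (\<integral>\<^sup>+x. \<integral>\<^sup>+t. (ennreal (norm (H (x, t))) * ennreal (norm (f' t))) * (if 0 \<le> t \<and> t \<le> x then 1 else 0) * indicator {0..1} x \<partial>lborel \<partial>lborel)"
    unfolding J_def by (simp add: nn_integral_multc)
  also have "\<dots> = (\<integral>\<^sup>+t. \<integral>\<^sup>+x. (ennreal (norm (H (x, t))) * ennreal (norm (f' t))) * (if 0 \<le> t \<and> t \<le> x then 1 else 0) * indicator {0..1} x \<partial>lborel \<partial>lborel)"
    by (rule lborel_pair.Fubini') measurable
  also have "\<dots> = (\<integral>\<^sup>+t. \<integral>\<^sup>+x. (ennreal (norm (f' t)) * indicator {0..1} t) * (ennreal (norm (H (x, t))) * indicator {t..1} x) \<partial>lborel \<partial>lborel)"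
    by (intro nn_integral_cong) (auto simp: indicator_def mult_ac)
  also have "\<dots> = (\<integral>\<^sup>+t. (ennreal (norm (f' t)) * indicator {0..1} t) * (\<integral>\<^sup>+x. ennreal (norm (H (x, t))) * indicator {t..1} x \<partial>lborel) \<partial>lborel)"
    by (simp add: nn_integral_cmult)
  also have "\<dots> \<le> (\<integral>\<^sup>+t. (ennreal (norm (f' t)) * indicator {0..1} t) * ennreal e \<partial>lborel)"
  proof (intro nn_integral_mono)
    fix t
    show "(ennreal (norm (f' t)) * indicator {0..1} t) * (\<integral>\<^sup>+x. ennreal (norm (H (x, t))) * indicator {t..1} x \<partial>lborel) \<le> (ennreal (norm (f' t)) * indicator {0..1} t) * ennreal e"
      using small unfolding kernel_small_def by (cases "t \<in> {0..1}") (auto intro!: mult_left_mono)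
  qed
  also have "\<dots> = (\<integral>\<^sup>+t\<in>{0..1}. ennreal (norm (f' t)) \<partial>lborel) * ennreal e"
    by (rule nn_integral_multc) measurable
  also have "(\<integral>\<^sup>+t\<in>{0..1}. ennreal (norm (f' t)) \<partial>lborel) = (\<integral>\<^sup>+t. ennreal (norm (f t)) \<partial>I01)"
    unfolding nn_integral_I01 by (rule nn_integral_cong_AE) (use ae in \<open>auto elim!: eventually_mono simp: indicator_def\<close>)
  also have "\<dots> * ennreal e < \<infinity>"
  proof -
    have "(\<integral>\<^sup>+t. ennreal (norm (f t)) \<partial>I01) \<le> ennreal (2 * (Lpn p f + 1))"
      by (rule Lp_imp_L1[OF p f]) (simp_all add: add_nonneg_pos)
    then have "(\<integral>\<^sup>+t. ennreal (norm (f t)) \<partial>I01) < \<infinity>" by (rule le_less_trans) simp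
    then show ?thesis by (simp add: ennreal_mult_less_top)
  qed
  finally have "(\<integral>\<^sup>+x\<in>{0..1}. J x \<partial>lborel) \<noteq> \<infinity>" by simp
  then have "AE x in lborel. J x * indicator {0..1} x \<noteq> \<infinity>" by (intro nn_integral_PInf_AE) auto
  then have "AE x in lborel. x \<in> {0..1} \<longrightarrow> J x < \<infinity>" by eventually_elim (auto simp: less_top)
  then have "AE x in I01. J x < \<infinity>" by (simp only: AE_I01 AE_completion_iff)
  with AE_space show ?thesis
  proof eventually_elim
    case (elim x)
    then have x: "x \<in> {0..1}" by simp
    show ?case
      unfolding set_integrable_def
    proof (rule integrableI_bounded)
      show "(\<lambda>t. indicator {0..x} t *\<^sub>R (H (x, t) *v f t)) \<in> borel_measurable lebesgue"
        by (rule integrand_measurable[OF H Lp_spaceD[OF f] x])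
      have "(\<integral>\<^sup>+t. ennreal (norm (indicator {0..x} t *\<^sub>R (H (x, t) *v f t))) \<partial>lebesgue) \<le>
        (\<integral>\<^sup>+t. ennreal 4 * ((ennreal (norm (H (x, t))) * ennreal (norm (f' t))) * (if 0 \<le> t \<and> t \<le> x then 1 else 0)) \<partial>lborel)"
        unfolding nn_integral_completion
      proof (rule nn_integral_mono_AE)
        show "AE t in lborel. ennreal (norm (indicator {0..x} t *\<^sub>R (H (x, t) *v f t))) \<le> ennreal 4 * ((ennreal (norm (H (x, t))) * ennreal (norm (f' t))) * (if 0 \<le> t \<and> t \<le> x then 1 else 0))"
          using ae
        proof eventually_elim
          case (elim t)
          show ?case
          proof (cases "0 \<le> t \<and> t \<le> x")
            case True
            then have "f t = f' t" using elim x by auto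
            have "ennreal (norm (H (x, t) *v f t)) \<le> ennreal (4 * (norm (H (x, t)) * norm (f t)))"
              using norm_matrix_vector_le[of "H (x, t)" "f t"] by (intro ennreal_leI) simp
            then show ?thesis using True \<open>f t = f' t\<close> by (simp add: ennreal_mult)
          qed (auto simp: indicator_def)
        qed
      qed
      also have "\<dots> = ennreal 4 * J x" unfolding J_def by (rule nn_integral_cmult) measurable
      also have "\<dots> < \<infinity>" using elim by (simp add: ennreal_mult_less_top)
      finally show "(\<integral>\<^sup>+t. ennreal (norm (indicator {0..x} t *\<^sub>R (H (x, t) *v f t))) \<partial>lebesgue) < \<infinity>" .
    qed
  qed
qed

lemma nn_integral_exp_section:
  fixes w x t :: real
  assumes w: "w > 0"
  shows "x \<in> {0..1} \<Longrightarrow> (\<integral>\<^sup>+t\<in>{0..x}. ennreal (exp (- w * (x - t))) \<partial>lborel) \<le> ennreal (1 / w)"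
    and "t \<in> {0..1} \<Longrightarrow> (\<integral>\<^sup>+x\<in>{t..1}. ennreal (exp (- w * (x - t))) \<partial>lborel) \<le> ennreal (1 / w)"
proof -
  assume x: "x \<in> {0..1}"
  have "(\<integral>\<^sup>+t\<in>{0..x}. ennreal (exp (- w * (x - t))) \<partial>lborel) = ennreal (exp (- w * (x - x)) / w - exp (- w * (x - 0)) / w)"
    using w x by (intro nn_integral_FTC_Icc) (auto intro!: derivative_eq_intros)
  also have "\<dots> \<le> ennreal (1 / w)" using w by (intro ennreal_leI) simp
  finally show "(\<integral>\<^sup>+t\<in>{0..x}. ennreal (exp (- w * (x - t))) \<partial>lborel) \<le> ennreal (1 / w)" .
next
  assume t: "t \<in> {0..1}"
  have "(\<integral>\<^sup>+x\<in>{t..1}. ennreal (exp (- w * (x - t))) \<partial>lborel) = ennreal (- exp (- w * (1 - t)) / w - - exp (- w * (t - t)) / w)"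
    using w t by (intro nn_integral_FTC_Icc) (auto intro!: derivative_eq_intros)
  also have "\<dots> \<le> ennreal (1 / w)" using w by (intro ennreal_leI) simp
  finally show "(\<integral>\<^sup>+x\<in>{t..1}. ennreal (exp (- w * (x - t))) \<partial>lborel) \<le> ennreal (1 / w)" .
qed

text \<open>The kernel is a part that is small without any weight plus a bounded part, and the
  exponential weight reduces the latter to the order 1 / w.\<close>

lemma kernel_small_weight_exists:
  fixes K :: "real \<times> real \<Rightarrow> complex^2^2"
  assumes K: "approximable_kernel K" and e: "e > 0"
  obtains w where "w > 0" "kernel_small w e K"
proof -
  note Km[measurable] = approximable_kernelD(1)[OF K]
  obtain g where g: "continuous_on UNIV g" "bounded (range g)" "kernel_close (e/2) K g"
    using approximable_kernelD(2)[OF K, of "e/2"] e by auto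
  note [measurable] = continuous_pair_measurable[OF g(1)]
  obtain B0 where B0: "\<And>z. norm (g z) \<le> B0" using g(2) unfolding bounded_iff by blast
  define B where "B = B0 + 1"
  have B: "norm (g z) \<le> B" "B > 0" for z
    using B0[of z] order.trans[OF norm_ge_zero B0[of z]] by (auto simp: B_def)
  \<comment> \<open>The bounded part contributes B / w = e / 2, which leaves e / 2 for the error of
    the approximation.\<close>
  define w where "w = 2 * B / e"
  have w: "w > 0" "B * (1 / w) = e / 2" using B(2) e by (auto simp: w_def)
  have pt: "ennreal (norm (K (x, t)) * exp (- w * (x - t))) \<le> ennreal (norm (K (x, t) - g (x, t))) + ennreal B * ennreal (exp (- w * (x - t)))" if "t \<le> x" for x t
  proof -
    have "w * (x - t) \<ge> 0" using w that by simp
    then have E: "exp (- w * (x - t)) \<le> 1" by simp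
    have "norm (K (x, t)) \<le> norm (K (x, t) - g (x, t)) + norm (g (x, t))" by (metis norm_triangle_sub add.commute)
    then have "norm (K (x, t)) * exp (- w * (x - t)) \<le> (norm (K (x, t) - g (x, t)) + norm (g (x, t))) * exp (- w * (x - t))"
      by (intro mult_right_mono) auto
    also have "\<dots> \<le> norm (K (x, t) - g (x, t)) * 1 + B * exp (- w * (x - t))"
      unfolding distrib_right using E B by (intro add_mono mult_left_mono mult_right_mono) auto
    finally show ?thesis using B(2)
      by (simp add: ennreal_mult[symmetric] ennreal_plus[symmetric] ennreal_leI del: ennreal_plus)
  qed
  have "ennreal B * ennreal (1 / w) = ennreal (B * (1 / w))"
    by (rule ennreal_mult[symmetric]) (use B(2) w(1) in auto)
  then have half: "ennreal (e/2) + ennreal B * ennreal (1 / w) = ennreal e"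
    unfolding w(2) using e by (simp add: ennreal_plus[symmetric] del: ennreal_plus ennreal_divide_numeral)
  have "kernel_small w e K"
    unfolding kernel_small_def
  proof (intro conjI ballI)
    fix x :: real assume x: "x \<in> {0..1}"
    have "(\<integral>\<^sup>+t\<in>{0..x}. ennreal (norm (K (x, t)) * exp (- w * (x - t))) \<partial>lborel) \<le>
      (\<integral>\<^sup>+t. ennreal (norm (K (x, t) - g (x, t))) * indicator {0..x} t + ennreal B * (ennreal (exp (- w * (x - t))) * indicator {0..x} t) \<partial>lborel)"
      by (intro nn_integral_mono) (use pt in \<open>auto simp: indicator_def\<close>)
    also have "\<dots> = (\<integral>\<^sup>+t\<in>{0..x}. ennreal (norm (K (x, t) - g (x, t))) \<partial>lborel) + ennreal B * (\<integral>\<^sup>+t\<in>{0..x}. ennreal (exp (- w * (x - t))) \<partial>lborel)"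
      by (subst nn_integral_add) (auto simp: nn_integral_cmult)
    also have "\<dots> \<le> ennreal (e/2) + ennreal B * ennreal (1 / w)"
      using g(3) x unfolding kernel_close_def by (intro add_mono mult_left_mono nn_integral_exp_section w x) auto
    finally show "(\<integral>\<^sup>+t\<in>{0..x}. ennreal (norm (K (x, t)) * exp (- w * (x - t))) \<partial>lborel) \<le> ennreal e" unfolding half .
  next
    fix t :: real assume t: "t \<in> {0..1}"
    have "(\<integral>\<^sup>+x\<in>{t..1}. ennreal (norm (K (x, t)) * exp (- w * (x - t))) \<partial>lborel) \<le>
      (\<integral>\<^sup>+x. ennreal (norm (K (x, t) - g (x, t))) * indicator {t..1} x + ennreal B * (ennreal (exp (- w * (x - t))) * indicator {t..1} x) \<partial>lborel)"
      by (intro nn_integral_mono) (use pt in \<open>auto simp: indicator_def\<close>)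
    also have "\<dots> = (\<integral>\<^sup>+x\<in>{t..1}. ennreal (norm (K (x, t) - g (x, t))) \<partial>lborel) + ennreal B * (\<integral>\<^sup>+x\<in>{t..1}. ennreal (exp (- w * (x - t))) \<partial>lborel)"
      by (subst nn_integral_add) (auto simp: nn_integral_cmult)
    also have "\<dots> \<le> ennreal (e/2) + ennreal B * ennreal (1 / w)"
      using g(3) t unfolding kernel_close_def by (intro add_mono mult_left_mono nn_integral_exp_section w t) auto
    finally show "(\<integral>\<^sup>+x\<in>{t..1}. ennreal (norm (K (x, t)) * exp (- w * (x - t))) \<partial>lborel) \<le> ennreal e" unfolding half .
  qed
  then show ?thesis using that w by blast
qed

lemma triangular_op_add_AE:
  fixes H :: "real \<times> real \<Rightarrow> complex^2^2"
  assumes H: "H \<in> borel_measurable (borel \<Otimes>\<^sub>M borel)" and e: "e \<ge> 0" "kernel_small 0 e H" and p: "p \<ge> 1"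
    and f: "f \<in> Lp_space I01 p" and g: "g \<in> Lp_space I01 p"
  shows "AE x in I01. triangular_op H (\<lambda>z. f z + g z) x = triangular_op H f x + triangular_op H g x"
    and "AE x in I01. triangular_op H (\<lambda>z. f z - g z) x = triangular_op H f x - triangular_op H g x"
    and "AE x in I01. triangular_op H (\<lambda>z. c *s f z) x = c *s triangular_op H f x"
proof -
  note i = triangular_integrable_AE[OF H e p f] triangular_integrable_AE[OF H e p g]
  show "AE x in I01. triangular_op H (\<lambda>z. f z + g z) x = triangular_op H f x + triangular_op H g x"
    using i by eventually_elim (simp add: triangular_op_def matrix_vector_right_distrib set_integral_add)
  show "AE x in I01. triangular_op H (\<lambda>z. f z - g z) x = triangular_op H f x - triangular_op H g x"
    using i by eventually_elim (simp add: triangular_op_def matrix_vector_mult_diff_distrib set_integral_diff)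
  have bl: "bounded_linear (\<lambda>v::complex^2. c *s v)"
    by (rule bounded_linear_intro[of _ "norm c"]) (simp_all add: vec_eq_iff distrib_left norm_smult_vec mult.commute)
  show "AE x in I01. triangular_op H (\<lambda>z. c *s f z) x = c *s triangular_op H f x"
    using i(1)
  proof eventually_elim
    case (elim x)
    have "triangular_op H (\<lambda>z. c *s f z) x = (LINT t|lebesgue. c *s (indicator {0..x} t *\<^sub>R (H (x, t) *v f t)))"
      unfolding triangular_op_def set_lebesgue_integral_def
      by (intro Bochner_Integration.integral_cong refl) (simp add: vec_eq_iff matrix_vector_mult_def sum_distrib_left mult_ac)
    also have "\<dots> = c *s triangular_op H f x"
      unfolding triangular_op_def set_lebesgue_integral_def
      using elim unfolding set_integrable_def by (rule integral_bounded_linear[OF bl])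
    finally show ?case .
  qed
qed

lemma triangular_op_diff_kernel_AE:
  fixes H G :: "real \<times> real \<Rightarrow> complex^2^2"
  assumes H: "H \<in> borel_measurable (borel \<Otimes>\<^sub>M borel)" "e \<ge> 0" "kernel_small 0 e H"
    and G: "G \<in> borel_measurable (borel \<Otimes>\<^sub>M borel)" "e' \<ge> 0" "kernel_small 0 e' G"
    and p: "p \<ge> 1" and f: "f \<in> Lp_space I01 p"
  shows "AE x in I01. triangular_op (\<lambda>z. H z - G z) f x = triangular_op H f x - triangular_op G f x"
  using triangular_integrable_AE[OF H p f] triangular_integrable_AE[OF G p f]
  by eventually_elim (simp add: triangular_op_def matrix_vector_mult_diff_rdistrib set_integral_diff)

lemma approximable_kernel_small:
  fixes K :: "real \<times> real \<Rightarrow> complex^2^2"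
  assumes "approximable_kernel K"
  obtains C where "C > 0" "kernel_small 0 C K"
proof -
  obtain C where C: "C \<ge> 0" "\<forall>x\<in>{0..1}. (\<integral>\<^sup>+t\<in>{0..x}. ennreal (norm (K (x, t))) \<partial>lborel) \<le> ennreal C"
    "\<forall>t\<in>{0..1}. (\<integral>\<^sup>+x\<in>{t..1}. ennreal (norm (K (x, t))) \<partial>lborel) \<le> ennreal C"
    using approximable_kernel_bounds[OF assms] .
  have "ennreal C \<le> ennreal (C + 1)" by (intro ennreal_leI) simp
  then have "kernel_small 0 (C + 1) K"
    unfolding kernel_small_def using C by (auto intro: order.trans)
  then show ?thesis using that[of "C + 1"] C by auto
qed

lemma triangular_op_linear:
  assumes K: "approximable_kernel K" and p: "p \<ge> 1"
  shows "Lp_linear_op I01 p (triangular_op K)"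
proof -
  note Km = approximable_kernelD(1)[OF K]
  obtain C where C: "C > 0" "kernel_small 0 C K" using approximable_kernel_small[OF K] .
  show ?thesis
    unfolding Lp_linear_op_def
  proof (intro conjI ballI allI impI)
    fix f g :: "real \<Rightarrow> complex^2" assume f: "f \<in> Lp_space I01 p" and g: "g \<in> Lp_space I01 p" and eq: "AE x in I01. f x = g x"
    have "AE t in lborel. t \<in> {0..1} \<longrightarrow> f t = g t" using eq by (simp only: AE_I01 AE_completion_iff)
    then have "triangular_op K f x = triangular_op K g x" if "x \<in> {0..1}" for x
      using that by (rule triangular_op_cong[OF Km Lp_spaceD[OF f] Lp_spaceD[OF g]])
    then show "AE x in I01. triangular_op K f x = triangular_op K g x" by (intro AE_I2) simp
  next
    fix f :: "real \<Rightarrow> complex^2" assume "f \<in> Lp_space I01 p"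
    then show "triangular_op K f \<in> Lp_space I01 p" by (rule triangular_op_Lp(1)[OF p Km C])
  next
    fix f g :: "real \<Rightarrow> complex^2" assume "f \<in> Lp_space I01 p" "g \<in> Lp_space I01 p"
    then show "AE x in I01. triangular_op K (\<lambda>z. f z + g z) x = triangular_op K f x + triangular_op K g x"
      by (rule triangular_op_add_AE(1)[OF Km less_imp_le[OF C(1)] C(2) p])
  next
    fix c and f :: "real \<Rightarrow> complex^2" assume f: "f \<in> Lp_space I01 p"
    show "AE x in I01. triangular_op K (\<lambda>z. c *s f z) x = c *s triangular_op K f x"
      by (rule triangular_op_add_AE(3)[OF Km less_imp_le[OF C(1)] C(2) p f f])
  qed
qed

lemma Lpn_AE_eq:
  assumes p: "p \<ge> 1" and f: "f \<in> Lp_space I01 p" and g: "g \<in> borel_measurable I01" and eq: "AE x in I01. g x = f x"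
  shows "g \<in> Lp_space I01 p" "Lpn p g = Lpn p f"
proof -
  have gf: "AE x in I01. norm (g x) \<le> 1 * norm (f x)" and fg: "AE x in I01. norm (f x) \<le> 1 * norm (g x)"
    using eq by (eventually_elim, simp)+
  show l: "g \<in> Lp_space I01 p" by (rule Lp_mono(1)[OF p f _ g gf]) simp
  show "Lpn p g = Lpn p f"
    using Lp_mono(2)[OF p f _ g gf] Lp_mono(2)[OF p l _ Lp_spaceD[OF f] fg] by simp
qed

lemma Lp_smult:
  assumes p: "p \<ge> 1" and f: "f \<in> Lp_space I01 p"
  shows "(\<lambda>x. c *s (f x :: complex^'n)) \<in> Lp_space I01 p" "Lpn p (\<lambda>x. c *s f x) \<le> norm c * Lpn p f"
proof -
  have bl: "bounded_linear (\<lambda>v::complex^'n. c *s v)"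
    by (rule bounded_linear_intro[of _ "norm c"]) (simp_all add: vec_eq_iff distrib_left norm_smult_vec mult.commute)
  have m: "(\<lambda>x. c *s f x) \<in> borel_measurable I01"
    by (rule measurable_compose[OF Lp_spaceD[OF f]]) (intro borel_measurable_continuous_onI linear_continuous_on bl)
  have "AE x in I01. norm (c *s f x) \<le> norm c * norm (f x)" by (simp add: norm_smult_vec)
  from Lp_mono[OF p f norm_ge_zero m this]
  show "(\<lambda>x. c *s f x) \<in> Lp_space I01 p" "Lpn p (\<lambda>x. c *s f x) \<le> norm c * Lpn p f" .
qed

section \<open>The resolvent\<close>

lemma weighted_add: "weighted w (\<lambda>x. f x + g x) = (\<lambda>x. weighted w f x + weighted w g x)"
  by (simp add: weighted_def fun_eq_iff scaleR_add_right)

lemma weighted_smult: "weighted w (\<lambda>x. c *s f x) = (\<lambda>x. c *s weighted w f x)"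
  by (simp add: weighted_def fun_eq_iff vec_eq_iff)

text \<open>The Volterra property enters through an exponential weight in which
  \<open>\<mu>\<^sup>-\<^sup>1 T\<close> is a contraction.\<close>
locale volterra_resolvent =
  fixes K :: "real \<times> real \<Rightarrow> complex^2^2" and p :: ennreal and \<mu> :: complex
  assumes K: "approximable_kernel K" and p: "p \<ge> 1" and \<mu>: "\<mu> \<noteq> 0"
begin

definition A :: "(real \<Rightarrow> complex^2) \<Rightarrow> real \<Rightarrow> complex^2" where
  "A f x = (1 / \<mu>) *s triangular_op K f x"

text \<open>\<open>triangular_op_Lp_weighted\<close> loses a factor 8, so the sixteenth part of
  |\<mu>| makes \<open>A\<close> a contraction with constant 1/2.\<close>

definition wt :: real where "wt = (SOME w. w > 0 \<and> kernel_small w (norm \<mu> / 16) K)"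

lemma wt: "wt > 0" "kernel_small wt (norm \<mu> / 16) K"
proof -
  have "norm \<mu> / 16 > 0" using \<mu> by simp
  from kernel_small_weight_exists[OF K this] have "\<exists>w. w > 0 \<and> kernel_small w (norm \<mu> / 16) K" by blast
  from someI_ex[OF this] show "wt > 0" "kernel_small wt (norm \<mu> / 16) K" unfolding wt_def by auto
qed

lemma Km: "K \<in> borel_measurable (borel \<Otimes>\<^sub>M borel)" by (rule approximable_kernelD(1)[OF K])

lemma A_Lp: "f \<in> Lp_space I01 p \<Longrightarrow> A f \<in> Lp_space I01 p"
  unfolding A_def[abs_def] using triangular_op_linear[OF K p] by (intro Lp_smult p) (simp add: Lp_linear_op_def)

lemma A_diff:
  assumes f: "f \<in> Lp_space I01 p" and g: "g \<in> Lp_space I01 p"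
  shows "AE x in I01. A (\<lambda>z. f z - g z) x = A f x - A g x"
    "AE x in I01. A (\<lambda>z. f z + g z) x = A f x + A g x"
    "AE x in I01. A (\<lambda>z. c *s f z) x = c *s A f x"
proof -
  obtain C where C: "C > 0" "kernel_small 0 C K" using approximable_kernel_small[OF K] .
  note ae = triangular_op_add_AE[OF Km less_imp_le[OF C(1)] C(2) p f g]
  show "AE x in I01. A (\<lambda>z. f z - g z) x = A f x - A g x"
    using ae(2) by eventually_elim (simp add: A_def vec_eq_iff right_diff_distrib)
  show "AE x in I01. A (\<lambda>z. f z + g z) x = A f x + A g x"
    using ae(1) by eventually_elim (simp add: A_def vec_eq_iff distrib_left)
  show "AE x in I01. A (\<lambda>z. c *s f z) x = c *s A f x"
    using ae(3)[of c] by eventually_elim (simp add: A_def vec_eq_iff)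
qed

lemma A_weighted:
  assumes f: "f \<in> Lp_space I01 p"
  shows "Lpn p (weighted wt (A f)) \<le> 1/2 * Lpn p (weighted wt f)"
proof -
  have e: "norm \<mu> / 16 > 0" using \<mu> by simp
  note T = triangular_op_Lp_weighted[OF p Km e wt(2) f less_imp_le[OF wt(1)]]
  have "Lpn p (weighted wt (A f)) = Lpn p (\<lambda>x. (1 / \<mu>) *s weighted wt (triangular_op K f) x)"
    unfolding A_def[abs_def] weighted_smult ..
  also have "\<dots> \<le> norm (1 / \<mu>) * Lpn p (weighted wt (triangular_op K f))" by (rule Lp_smult(2)[OF p T(1)])
  also have "\<dots> \<le> norm (1 / \<mu>) * (8 * (norm \<mu> / 16) * Lpn p (weighted wt f))" by (intro mult_left_mono T(2)) simp
  also have "\<dots> = 1/2 * Lpn p (weighted wt f)" using \<mu> by (simp add: norm_divide)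
  finally show ?thesis .
qed

lemma Lpn_le_weighted: "f \<in> Lp_space I01 p \<Longrightarrow> Lpn p f \<le> exp wt * Lpn p (weighted wt f)"
  using weighted_Lp(3)[OF p less_imp_le[OF wt(1)]] .

lemma weighted_in: "f \<in> Lp_space I01 p \<Longrightarrow> weighted wt f \<in> Lp_space I01 p"
  "f \<in> Lp_space I01 p \<Longrightarrow> Lpn p (weighted wt f) \<le> Lpn p f"
  by (erule weighted_Lp(1,2)[OF p less_imp_le[OF wt(1)]])+

lemma A_bound: "f \<in> Lp_space I01 p \<Longrightarrow> Lpn p (A f) \<le> exp wt * Lpn p f"
proof -
  assume f: "f \<in> Lp_space I01 p"
  have "Lpn p (A f) \<le> exp wt * Lpn p (weighted wt (A f))" by (rule Lpn_le_weighted[OF A_Lp[OF f]])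
  also have "\<dots> \<le> exp wt * Lpn p f"
  proof (intro mult_left_mono)
    show "Lpn p (weighted wt (A f)) \<le> Lpn p f"
      using A_weighted[OF f] weighted_in(2)[OF f] Lpn_nonneg[of p f] by linarith
  qed simp
  finally show ?thesis .
qed

lemma weighted_cong:
  assumes f: "f \<in> Lp_space I01 p" and g: "g \<in> Lp_space I01 p" and eq: "AE x in I01. g x = f x"
  shows "Lpn p (weighted wt g) = Lpn p (weighted wt f)"
proof (rule Lpn_AE_eq(2)[OF p weighted_in(1)[OF f] Lp_spaceD[OF weighted_in(1)[OF g]]])
  show "AE x in I01. weighted wt g x = weighted wt f x" using eq by eventually_elim (simp add: weighted_def)
qed

text \<open>A priori estimate: in the weighted norm \<open>A y\<close> takes at most half of y. It
  yields both uniqueness and the boundedness of the resolvent.\<close>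

lemma fixed_point_bound:
  assumes f: "f \<in> Lp_space I01 p" and y: "y \<in> Lp_space I01 p" and eq: "AE x in I01. y x = f x + A y x"
  shows "Lpn p y \<le> 2 * exp wt * Lpn p f"
proof -
  have "Lpn p (weighted wt y) = Lpn p (weighted wt (\<lambda>x. f x + A y x))"
    by (rule weighted_cong[OF Lp_add(1)[OF p f A_Lp[OF y]] y eq])
  also have "\<dots> \<le> Lpn p (weighted wt f) + Lpn p (weighted wt (A y))"
    unfolding weighted_add by (rule Lp_add(2)[OF p weighted_in(1)[OF f] weighted_in(1)[OF A_Lp[OF y]]])
  finally have "Lpn p (weighted wt y) \<le> 2 * Lpn p f" using A_weighted[OF y] weighted_in(2)[OF f] by simp
  then have "exp wt * Lpn p (weighted wt y) \<le> exp wt * (2 * Lpn p f)" by (intro mult_left_mono) auto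
  with Lpn_le_weighted[OF y] have "Lpn p y \<le> exp wt * (2 * Lpn p f)" by (rule order.trans)
  then show ?thesis by (simp add: mult_ac)
qed

lemma fixed_point_unique:
  assumes f: "f \<in> Lp_space I01 p" and y: "y \<in> Lp_space I01 p" "AE x in I01. y x = f x + A y x"
    and y': "y' \<in> Lp_space I01 p" "AE x in I01. y' x = f x + A y' x"
  shows "AE x in I01. y x = y' x"
proof -
  have z: "(\<lambda>x. 0 :: complex^2) \<in> Lp_space I01 p" "Lpn p (\<lambda>x. 0 :: complex^2) \<le> 0"
    using Lp_bounded_fun[OF p, of "\<lambda>x. 0 :: complex^2" 0] by auto
  have d: "(\<lambda>x. y x - y' x) \<in> Lp_space I01 p" by (rule Lp_diff(1)[OF p y(1) y'(1)])
  have "AE x in I01. y x - y' x = 0 + A (\<lambda>x. y x - y' x) x"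
    using y(2) y'(2) A_diff(1)[OF y(1) y'(1)] by eventually_elim simp
  from fixed_point_bound[OF z(1) d this] have "Lpn p (\<lambda>x. y x - y' x) \<le> 2 * exp wt * Lpn p (\<lambda>x. 0 :: complex^2)" .
  also have "\<dots> \<le> 2 * exp wt * 0" using z(2) by (intro mult_left_mono) auto
  finally have "Lpn p (\<lambda>x. y x - y' x) \<le> 0" by simp
  from Lpn_0_iff[OF p d this] show ?thesis by simp
qed

text \<open>Successive approximation. The contraction property belongs to the weighted norm and
  completeness to the unweighted one; \<open>exp wt\<close> mediates between them.\<close>

lemma fixed_point_exists:
  assumes f: "f \<in> Lp_space I01 p"
  obtains y where "y \<in> Lp_space I01 p" "AE x in I01. y x = f x + A y x"
proof -
  define Y where "Y = rec_nat f (\<lambda>_ g x. f x + A g x)"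
  have Y0: "Y 0 = f" and YS: "Y (Suc n) = (\<lambda>x. f x + A (Y n) x)" for n by (simp_all add: Y_def)
  have Yin: "Y n \<in> Lp_space I01 p" for n
    by (induction n) (auto simp: Y0 YS intro: f Lp_add(1)[OF p f A_Lp])
  have din: "(\<lambda>x. Y m x - Y n x) \<in> Lp_space I01 p" for m n by (rule Lp_diff(1)[OF p Yin Yin])
  define D where "D = Lpn p (weighted wt (\<lambda>x. Y 1 x - Y 0 x))"
  have D0: "D \<ge> 0" by (simp add: D_def)
  have step: "Lpn p (weighted wt (\<lambda>x. Y (Suc n) x - Y n x)) \<le> D * (1/2)^n" for n
  proof (induction n)
    case 0
    then show ?case by (simp add: D_def)
  next
    case (Suc n)
    have "AE x in I01. Y (Suc (Suc n)) x - Y (Suc n) x = A (\<lambda>x. Y (Suc n) x - Y n x) x"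
      using A_diff(1)[OF Yin[of "Suc n"] Yin[of n]] by eventually_elim (simp add: YS[of "Suc n"] YS[of n, THEN fun_cong])
    from weighted_cong[OF A_Lp[OF din] din this]
    have "Lpn p (weighted wt (\<lambda>x. Y (Suc (Suc n)) x - Y (Suc n) x)) = Lpn p (weighted wt (A (\<lambda>x. Y (Suc n) x - Y n x)))" .
    also have "\<dots> \<le> 1/2 * Lpn p (weighted wt (\<lambda>x. Y (Suc n) x - Y n x))" by (rule A_weighted[OF din])
    also have "\<dots> \<le> 1/2 * (D * (1/2)^n)" using Suc by simp
    finally show ?case by simp
  qed
  \<comment> \<open>The subtracted term makes the partial sum of the geometric series exact, so that
    induction on k goes through.\<close>
  have tail: "Lpn p (weighted wt (\<lambda>x. Y (n + k) x - Y n x)) \<le> 2 * D * (1/2)^n - 2 * D * (1/2)^(n+k)" for n k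
  proof (induction k)
    case 0
    have "AE x in I01. norm (weighted wt (\<lambda>x. Y n x - Y n x) x) \<le> 0" by (simp add: weighted_def)
    from Lp_bounded_fun(2)[OF p Lp_spaceD[OF weighted_in(1)[OF din]] _ this] show ?case by simp
  next
    case (Suc k)
    have "weighted wt (\<lambda>x. Y (n + Suc k) x - Y n x) = (\<lambda>x. weighted wt (\<lambda>x. Y (Suc (n + k)) x - Y (n + k) x) x + weighted wt (\<lambda>x. Y (n + k) x - Y n x) x)"
      unfolding weighted_add[symmetric] by simp
    then have "Lpn p (weighted wt (\<lambda>x. Y (n + Suc k) x - Y n x)) \<le> Lpn p (weighted wt (\<lambda>x. Y (Suc (n + k)) x - Y (n + k) x)) + Lpn p (weighted wt (\<lambda>x. Y (n + k) x - Y n x))"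
      using Lp_add(2)[OF p weighted_in(1)[OF din] weighted_in(1)[OF din]] by simp
    also have "\<dots> \<le> D * (1/2)^(n+k) + (2 * D * (1/2)^n - 2 * D * (1/2)^(n+k))" by (intro add_mono step Suc)
    finally show ?case by simp
  qed
  have tail': "Lpn p (\<lambda>x. Y m x - Y n x) \<le> exp wt * (2 * D * (1/2)^n)" if "m \<ge> n" for m n
  proof -
    have "Lpn p (weighted wt (\<lambda>x. Y m x - Y n x)) \<le> 2 * D * (1/2)^n"
    proof -
      have "0 \<le> 2 * D * (1/2)^m" using D0 by (intro mult_nonneg_nonneg) auto
      then show ?thesis using tail[of n "m - n"] that by simp
    qed
    then show ?thesis using Lpn_le_weighted[OF din[of m n]] by (meson exp_ge_zero mult_left_mono order.trans)
  qed
  have "\<exists>N. \<forall>m\<ge>N. \<forall>n\<ge>N. Lpn p (\<lambda>x. Y m x - Y n x) \<le> e" if e: "e > 0" for e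
  proof -
    have "(\<lambda>n. exp wt * (2 * D * (1/2)^n)) \<longlonglongrightarrow> exp wt * (2 * D * 0)"
      by (intro tendsto_intros LIMSEQ_realpow_zero) auto
    from order_tendstoD(2)[OF this, of "e/2"] e obtain N where N: "exp wt * (2 * D * (1/2)^N) < e / 2"
      by (auto simp: eventually_sequentially)
    show ?thesis
    proof (intro exI allI impI)
      fix m n assume mn: "m \<ge> N" "n \<ge> N"
      have "Lpn p (\<lambda>x. (Y m x - Y N x) - (Y n x - Y N x)) \<le> Lpn p (\<lambda>x. Y m x - Y N x) + Lpn p (\<lambda>x. Y n x - Y N x)"
        by (rule Lp_diff(2)[OF p din din])
      also have "\<dots> \<le> e" using tail'[OF mn(1)] tail'[OF mn(2)] N by simp
      finally show "Lpn p (\<lambda>x. Y m x - Y n x) \<le> e" by simp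
    qed
  qed
  note cauchy = this
  show ?thesis
  proof (rule Lp_complete[of p Y, OF p Yin cauchy])
    fix y assume y: "y \<in> Lp_space I01 p" and lim: "\<And>e. e > 0 \<Longrightarrow> \<exists>N. \<forall>n\<ge>N. Lpn p (\<lambda>x. Y n x - y x) \<le> e"
    let ?r = "\<lambda>x. y x - (f x + A y x)"
    have r: "?r \<in> Lp_space I01 p" by (intro Lp_diff(1) Lp_add(1) p y f A_Lp)
    have dy: "(\<lambda>x. Y n x - y x) \<in> Lp_space I01 p" for n by (rule Lp_diff(1)[OF p Yin y])
    have "Lpn p ?r \<le> 0"
    proof (rule field_le_epsilon)
      fix e :: real assume e: "e > 0"
      \<comment> \<open>The defect of the limit is A (Y N - y) - (Y (Suc N) - y), of norm at most
        (exp wt + 1) * d.\<close>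
      define d where "d = e / (exp wt + 1)"
      have d: "d > 0" using e by (simp add: d_def add_pos_pos)
      have "(exp wt + 1) * d = e" unfolding d_def by (simp add: add_pos_pos less_imp_neq[THEN not_sym])
      then have d2: "exp wt * d + d = e" by (simp add: algebra_simps)
      obtain N where N: "\<forall>n\<ge>N. Lpn p (\<lambda>x. Y n x - y x) \<le> d" using lim[OF d] by blast
      have "AE x in I01. ?r x = A (\<lambda>x. Y N x - y x) x - (Y (Suc N) x - y x)"
        using A_diff(1)[OF Yin[of N] y] by eventually_elim (simp add: YS[of N, THEN fun_cong])
      from Lpn_AE_eq(2)[OF p Lp_diff(1)[OF p A_Lp[OF dy] dy] Lp_spaceD[OF r] this]
      have "Lpn p ?r = Lpn p (\<lambda>x. A (\<lambda>x. Y N x - y x) x - (Y (Suc N) x - y x))" .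
      also have "\<dots> \<le> Lpn p (A (\<lambda>x. Y N x - y x)) + Lpn p (\<lambda>x. Y (Suc N) x - y x)"
        by (rule Lp_diff(2)[OF p A_Lp[OF dy] dy])
      also have "\<dots> \<le> exp wt * d + d"
      proof (rule add_mono)
        have "Lpn p (A (\<lambda>x. Y N x - y x)) \<le> exp wt * Lpn p (\<lambda>x. Y N x - y x)" by (rule A_bound[OF dy])
        also have "\<dots> \<le> exp wt * d" using N by (intro mult_left_mono) auto
        finally show "Lpn p (A (\<lambda>x. Y N x - y x)) \<le> exp wt * d" .
        show "Lpn p (\<lambda>x. Y (Suc N) x - y x) \<le> d" using N by simp
      qed
      finally show "Lpn p ?r \<le> 0 + e" using d2 by simp
    qed
    from Lpn_0_iff[OF p r this] have "AE x in I01. y x = f x + A y x" by simp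
    with y show thesis by (rule that)
  qed
qed

text \<open>The choice is made for each representative separately, so compatibility with equality
  almost everywhere and linearity are not automatic; both follow from uniqueness of the fixed
  point.\<close>

definition Y :: "(real \<Rightarrow> complex^2) \<Rightarrow> real \<Rightarrow> complex^2" where
  "Y f = (SOME y. y \<in> Lp_space I01 p \<and> (AE x in I01. y x = f x + A y x))"

lemma Y:
  assumes f: "f \<in> Lp_space I01 p"
  shows "Y f \<in> Lp_space I01 p" "AE x in I01. Y f x = f x + A (Y f) x"
proof -
  have "\<exists>y. y \<in> Lp_space I01 p \<and> (AE x in I01. y x = f x + A y x)"
    by (rule fixed_point_exists[OF f]) blast
  from someI_ex[OF this] show "Y f \<in> Lp_space I01 p" "AE x in I01. Y f x = f x + A (Y f) x"
    unfolding Y_def by auto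
qed

text \<open>If y = f + A y, then T - \<mu> maps - y / \<mu> to y - A y = f.\<close>

definition R :: "(real \<Rightarrow> complex^2) \<Rightarrow> real \<Rightarrow> complex^2" where
  "R f x = (- (1 / \<mu>)) *s Y f x"

lemma R_linear: "Lp_linear_op I01 p R"
  unfolding Lp_linear_op_def
proof (intro conjI ballI allI impI)
  fix f :: "real \<Rightarrow> complex^2" assume "f \<in> Lp_space I01 p"
  then show "R f \<in> Lp_space I01 p" unfolding R_def[abs_def] by (intro Lp_smult(1) p Y(1))
next
  fix f g :: "real \<Rightarrow> complex^2" assume f: "f \<in> Lp_space I01 p" and g: "g \<in> Lp_space I01 p" and eq: "AE x in I01. f x = g x"
  have "AE x in I01. Y g x = f x + A (Y g) x" using Y(2)[OF g] eq by eventually_elim simp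
  from fixed_point_unique[OF f Y[OF f] Y(1)[OF g] this]
  show "AE x in I01. R f x = R g x" by eventually_elim (simp add: R_def)
next
  fix f g :: "real \<Rightarrow> complex^2" assume f: "f \<in> Lp_space I01 p" and g: "g \<in> Lp_space I01 p"
  have "AE x in I01. Y f x + Y g x = (f x + g x) + A (\<lambda>x. Y f x + Y g x) x"
    using Y(2)[OF f] Y(2)[OF g] A_diff(2)[OF Y(1)[OF f] Y(1)[OF g]] by eventually_elim simp
  from fixed_point_unique[OF Lp_add(1)[OF p f g] Y[OF Lp_add(1)[OF p f g]] Lp_add(1)[OF p Y(1)[OF f] Y(1)[OF g]] this]
  show "AE x in I01. R (\<lambda>z. f z + g z) x = R f x + R g x"
    by eventually_elim (simp add: R_def vec_eq_iff distrib_left)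
next
  fix c and f :: "real \<Rightarrow> complex^2" assume f: "f \<in> Lp_space I01 p"
  have "AE x in I01. c *s Y f x = c *s f x + A (\<lambda>x. c *s Y f x) x"
    using Y(2)[OF f] A_diff(3)[OF Y(1)[OF f] Y(1)[OF f], of c]
  proof eventually_elim
    case (elim x)
    have "c *s Y f x = c *s (f x + A (Y f) x)" using elim(1) by simp
    then show ?case using elim(2) by (simp add: vec_eq_iff distrib_left)
  qed
  from fixed_point_unique[OF Lp_smult(1)[OF p f] Y[OF Lp_smult(1)[OF p f]] Lp_smult(1)[OF p Y(1)[OF f]] this]
  show "AE x in I01. R (\<lambda>z. c *s f z) x = c *s R f x"
    by eventually_elim (simp add: R_def vec_eq_iff)
qed

lemma not_in_spectrum: "\<mu> \<notin> Lp_spectrum I01 p (triangular_op K)"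
proof -
  have "Lp_bounded_op I01 p R"
    unfolding Lp_bounded_op_def
  proof (intro conjI exI[of _ "norm (1 / \<mu>) * (2 * exp wt)"] ballI)
    fix f :: "real \<Rightarrow> complex^2" assume f: "f \<in> Lp_space I01 p"
    have Rf: "R f \<in> Lp_space I01 p" using R_linear f by (simp add: Lp_linear_op_def)
    have "Lpn p (R f) \<le> norm (- (1 / \<mu>)) * Lpn p (Y f)"
      unfolding R_def[abs_def] by (rule Lp_smult(2)[OF p Y(1)[OF f]])
    also have "\<dots> \<le> norm (1 / \<mu>) * (2 * exp wt * Lpn p f)"
      unfolding norm_minus_cancel by (intro mult_left_mono fixed_point_bound[OF f Y[OF f]]) simp
    finally have "Lpn p (R f) \<le> norm (1 / \<mu>) * (2 * exp wt) * Lpn p f" by simp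
    then show "Lp_norm I01 p (R f) \<le> ennreal (norm (1 / \<mu>) * (2 * exp wt)) * Lp_norm I01 p f"
      unfolding Lp_norm_eq[OF Rf] Lp_norm_eq[OF f] by (simp add: ennreal_mult[symmetric] ennreal_leI)
  qed (rule R_linear)
  moreover have "AE x in I01. R (\<lambda>z. triangular_op K f z - \<mu> *s f z) x = f x" if f: "f \<in> Lp_space I01 p" for f
  proof -
    have Tf: "triangular_op K f \<in> Lp_space I01 p" using triangular_op_linear[OF K p] f by (simp add: Lp_linear_op_def)
    have h: "(\<lambda>z. triangular_op K f z - \<mu> *s f z) \<in> Lp_space I01 p" by (intro Lp_diff(1) p Tf Lp_smult(1) f)
    have y: "(\<lambda>z. (- \<mu>) *s f z) \<in> Lp_space I01 p" by (rule Lp_smult(1)[OF p f])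
    \<comment> \<open>The function - \<mu> * f solves the fixed point equation with right-hand side
      T f - \<mu> * f; uniqueness then shows that \<open>R\<close> is a left inverse.\<close>
    have "AE x in I01. (- \<mu>) *s f x = (triangular_op K f x - \<mu> *s f x) + A (\<lambda>z. (- \<mu>) *s f z) x"
      using A_diff(3)[OF f f, of "- \<mu>"] by eventually_elim (use \<mu> in \<open>simp add: A_def vec_eq_iff\<close>)
    from fixed_point_unique[OF h Y[OF h] y this] show ?thesis
      by eventually_elim (use \<mu> in \<open>simp add: R_def vec_eq_iff\<close>)
  qed
  moreover have "AE x in I01. triangular_op K (R f) x - \<mu> *s R f x = f x" if f: "f \<in> Lp_space I01 p" for f
  proof -
    obtain C where C: "C > 0" "kernel_small 0 C K" using approximable_kernel_small[OF K] .
    from triangular_op_add_AE(3)[OF Km less_imp_le[OF C(1)] C(2) p Y(1)[OF f] Y(1)[OF f], of "- (1 / \<mu>)"]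
    have "AE x in I01. triangular_op K (R f) x = (- (1 / \<mu>)) *s triangular_op K (Y f) x"
      unfolding R_def[abs_def] .
    with Y(2)[OF f] show ?thesis
    proof eventually_elim
      case (elim x)
      have "\<mu> *s R f x = - Y f x" using \<mu> by (simp add: R_def vec_eq_iff)
      then have "triangular_op K (R f) x - \<mu> *s R f x = Y f x - A (Y f) x"
        unfolding elim(2) by (simp add: A_def vec_eq_iff)
      also have "\<dots> = f x" using elim(1) by (metis add_diff_cancel_right')
      finally show ?case .
    qed
  qed
  ultimately show ?thesis unfolding Lp_spectrum_def by blast
qed

end

section \<open>Compactness\<close>

definition grid :: "nat \<Rightarrow> real \<Rightarrow> real" where
  "grid N x = of_int \<lfloor>real N * x\<rfloor> / real N"

text \<open>Piecewise constant in the first variable, so the associated operator has finite rank.\<close>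
definition step_kernel :: "(real \<times> real \<Rightarrow> complex^2^2) \<Rightarrow> nat \<Rightarrow> real \<times> real \<Rightarrow> complex^2^2" where
  "step_kernel g N z = (if snd z \<le> grid N (fst z) then g (grid N (fst z), snd z) else 0)"

lemma grid:
  assumes "N > 0"
  shows "grid N x \<le> x" "x - 1 / real N < grid N x" "0 \<le> x \<Longrightarrow> 0 \<le> grid N x"
proof -
  have "of_int \<lfloor>real N * x\<rfloor> \<le> real N * x" "real N * x - 1 < of_int \<lfloor>real N * x\<rfloor>" by linarith+
  moreover from divide_strict_right_mono[OF this(2), of "real N"]
  have "x - 1 / real N < grid N x" using assms by (simp add: grid_def diff_divide_distrib)
  ultimately show "grid N x \<le> x" "x - 1 / real N < grid N x"
    using assms by (simp_all add: grid_def divide_le_eq mult.commute)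
  show "0 \<le> grid N x" if "0 \<le> x" using that by (simp add: grid_def)
qed

lemma grid_index:
  assumes "N > 0" "x \<in> {0..1}"
  obtains i where "i \<le> N" "grid N x = real i / real N"
proof
  have "real N * x \<le> real N" using assms by (simp add: mult_left_le)
  then have "\<lfloor>real N * x\<rfloor> \<le> int N" by linarith
  then show "nat \<lfloor>real N * x\<rfloor> \<le> N" by simp
  have "0 \<le> \<lfloor>real N * x\<rfloor>" using assms by simp
  then show "grid N x = real (nat \<lfloor>real N * x\<rfloor>) / real N" by (simp add: grid_def)
qed

lemma step_kernel_measurable:
  assumes g: "continuous_on UNIV g"
  shows "step_kernel g N \<in> borel_measurable (borel \<Otimes>\<^sub>M borel)"
proof -
  note [measurable] = continuous_pair_measurable[OF g]
  show ?thesis unfolding step_kernel_def[abs_def] grid_def by measurable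
qed

text \<open>The cut-off at \<open>grid N x\<close> in \<open>step_kernel\<close> acts as the upper
  limit of integration, so the image depends on x through its grid point. On the unit interval there
  are at most N + 1 of these.\<close>

lemma triangular_op_step:
  assumes N: "N > 0"
  shows "triangular_op (step_kernel g N) f x = triangular_op g f (grid N x)"
  unfolding triangular_op_def set_lebesgue_integral_def
proof (intro Bochner_Integration.integral_cong refl)
  fix t
  show "indicator {0..x} t *\<^sub>R (step_kernel g N (x, t) *v f t) = indicator {0..grid N x} t *\<^sub>R (g (grid N x, t) *v f t)"
    using grid(1)[OF N, of x] by (auto simp: step_kernel_def indicator_def)
qed

lemma kernel_small_bounded:
  assumes "B \<ge> 0" "\<And>z. norm (H z) \<le> B"
  shows "kernel_small 0 B H"
proof -
  have *: "(\<integral>\<^sup>+t\<in>{a..b}. ennreal (norm (h t)) \<partial>lborel) \<le> ennreal B"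
    if "0 \<le> a" "a \<le> b" "b \<le> 1" "\<And>t. norm (h t) \<le> B" for a b :: real and h :: "real \<Rightarrow> complex^2^2"
  proof -
    have "(\<integral>\<^sup>+t\<in>{a..b}. ennreal (norm (h t)) \<partial>lborel) \<le> (\<integral>\<^sup>+t. ennreal B * indicator {a..b} t \<partial>lborel)"
      by (intro nn_integral_mono mult_right_mono ennreal_leI that) simp
    also have "\<dots> = ennreal (B * (b - a))"
      using that assms by (subst nn_integral_cmult_indicator) (auto simp: ennreal_mult)
    also have "\<dots> \<le> ennreal B" using that assms by (intro ennreal_leI) (simp add: mult_left_le)
    finally show ?thesis .
  qed
  show ?thesis unfolding kernel_small_def by (auto intro!: * assms)
qed

lemma kernel_small_add:
  fixes H G :: "real \<times> real \<Rightarrow> complex^2^2"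
  assumes [measurable]: "H \<in> borel_measurable (borel \<Otimes>\<^sub>M borel)" "G \<in> borel_measurable (borel \<Otimes>\<^sub>M borel)"
    and H: "kernel_small 0 a H" and G: "kernel_small 0 b G" and ab: "0 \<le> a" "0 \<le> b"
  shows "kernel_small 0 (a + b) (\<lambda>z. H z + G z)"
proof -
  have *: "(\<integral>\<^sup>+t\<in>E. ennreal (norm (h t + g t)) \<partial>lborel) \<le> ennreal (a + b)"
    if [measurable]: "h \<in> borel_measurable borel" "g \<in> borel_measurable borel" "E \<in> sets borel"
      and h: "(\<integral>\<^sup>+t\<in>E. ennreal (norm (h t)) \<partial>lborel) \<le> ennreal a" and g: "(\<integral>\<^sup>+t\<in>E. ennreal (norm (g t)) \<partial>lborel) \<le> ennreal b"
    for h g :: "real \<Rightarrow> complex^2^2" and E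
  proof -
    have "(\<integral>\<^sup>+t\<in>E. ennreal (norm (h t + g t)) \<partial>lborel) \<le> (\<integral>\<^sup>+t. ennreal (norm (h t)) * indicator E t + ennreal (norm (g t)) * indicator E t \<partial>lborel)"
      by (intro nn_integral_mono)
        (simp add: distrib_right[symmetric] ennreal_plus[symmetric] mult_right_mono ennreal_leI norm_triangle_ineq del: ennreal_plus)
    also have "\<dots> = (\<integral>\<^sup>+t\<in>E. ennreal (norm (h t)) \<partial>lborel) + (\<integral>\<^sup>+t\<in>E. ennreal (norm (g t)) \<partial>lborel)"
      by (rule nn_integral_add) measurable
    also have "\<dots> \<le> ennreal a + ennreal b" by (intro add_mono h g)
    finally show ?thesis using ab by (simp add: ennreal_plus)
  qed
  show ?thesis
    unfolding kernel_small_def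
  proof (intro conjI ballI)
    fix x :: real assume "x \<in> {0..1}"
    then show "(\<integral>\<^sup>+t\<in>{0..x}. ennreal (norm (H (x, t) + G (x, t)) * exp (- 0 * (x - t))) \<partial>lborel) \<le> ennreal (a + b)"
      using *[of "\<lambda>t. H (x, t)" "\<lambda>t. G (x, t)" "{0..x}"] H G by (simp add: kernel_small_def)
  next
    fix t :: real assume "t \<in> {0..1}"
    then show "(\<integral>\<^sup>+x\<in>{t..1}. ennreal (norm (H (x, t) + G (x, t)) * exp (- 0 * (x - t))) \<partial>lborel) \<le> ennreal (a + b)"
      using *[of "\<lambda>x. H (x, t)" "\<lambda>x. G (x, t)" "{t..1}"] H G by (simp add: kernel_small_def)
  qed
qed

text \<open>For t \<le> grid N x uniform continuity applies. Otherwise the step kernel is 0 and the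
  difference is as large as g, but on the triangle this is confined to a strip of width 1 / N along
  the diagonal, which contributes at most B / N to a section.\<close>

lemma step_kernel_close:
  assumes g: "continuous_on UNIV g" and B: "\<And>z. norm (g z) \<le> B" "B > 0" and e: "e > 0"
  obtains N where "N > 0" "kernel_small 0 e (\<lambda>z. g z - step_kernel g N z)"
proof -
  have "uniformly_continuous_on ({0..1} \<times> {0..1}) g"
    by (intro compact_uniformly_continuous continuous_on_subset[OF g] compact_Times) auto
  then obtain d where d: "d > 0" "\<forall>x\<in>{0..1} \<times> {0..1}. \<forall>x'\<in>{0..1} \<times> {0..1}. dist x' x < d \<longrightarrow> dist (g x') (g x) < e/2"
    unfolding uniformly_continuous_on_def using e by (meson half_gt_zero)
  \<comment> \<open>1 / N < d is for uniform continuity, B / N \<le> e / 2 for the strip.\<close>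
  obtain N :: nat where N: "max (1/d) (2 * B / e) < real N" using reals_Archimedean2 by blast
  have "0 < 1 / d" using d by simp
  then have N0: "N > 0" using N by (metis gr0I less_numeral_extra(3) max_less_iff_conj of_nat_0 order_less_trans)
  have Nd: "1 / real N < d" and NB: "B / real N \<le> e / 2"
    using N N0 d e by (auto simp: field_simps)
  let ?D = "\<lambda>z. g z - step_kernel g N z"
  have pt: "norm (?D (x, t)) \<le> e / 2 + B * indicator {t..t + 1 / real N} x" if "x \<in> {0..1}" "t \<in> {0..x}" for x t
  proof (cases "t \<le> grid N x")
    case True
    have "dist (x, t) (grid N x, t) < d"
      using grid(1,2)[OF N0, of x] Nd by (simp add: dist_Pair_Pair dist_real_def)
    moreover have "(x, t) \<in> {0..1} \<times> {0..1}" "(grid N x, t) \<in> {0..1} \<times> {0..1}"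
      using that grid(1)[OF N0, of x] grid(3)[OF N0, of x] by auto
    ultimately have "dist (g (x, t)) (g (grid N x, t)) < e / 2" using d(2) by blast
    then have "norm (?D (x, t)) \<le> e / 2" using True by (simp add: step_kernel_def dist_norm)
    then show ?thesis using B(2) by (simp add: add_increasing2)
  next
    case False
    then have "x \<in> {t..t + 1 / real N}" using grid(2)[OF N0, of x] that by simp
    then show ?thesis using False B(1)[of "(x, t)"] e by (simp add: step_kernel_def)
  qed
  have bound: "(\<integral>\<^sup>+t\<in>E. ennreal (h t) \<partial>lborel) \<le> ennreal e"
    if le: "\<And>t. t \<in> E \<Longrightarrow> h t \<le> e / 2 + B * indicator F t" and E[measurable]: "E \<in> sets borel" and F[measurable]: "F \<in> sets borel"
      and eE: "emeasure lborel E \<le> 1" and eF: "emeasure lborel F \<le> ennreal (1 / real N)" for h :: "real \<Rightarrow> real" and E F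
  proof -
    have "(\<integral>\<^sup>+t\<in>E. ennreal (h t) \<partial>lborel) \<le> (\<integral>\<^sup>+t. ennreal (e / 2) * indicator E t + ennreal B * indicator F t \<partial>lborel)"
    proof (intro nn_integral_mono)
      fix t
      show "ennreal (h t) * indicator E t \<le> ennreal (e / 2) * indicator E t + ennreal B * indicator F t"
      proof (cases "t \<in> E")
        case True
        have "ennreal (h t) \<le> ennreal (e / 2 + B * indicator F t)" by (intro ennreal_leI le True)
        also have "\<dots> = ennreal (e / 2) + ennreal B * indicator F t"
          using e B(2) by (auto simp: indicator_def ennreal_plus[symmetric] simp del: ennreal_plus)
        finally show ?thesis using True by simp
      qed simp
    qed
    also have "\<dots> = ennreal (e / 2) * emeasure lborel E + ennreal B * emeasure lborel F"
      by (subst nn_integral_add) (auto simp: nn_integral_cmult_indicator)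
    also have "\<dots> \<le> ennreal (e / 2) * 1 + ennreal B * ennreal (1 / real N)"
      by (intro add_mono mult_left_mono eE eF) auto
    also have "ennreal B * ennreal (1 / real N) = ennreal (B / real N)"
      using B(2) by (subst ennreal_mult[symmetric]) auto
    also have "ennreal (e / 2) * 1 + ennreal (B / real N) = ennreal (e / 2 + B / real N)"
      using e B(2) by (simp add: ennreal_plus)
    also have "\<dots> \<le> ennreal e" using NB by (intro ennreal_leI) linarith
    finally show ?thesis .
  qed
  have "kernel_small 0 e ?D"
    unfolding kernel_small_def
  proof (intro conjI ballI)
    fix x :: real assume x: "x \<in> {0..1}"
    have "(\<integral>\<^sup>+t\<in>{0..x}. ennreal (norm (?D (x, t))) \<partial>lborel) \<le> ennreal e"
    proof (rule bound[where F = "{x - 1 / real N..x}"])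
      fix t assume t: "t \<in> {0..x}"
      have "indicator {t..t + 1 / real N} x = (indicator {x - 1 / real N..x} t :: real)" by (auto simp: indicator_def)
      then show "norm (?D (x, t)) \<le> e / 2 + B * indicator {x - 1 / real N..x} t" using pt[OF x t] by simp
    qed (use x in auto)
    then show "(\<integral>\<^sup>+t\<in>{0..x}. ennreal (norm (?D (x, t)) * exp (- 0 * (x - t))) \<partial>lborel) \<le> ennreal e" by simp
  next
    fix t :: real assume t: "t \<in> {0..1}"
    have "(\<integral>\<^sup>+x\<in>{t..1}. ennreal (norm (?D (x, t))) \<partial>lborel) \<le> ennreal e"
    proof (rule bound[where F = "{t..t + 1 / real N}"])
      fix x assume x: "x \<in> {t..1}"
      show "norm (?D (x, t)) \<le> e / 2 + B * indicator {t..t + 1 / real N} x" by (rule pt) (use x t in auto)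
    qed (use t in auto)
    then show "(\<integral>\<^sup>+x\<in>{t..1}. ennreal (norm (?D (x, t)) * exp (- 0 * (x - t))) \<partial>lborel) \<le> ennreal e" by simp
  qed
  then show ?thesis using that N0 by blast
qed

definition step_approx :: "(real \<times> real \<Rightarrow> complex^2^2) \<Rightarrow> real \<Rightarrow> (real \<times> real \<Rightarrow> complex^2^2) \<Rightarrow> nat \<Rightarrow> real \<Rightarrow> bool" where
  "step_approx K e g N B \<longleftrightarrow> continuous_on UNIV g \<and> (\<forall>z. norm (g z) \<le> B) \<and> B > 0 \<and> N > 0 \<and>
     kernel_small 0 e (\<lambda>z. K z - step_kernel g N z)"

lemma step_approx_exists:
  assumes K: "approximable_kernel K" and e: "e > 0"
  shows "\<exists>g N B. step_approx K e g N B"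
proof -
  note Km = approximable_kernelD(1)[OF K]
  obtain g where g: "continuous_on UNIV g" "bounded (range g)" "kernel_close (e/2) K g"
    using approximable_kernelD(2)[OF K, of "e/2"] e by auto
  obtain B0 where B0: "\<And>z. norm (g z) \<le> B0" using g(2) unfolding bounded_iff by blast
  define B where "B = max B0 1"
  have B: "norm (g z) \<le> B" "B > 0" for z using B0[of z] by (auto simp: B_def)
  have e2: "e / 2 > 0" using e by simp
  obtain N where N: "N > 0" "kernel_small 0 (e/2) (\<lambda>z. g z - step_kernel g N z)"
    using step_kernel_close[OF g(1) B e2] .
  have "kernel_small 0 (e/2 + e/2) (\<lambda>z. (K z - g z) + (g z - step_kernel g N z))"
  proof (rule kernel_small_add[OF _ _ _ N(2)])
    note [measurable] = Km continuous_pair_measurable[OF g(1)] step_kernel_measurable[OF g(1), of N]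
    show "(\<lambda>z. K z - g z) \<in> borel_measurable (borel \<Otimes>\<^sub>M borel)" "(\<lambda>z. g z - step_kernel g N z) \<in> borel_measurable (borel \<Otimes>\<^sub>M borel)"
      by measurable
    show "kernel_small 0 (e/2) (\<lambda>z. K z - g z)" using g(3) by (simp add: kernel_small_def kernel_close_def)
  qed (use e in auto)
  then have "step_approx K e g N B" using g(1) B N(1) by (simp add: step_approx_def)
  then show ?thesis by blast
qed

lemma triangular_op_sup_bound:
  assumes B: "\<And>z. norm (g z) \<le> B" "B > 0" and p: "p \<ge> 1" and f: "f \<in> Lp_space I01 p" and y: "y \<in> {0..1}"
  shows "norm (triangular_op g f y) \<le> 8 * B * (Lpn p f + 1)"
proof -
  have "ennreal (norm (triangular_op g f y)) \<le> (\<integral>\<^sup>+t\<in>{0..y}. ennreal (4 * norm (g (y, t))) * ennreal (norm (f t)) \<partial>lborel)"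
    by (rule norm_triangular_op_le)
  also have "\<dots> \<le> (\<integral>\<^sup>+t. ennreal (4 * B) * (ennreal (norm (f t)) * indicator {0..1} t) \<partial>lborel)"
  proof (intro nn_integral_mono)
    fix t
    show "ennreal (4 * norm (g (y, t))) * ennreal (norm (f t)) * indicator {0..y} t \<le> ennreal (4 * B) * (ennreal (norm (f t)) * indicator {0..1} t)"
    proof -
      have "ennreal (4 * norm (g (y, t))) \<le> ennreal (4 * B)" using B(1)[of "(y, t)"] by (intro ennreal_leI) simp
      from mult_right_mono[OF this zero_le[of "ennreal (norm (f t))"]] show ?thesis
        using y by (auto simp: indicator_def)
    qed
  qed
  also have "\<dots> = (\<integral>\<^sup>+t. ennreal (4 * B) * ennreal (norm (f t)) \<partial>I01)"
    unfolding nn_integral_I01 by (simp add: mult.assoc)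
  also have "\<dots> = ennreal (4 * B) * (\<integral>\<^sup>+t. ennreal (norm (f t)) \<partial>I01)"
    using Lp_spaceD[OF f] by (intro nn_integral_cmult) measurable
  also have "\<dots> \<le> ennreal (4 * B) * ennreal (2 * (Lpn p f + 1))"
    by (intro mult_left_mono Lp_imp_L1[OF p f]) (simp_all add: add_nonneg_pos)
  also have "\<dots> = ennreal (8 * B * (Lpn p f + 1))"
    using B(2) by (subst ennreal_mult[symmetric]) (auto simp: mult_ac)
  finally show ?thesis using B(2) by (subst (asm) ennreal_le_iff) auto
qed

text \<open>An image under a step operator is determined by finitely many vectors, so one
  subsequence makes these images converge for all step operators at once. As the step operators
  approximate T in norm, the images under T are Cauchy along it, and completeness supplies the
  limit.\<close>

theorem triangular_op_compact:
  assumes K: "approximable_kernel K" and p: "p \<ge> 1"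
  shows "Lp_compact_op I01 p (triangular_op K)"
  unfolding Lp_compact_op_def
proof (intro conjI allI impI)
  show "Lp_linear_op I01 p (triangular_op K)" by (rule triangular_op_linear[OF K p])
  let ?T = "triangular_op K"
  note Km = approximable_kernelD(1)[OF K]
  obtain CK where CK: "CK > 0" "kernel_small 0 CK K" using approximable_kernel_small[OF K] .
  fix f :: "nat \<Rightarrow> real \<Rightarrow> complex^2" and C0 :: real
  assume f0: "\<forall>n. f n \<in> Lp_space I01 p \<and> Lp_norm I01 p (f n) \<le> ennreal C0"
  then have f: "f n \<in> Lp_space I01 p" for n by blast
  define C where "C = max C0 1"
  have C: "C > 0" "Lpn p (f n) \<le> C" for n
  proof -
    have "ennreal C0 \<le> ennreal C" by (simp add: C_def ennreal_leI)
    then have "ennreal (Lpn p (f n)) \<le> ennreal C" using f0 Lp_norm_eq[OF f, of n] by (metis order.trans)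
    then show "C > 0" "Lpn p (f n) \<le> C" by (simp_all add: C_def ennreal_le_iff)
  qed
  have "\<forall>m. \<exists>G. step_approx K (1 / real (Suc m)) (fst G) (fst (snd G)) (snd (snd G))"
  proof
    fix m
    have "1 / real (Suc m) > 0" by simp
    from step_approx_exists[OF K this] obtain g N B where "step_approx K (1 / real (Suc m)) g N B" by blast
    then show "\<exists>G. step_approx K (1 / real (Suc m)) (fst G) (fst (snd G)) (snd (snd G))"
      by (intro exI[of _ "(g, N, B)"]) simp
  qed
  from choice[OF this] obtain G where G: "\<forall>m. step_approx K (1 / real (Suc m)) (fst (G m)) (fst (snd (G m))) (snd (snd (G m)))" ..
  define g N B where "g m = fst (G m)" and "N m = fst (snd (G m))" and "B m = snd (snd (G m))" for m
  have gNB: "continuous_on UNIV (g m)" "norm (g m z) \<le> B m" "B m > 0" "N m > 0"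
    "kernel_small 0 (1 / real (Suc m)) (\<lambda>z. K z - step_kernel (g m) (N m) z)" for m z
    using G[rule_format, of m] unfolding step_approx_def g_def N_def B_def by blast+
  \<comment> \<open>Indexed by pairs of an approximation level and a grid index. Division by
    \<open>B\<close> makes the values bounded uniformly over all levels, as a common convergent
    subsequence requires; indices beyond the grid get 0.\<close>
  define F where "F n q = (if snd q \<le> N (fst q) then (1 / B (fst q)) *\<^sub>R triangular_op (g (fst q)) (f n) (real (snd q) / real (N (fst q))) else 0)" for n and q :: "nat \<times> nat"
  have Fbound: "norm (F n q) \<le> 8 * (C + 1)" for n q
  proof (cases "snd q \<le> N (fst q)")
    case True
    let ?m = "fst q"
    have "real (snd q) / real (N ?m) \<in> {0..1}" using True gNB(4)[of ?m] by simp
    from triangular_op_sup_bound[OF gNB(2)[of ?m] gNB(3)[of ?m] p f[of n] this]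
    have "norm (triangular_op (g ?m) (f n) (real (snd q) / real (N ?m))) \<le> 8 * B ?m * (Lpn p (f n) + 1)" .
    also have "\<dots> \<le> 8 * B ?m * (C + 1)" using C(2)[of n] gNB(3)[of ?m] by (intro mult_left_mono) auto
    finally have "(1 / B ?m) * norm (triangular_op (g ?m) (f n) (real (snd q) / real (N ?m))) \<le> (1 / B ?m) * (8 * B ?m * (C + 1))"
      using gNB(3)[of ?m] by (intro mult_left_mono) auto
    then show ?thesis using True gNB(3)[of ?m] by (simp add: F_def)
  qed (use C(1) in \<open>simp add: F_def\<close>)
  obtain r where r: "strict_mono (r::nat\<Rightarrow>nat)" "\<forall>q. \<exists>l. (\<lambda>n. F (r n) q) \<longlonglongrightarrow> l"
    by (rule function_convergent_subsequence[of UNIV F, OF countableI_type Fbound]) (rule that, auto)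
  have Tf: "?T (f n) \<in> Lp_space I01 p" for n by (rule triangular_op_Lp(1)[OF p Km CK f])
  have cauchy: "\<exists>n0. \<forall>n\<ge>n0. \<forall>k\<ge>n0. Lpn p (\<lambda>x. ?T (f (r n)) x - ?T (f (r k)) x) \<le> e" if e: "e > 0" for e
  proof -
    \<comment> \<open>Two approximation errors of 8 * C / (m + 1) then add up to at most e / 2; the
      other half is spent on the step operator.\<close>
    obtain m where m: "32 * (C + 1) / e < real m" using reals_Archimedean2 by blast
    let ?e = "1 / real (Suc m)"
    let ?H = "step_kernel (g m) (N m)"
    have em: "16 * ?e * C \<le> e / 2"
    proof -
      have "32 * (C + 1) < e * real m" using m e by (simp add: field_simps)
      also have "\<dots> \<le> e * real (Suc m)" using e by simp
      finally have "32 * C \<le> e * real (Suc m)" by simp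
      then show ?thesis by (simp add: field_simps del: of_nat_Suc)
    qed
    note Hm = step_kernel_measurable[OF gNB(1)[of m], of "N m"]
    have HB: "kernel_small 0 (B m) ?H"
      using gNB(2,3)[of m] by (intro kernel_small_bounded) (auto simp: step_kernel_def less_imp_le)
    have THf: "triangular_op ?H (f n) \<in> Lp_space I01 p" for n by (rule triangular_op_Lp(1)[OF p Hm gNB(3) HB f])
    have approx: "Lpn p (\<lambda>x. ?T (f n) x - triangular_op ?H (f n) x) \<le> 8 * ?e * C" for n
    proof -
      have KH: "(\<lambda>z. K z - ?H z) \<in> borel_measurable (borel \<Otimes>\<^sub>M borel)" using Km Hm by measurable
      have e': "?e > 0" by simp
      note TD = triangular_op_Lp[OF p KH e' gNB(5) f[of n]]
      have d: "(\<lambda>x. ?T (f n) x - triangular_op ?H (f n) x) \<in> borel_measurable I01"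
        by (rule Lp_spaceD[OF Lp_diff(1)[OF p Tf THf]])
      have "AE x in I01. ?T (f n) x - triangular_op ?H (f n) x = triangular_op (\<lambda>z. K z - ?H z) (f n) x"
        using triangular_op_diff_kernel_AE[OF Km less_imp_le[OF CK(1)] CK(2) Hm less_imp_le[OF gNB(3)] HB p f[of n]]
        by eventually_elim simp
      from Lpn_AE_eq(2)[OF p TD(1) d this]
      have "Lpn p (\<lambda>x. ?T (f n) x - triangular_op ?H (f n) x) \<le> 8 * ?e * Lpn p (f n)" using TD(2) by simp
      also have "\<dots> \<le> 8 * ?e * C" using C(2)[of n] by (intro mult_left_mono) auto
      finally show ?thesis .
    qed
    \<comment> \<open>Comparison through the index n0 doubles this bound and multiplication by
      \<open>B m\<close> undoes the normalisation, which gives e / 2.\<close>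
    have "\<forall>i\<in>{..N m}. \<forall>\<^sub>F n in sequentially. \<forall>k\<ge>n. norm (F (r n) (m, i) - F (r k) (m, i)) < e / (4 * B m)"
    proof
      fix i assume "i \<in> {..N m}"
      obtain l where l: "(\<lambda>n. F (r n) (m, i)) \<longlonglongrightarrow> l" using r(2) by blast
      have "e / (4 * B m) > 0" using e gNB(3) by simp
      from CauchyD[OF LIMSEQ_imp_Cauchy[OF l] this] obtain M where
        "\<forall>n\<ge>M. \<forall>k\<ge>M. norm (F (r n) (m, i) - F (r k) (m, i)) < e / (4 * B m)" by blast
      then show "\<forall>\<^sub>F n in sequentially. \<forall>k\<ge>n. norm (F (r n) (m, i) - F (r k) (m, i)) < e / (4 * B m)"
        unfolding eventually_sequentially by (metis order.trans)
    qed
    then have "\<forall>\<^sub>F n in sequentially. \<forall>i\<in>{..N m}. \<forall>k\<ge>n. norm (F (r n) (m, i) - F (r k) (m, i)) < e / (4 * B m)"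
      by (intro eventually_ball_finite) auto
    then obtain n0 where n0: "\<forall>i\<in>{..N m}. \<forall>k\<ge>n0. norm (F (r n0) (m, i) - F (r k) (m, i)) < e / (4 * B m)"
      unfolding eventually_sequentially by blast
    have Hdiff: "norm (triangular_op ?H (f (r n)) x - triangular_op ?H (f (r k)) x) \<le> e / 2"
      if nk: "n \<ge> n0" "k \<ge> n0" and x: "x \<in> {0..1}" for n k x
    proof -
      obtain i where i: "i \<le> N m" "grid (N m) x = real i / real (N m)" using grid_index[OF gNB(4) x] .
      have FH: "triangular_op ?H (f n) x = B m *\<^sub>R F n (m, i)" for n
        using i gNB(3)[of m] by (simp add: F_def triangular_op_step[OF gNB(4)])
      have "norm (F (r n) (m, i) - F (r k) (m, i)) \<le> norm (F (r n0) (m, i) - F (r n) (m, i)) + norm (F (r n0) (m, i) - F (r k) (m, i))"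
        by norm
      also have "\<dots> \<le> e / (4 * B m) + e / (4 * B m)"
        using n0 nk i(1) by (intro add_mono less_imp_le) auto
      finally have "B m * norm (F (r n) (m, i) - F (r k) (m, i)) \<le> B m * (e / (4 * B m) + e / (4 * B m))"
        using gNB(3)[of m] by (intro mult_left_mono) auto
      also have "\<dots> = e / 2" using gNB(3)[of m] by (simp add: field_simps)
      finally show ?thesis
        unfolding FH scaleR_diff_right[symmetric] norm_scaleR using gNB(3)[of m] by simp
    qed
    show ?thesis
    proof (intro exI allI impI)
      fix n k assume nk: "n \<ge> n0" "k \<ge> n0"
      let ?d = "\<lambda>n x. ?T (f n) x - triangular_op ?H (f n) x"
      let ?h = "\<lambda>x. triangular_op ?H (f (r n)) x - triangular_op ?H (f (r k)) x"
      have din: "?d n \<in> Lp_space I01 p" for n by (rule Lp_diff(1)[OF p Tf THf])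
      have hm: "?h \<in> borel_measurable I01" by (rule Lp_spaceD[OF Lp_diff(1)[OF p THf THf]])
      have "AE x in I01. norm (?h x) \<le> e / 2" using Hdiff[OF nk] by (intro AE_I2) simp
      from Lp_bounded_fun[OF p hm _ this] e have h: "?h \<in> Lp_space I01 p" "Lpn p ?h \<le> e / 2" by auto
      have "Lpn p (\<lambda>x. (?d (r n) x - ?d (r k) x) + ?h x) \<le> Lpn p (\<lambda>x. ?d (r n) x - ?d (r k) x) + Lpn p ?h"
        by (rule Lp_add(2)[OF p Lp_diff(1)[OF p din din] h(1)])
      also have "\<dots> \<le> (8 * ?e * C + 8 * ?e * C) + e / 2"
        using Lp_diff(2)[OF p din[of "r n"] din[of "r k"]] approx[of "r n"] approx[of "r k"] h(2) by linarith
      also have "\<dots> \<le> e" using em by simp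
      finally show "Lpn p (\<lambda>x. ?T (f (r n)) x - ?T (f (r k)) x) \<le> e" by (simp add: algebra_simps)
    qed
  qed
  show "\<exists>g\<in>Lp_space I01 p. \<exists>r::nat \<Rightarrow> nat. strict_mono r \<and> (\<lambda>n. Lp_norm I01 p (\<lambda>x. ?T (f (r n)) x - g x)) \<longlonglongrightarrow> 0"
  proof (rule Lp_complete[of p "\<lambda>n. ?T (f (r n))", OF p Tf cauchy])
    fix h assume h: "h \<in> Lp_space I01 p" and lim: "\<And>e. e > 0 \<Longrightarrow> \<exists>N. \<forall>n\<ge>N. Lpn p (\<lambda>x. ?T (f (r n)) x - h x) \<le> e"
    have "(\<lambda>n. Lpn p (\<lambda>x. ?T (f (r n)) x - h x)) \<longlonglongrightarrow> 0"
    proof (rule LIMSEQ_I)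
      fix e :: real assume e: "0 < e"
      obtain n0 where "\<forall>n\<ge>n0. Lpn p (\<lambda>x. ?T (f (r n)) x - h x) \<le> e / 2" using lim[of "e/2"] e by auto
      then have "norm (Lpn p (\<lambda>x. ?T (f (r n)) x - h x) - 0) < e" if "n \<ge> n0" for n
        using that e by (auto intro: le_less_trans)
      then show "\<exists>n0. \<forall>n\<ge>n0. norm (Lpn p (\<lambda>x. ?T (f (r n)) x - h x) - 0) < e" by blast
    qed
    then have "(\<lambda>n. ennreal (Lpn p (\<lambda>x. ?T (f (r n)) x - h x))) \<longlonglongrightarrow> ennreal 0" by (rule tendsto_ennrealI)
    then have "(\<lambda>n. Lp_norm I01 p (\<lambda>x. ?T (f (r n)) x - h x)) \<longlonglongrightarrow> 0"
      unfolding Lp_norm_eq[OF Lp_diff(1)[OF p Tf h]] by simp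
    then show ?thesis using h r(1) by blast
  qed
qed

section \<open>Zero belongs to the spectrum\<close>

lemma unit_bump:
  fixes l u :: real
  assumes p: "p \<ge> 1" and lu: "0 \<le> l" "l < u" "u \<le> 1"
  obtains c where "c > 0" "(\<lambda>x. (indicat_real {l<..u} x * c) *\<^sub>R (axis 1 1 :: complex^2)) \<in> Lp_space I01 p"
    "Lpn p (\<lambda>x. (indicat_real {l<..u} x * c) *\<^sub>R (axis 1 1 :: complex^2)) = 1"
proof -
  define r where "r = enn2real p"
  \<comment> \<open>Normalises a bump of length u - l; for infinite p the height 1 already has norm
    1.\<close>
  define c where "c = (if p = \<infinity> then 1 else (u - l) powr (- 1 / r))"
  have c: "c > 0" using lu by (simp add: c_def)
  let ?f = "\<lambda>x. (indicat_real {l<..u} x * c) *\<^sub>R (axis 1 1 :: complex^2)"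
  have nf: "norm (?f x) = indicat_real {l<..u} x * c" for x
    using c by (simp add: norm_vec_def L2_set_def sum_2 axis_def)
  have fm: "?f \<in> borel_measurable I01" by (rule borel_imp_lebesgue_on) measurable
  have bd: "Lp_bd p ?f d \<longleftrightarrow> 1 \<le> d" if d: "d \<ge> 0" for d
  proof (cases "p = \<infinity>")
    case True
    show ?thesis
    proof
      assume "Lp_bd p ?f d"
      then have ae: "AE x in lborel. x \<in> {0..1} \<longrightarrow> norm (?f x) \<le> d"
        using True by (simp only: Lp_bd_def AE_I01 AE_completion_iff if_True)
      show "1 \<le> d"
      proof (rule ccontr)
        assume "\<not> 1 \<le> d"
        with ae have "AE x in lborel. x \<notin> {l<..u}"
          by (elim eventually_mono) (use lu True in \<open>auto simp: nf c_def indicator_def\<close>)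
        then have "emeasure lborel {l<..u} = 0" by (intro AE_iff_measurable[THEN iffD1]) auto
        then show False using lu by simp
      qed
    next
      assume "1 \<le> d"
      then show "Lp_bd p ?f d" using True by (auto simp: Lp_bd_def nf c_def indicator_def intro!: AE_I2)
    qed
  next
    case False
    have r: "r \<ge> 1" using enn2real_ge_1[OF p False] by (simp add: r_def)
    have "c powr r = (u - l) powr (- 1)" unfolding c_def using False r by (simp add: powr_powr)
    then have cr: "c powr r * (u - l) = 1" using lu by (simp add: powr_minus_divide)
    have "(\<integral>\<^sup>+x. ennreal (norm (?f x) powr r) \<partial>I01) = (\<integral>\<^sup>+x. ennreal (c powr r) * indicator {l<..u} x \<partial>lborel)"
      unfolding nn_integral_I01 nf using lu by (intro nn_integral_cong) (auto simp: indicator_def)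
    also have "\<dots> = ennreal (c powr r * (u - l))"
      using lu by (subst nn_integral_cmult_indicator) (auto simp: ennreal_mult)
    finally have J: "(\<integral>\<^sup>+x. ennreal (norm (?f x) powr r) \<partial>I01) = 1" using cr by simp
    have "Lp_bd p ?f d \<longleftrightarrow> 1 \<le> d powr r"
      using False J unfolding Lp_bd_def r_def[symmetric] by (simp flip: ennreal_1)
    also have "\<dots> \<longleftrightarrow> 1 \<le> d"
    proof
      assume *: "1 \<le> d powr r"
      show "1 \<le> d"
      proof (rule ccontr)
        assume "\<not> 1 \<le> d"
        then have "d powr r < 1 powr r" using d r by (intro powr_less_mono2) auto
        then show False using * by simp
      qed
    next
      assume "1 \<le> d"
      then have "1 powr r \<le> d powr r" using r by (intro powr_mono2) auto
      then show "1 \<le> d powr r" by simp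
    qed
    finally show ?thesis .
  qed
  have in_space: "?f \<in> Lp_space I01 p" and le: "Lpn p ?f \<le> 1"
    using Lp_bd_imp[OF p _ fm, of 1] bd[of 1] by auto
  have "1 \<le> Lpn p ?f" using bd[of "Lpn p ?f"] Lp_bd_Lpn[OF p in_space] by simp
  with le have "Lpn p ?f = 1" by (rule antisym)
  then show ?thesis by (rule that[OF c in_space])
qed

text \<open>Normalised bumps on disjoint intervals: on the support of f m the difference equals f m,
  so its norm is at least 1 whatever p is.\<close>

lemma separated_sequence_exists:
  assumes p: "p \<ge> 1"
  obtains f :: "nat \<Rightarrow> real \<Rightarrow> complex^2" where "\<And>n. f n \<in> Lp_space I01 p" "\<And>n. Lpn p (f n) \<le> 1"
    "\<And>m n. m < n \<Longrightarrow> 1 \<le> Lpn p (\<lambda>x. f m x - f n x)"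
proof -
  define I where "I n = {1 / real (n + 2) <.. 1 / real (n + 1)}" for n
  define b where "b c n x = (indicat_real (I n) x * c) *\<^sub>R (axis 1 1 :: complex^2)" for c n x
  have "\<forall>n. \<exists>c>0. b c n \<in> Lp_space I01 p \<and> Lpn p (b c n) = 1"
  proof
    fix n
    have "0 \<le> 1 / real (n + 2)" "1 / real (n + 2) < 1 / real (n + 1)" "1 / real (n + 1) \<le> 1"
      by (auto simp: field_simps)
    from unit_bump[OF p this] obtain c where "c > 0"
      "(\<lambda>x. (indicat_real (I n) x * c) *\<^sub>R (axis 1 1 :: complex^2)) \<in> Lp_space I01 p"
      "Lpn p (\<lambda>x. (indicat_real (I n) x * c) *\<^sub>R (axis 1 1 :: complex^2)) = 1"
      unfolding I_def .
    then show "\<exists>c>0. b c n \<in> Lp_space I01 p \<and> Lpn p (b c n) = 1"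
      unfolding b_def[abs_def] by blast
  qed
  from choice[OF this] obtain c where c: "\<forall>n. c n > 0 \<and> b (c n) n \<in> Lp_space I01 p \<and> Lpn p (b (c n) n) = 1" ..
  define f where "f n = b (c n) n" for n
  have f: "f n \<in> Lp_space I01 p" "Lpn p (f n) = 1" for n using c by (auto simp: f_def)
  show ?thesis
  proof (rule that[of f])
    fix m n :: nat assume "m < n"
    have d: "(\<lambda>x. f m x - f n x) \<in> Lp_space I01 p" by (rule Lp_diff(1)[OF p f(1) f(1)])
    have disj: "x \<notin> I n" if "x \<in> I m" for x
    proof -
      have "1 / real (n + 1) \<le> 1 / real (m + 2)" using \<open>m < n\<close> by (intro divide_left_mono) auto
      then show ?thesis using that by (auto simp: I_def)
    qed
    have "AE x in I01. norm (f m x) \<le> 1 * norm (f m x - f n x)"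
    proof (intro AE_I2)
      fix x
      show "norm (f m x) \<le> 1 * norm (f m x - f n x)"
        using disj[of x] by (cases "x \<in> I m") (auto simp: f_def b_def)
    qed
    from Lp_mono(2)[OF p d _ Lp_spaceD[OF f(1)] this] show "1 \<le> Lpn p (\<lambda>x. f m x - f n x)" using f(2)[of m] by simp
  qed (use f in auto)
qed

text \<open>A bounded right inverse R would give f n = T (R (f n)) with R (f n) bounded, so
  compactness would produce a convergent subsequence of a separated sequence.\<close>

lemma zero_in_spectrum:
  assumes K: "approximable_kernel K" and p: "p \<ge> 1"
  shows "0 \<in> Lp_spectrum I01 p (triangular_op K)"
proof (rule ccontr)
  let ?T = "triangular_op K"
  assume "0 \<notin> Lp_spectrum I01 p ?T"
  then obtain R where R: "Lp_bounded_op I01 p R"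
    and TR: "\<And>f. f \<in> Lp_space I01 p \<Longrightarrow> AE x in I01. ?T (R f) x - 0 *s R f x = f x"
    unfolding Lp_spectrum_def by blast
  obtain f :: "nat \<Rightarrow> real \<Rightarrow> complex^2" where f: "\<And>n. f n \<in> Lp_space I01 p" "\<And>n. Lpn p (f n) \<le> 1"
    "\<And>m n. m < n \<Longrightarrow> 1 \<le> Lpn p (\<lambda>x. f m x - f n x)"
    by (rule separated_sequence_exists[OF p]) (rule that, assumption+)
  obtain C where C: "\<forall>f\<in>Lp_space I01 p. Lp_norm I01 p (R f) \<le> ennreal C * Lp_norm I01 p f"
    using R unfolding Lp_bounded_op_def by blast
  have Rf: "R (f n) \<in> Lp_space I01 p" for n
    using R f(1) unfolding Lp_bounded_op_def Lp_linear_op_def by blast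
  have "Lp_norm I01 p (R (f n)) \<le> ennreal C" for n
  proof -
    have "Lp_norm I01 p (R (f n)) \<le> ennreal C * Lp_norm I01 p (f n)" using C f(1) by blast
    also have "\<dots> \<le> ennreal C * ennreal 1"
      unfolding Lp_norm_eq[OF f(1)] by (intro mult_left_mono ennreal_leI f(2)) simp
    finally show ?thesis by simp
  qed
  then have "\<forall>n. R (f n) \<in> Lp_space I01 p \<and> Lp_norm I01 p (R (f n)) \<le> ennreal C" using Rf by blast
  with conjunct2[OF triangular_op_compact[OF K p, unfolded Lp_compact_op_def], rule_format, of "\<lambda>n. R (f n)" C]
  obtain g r where g: "g \<in> Lp_space I01 p" and r: "strict_mono (r :: nat \<Rightarrow> nat)"
    and lim: "(\<lambda>n. Lp_norm I01 p (\<lambda>x. ?T (R (f (r n))) x - g x)) \<longlonglongrightarrow> 0"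
    by blast
  have TRf: "?T (R (f n)) \<in> Lp_space I01 p" for n
    using triangular_op_linear[OF K p] Rf unfolding Lp_linear_op_def by blast
  \<comment> \<open>Two terms within 1/3 of g are less than 2/3 apart, which contradicts the
    separation by 1.\<close>
  have "\<forall>\<^sub>F n in sequentially. Lp_norm I01 p (\<lambda>x. ?T (R (f (r n))) x - g x) < ennreal (1/3)"
    by (rule order_tendstoD(2)[OF lim]) simp
  then obtain n where n: "\<forall>k\<ge>n. Lp_norm I01 p (\<lambda>x. ?T (R (f (r k))) x - g x) < ennreal (1/3)"
    unfolding eventually_sequentially by blast
  have close: "Lpn p (\<lambda>x. f (r k) x - g x) < 1/3" if "k \<ge> n" for k
  proof -
    have d: "(\<lambda>x. ?T (R (f (r k))) x - g x) \<in> Lp_space I01 p" by (rule Lp_diff(1)[OF p TRf g])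
    have "AE x in I01. f (r k) x - g x = ?T (R (f (r k))) x - g x"
      using TR[OF f(1)[of "r k"]] by eventually_elim simp
    from Lpn_AE_eq(2)[OF p d Lp_spaceD[OF Lp_diff(1)[OF p f(1) g]] this]
    have "Lpn p (\<lambda>x. f (r k) x - g x) = Lpn p (\<lambda>x. ?T (R (f (r k))) x - g x)" .
    moreover have "ennreal (Lpn p (\<lambda>x. ?T (R (f (r k))) x - g x)) < ennreal (1/3)"
      unfolding Lp_norm_eq[OF d, symmetric] using n that by blast
    ultimately show ?thesis by (simp add: ennreal_less_iff)
  qed
  have fg: "(\<lambda>x. f k x - g x) \<in> Lp_space I01 p" for k by (rule Lp_diff(1)[OF p f(1) g])
  have "1 \<le> Lpn p (\<lambda>x. f (r n) x - f (r (Suc n)) x)" by (rule f(3)) (use r in \<open>simp add: strict_mono_Suc_iff\<close>)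
  also have "\<dots> = Lpn p (\<lambda>x. (f (r n) x - g x) - (f (r (Suc n)) x - g x))" by simp
  also have "\<dots> \<le> Lpn p (\<lambda>x. f (r n) x - g x) + Lpn p (\<lambda>x. f (r (Suc n)) x - g x)"
    by (rule Lp_diff(2)[OF p fg fg])
  also have "\<dots> < 1/3 + 1/3" by (intro add_strict_mono close) auto
  finally show False by simp
qed

theorem theorem2p5:
  fixes b1 b2 :: real and Q12 Q21 :: "real \<Rightarrow> complex" and s :: complex
  assumes "b1 < 0" and "0 < b2"
    and "set_integrable lebesgue {0..1} Q12"
    and "set_integrable lebesgue {0..1} Q21"
    and "s = 1 \<or> s = -1"
  shows "\<exists>K :: real \<times> real \<Rightarrow> complex^2^2.
     (\<forall>j k. (\<lambda>z. K z $ j $ k) \<in> X1_0_space \<inter> Xinf_0_space) \<and>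
     (\<forall>x\<in>{0..1}. \<forall>j k. is_trace (\<lambda>z. K z $ j $ k) x (\<lambda>t. K (x, t) $ j $ k)) \<and>
     (\<forall>lam e. is_solution b1 b2 Q12 Q21 lam e \<and> e 0 = vector [1, s] \<longrightarrow>
        (\<forall>x\<in>{0..1}. e x = e0 b1 b2 s lam x + triangular_op K (e0 b1 b2 s lam) x)) \<and>
     (\<forall>p\<ge>1. Lp_Volterra_op (lebesgue_on {0..1}) p (triangular_op K) \<and>
        Lp_spectrum (lebesgue_on {0..1}) p (triangular_op K) = {0})"
proof -
  obtain K :: "real \<times> real \<Rightarrow> complex^2^2" where entries: "\<forall>i j. approximable_kernel (\<lambda>z. K z $ i $ j)"
    and repr: "\<forall>lam e. is_solution b1 b2 Q12 Q21 lam e \<and> e 0 = vector [1, s] \<longrightarrow>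
        (\<forall>x\<in>{0..1}. e x = e0 b1 b2 s lam x + triangular_op K (e0 b1 b2 s lam) x)"
    using transformation_kernel_exists[OF assms] by blast
  \<comment> \<open>The function spaces and the traces are stated for the entries, whereas the
    operator estimates use the norm of the matrix.\<close>
  have K: "approximable_kernel K" using entries by (intro approximable_vec) blast
  have spec: "Lp_spectrum I01 p (triangular_op K) = {0}" if p: "p \<ge> 1" for p
  proof -
    have "\<mu> \<notin> Lp_spectrum I01 p (triangular_op K)" if "\<mu> \<noteq> 0" for \<mu>
      by (rule volterra_resolvent.not_in_spectrum) (unfold_locales, fact K, fact p, fact that)
    then show ?thesis using zero_in_spectrum[OF K p] by blast
  qed
  show ?thesis
  proof (intro exI[of _ K] conjI allI ballI impI)
    show "(\<lambda>z. K z $ j $ k) \<in> X1_0_space \<inter> Xinf_0_space" for j k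
      using approximable_kernel_spaces entries by blast
    show "is_trace (\<lambda>z. K z $ j $ k) x (\<lambda>t. K (x, t) $ j $ k)" if "x \<in> {0..1}" for x j k
      using approximable_kernel_trace[of "\<lambda>z. K z $ j $ k"] entries that by blast
    show "e x = e0 b1 b2 s lam x + triangular_op K (e0 b1 b2 s lam) x"
      if "is_solution b1 b2 Q12 Q21 lam e \<and> e 0 = vector [1, s]" "x \<in> {0..1}" for lam e x
      using repr that by blast
    show "Lp_Volterra_op (lebesgue_on {0..1}) p (triangular_op K)" if "1 \<le> p" for p
      unfolding Lp_Volterra_op_def using triangular_op_compact[OF K that] spec[OF that] by blast
    show "Lp_spectrum (lebesgue_on {0..1}) p (triangular_op K) = {0}" if "1 \<le> p" for p
      by (rule spec[OF that])
  qed
qed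

end
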